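(* (Completeness of the Universal Model) Let $\sigma=(S,M,V)$ be a signature with a modelable context structure $R$ on $V$, and let $E$ be an $R$-theory over $\sigma$. Let $\Sigma$ be the multicategorically extended signature of $\sigma$ and $R$, let $\overline{\sigma}$ be the categorization theory of $\sigma$, and let $\overline{E}=\overline\sigma\cup\widetilde E$ be the multicategorical $E$-theory. Let $C$ be the initial $\overline{E}$-model in $\mathbf{Set}$, regarded as a $\Delta_R$-multicategory, and let $m$ be the $E$-model in $C$. Then: 1. The pair $(C,m)$ is the initial object in the category of $\Delta_R$-multicategories with a choice of an $E$-model. 2. For every $R$-equation $\phi$, $E\vdash_R\phi$ if and only if $m\vDash\phi$.
   Context: **Finite ordinals and structure categories.** $[n]=\{1,\dots,n\}$ for $n\in\mathbb N$ ($0\in\mathbb N$); $\mathbf{FinOrd}$ is the category of the sets $[n]$ and all functions. For $f_i\colon[m_i]\to[n_i]$ ($i\le k$), $f_1+\dots+f_k\colon[M_k]\to[N_k]$ sends $M_{i-1}+x\mapsto N_{i-1}+f_i(x)$ for $0<x\le m_i$, where $M_i=\sum_{j\le i}m_j$, $N_i=\sum_{j\le i}n_j$. For $\theta\colon[m]\to[n]$ and $k_1,\dots,k_n\in\mathbb N$, the similarity component $\theta'_{k_1,\dots,k_n}\colon[k_{\theta(1)}+\dots+k_{\theta(m)}]\to[k_1+\dots+k_n]$ sends $L_{i-1}+x\mapsto K_{\theta(i)-1}+x$ for $0<x\le k_{\theta(i)}$, where $L_i=k_{\theta(1)}+\dots+k_{\theta(i)}$, $K_j=k_1+\dots+k_j$.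 A structure category is a wide subcategory $\Delta$ of $\mathbf{FinOrd}$ closed under coproducts of morphisms and such that $\theta\in\Delta$ implies that all $\theta'_{k_1,\dots,k_n}\in\Delta$. **$\Delta$-multicategories.** A $\Delta$-multicategory $C$ has a class of objects, sets $C(a,b)$ of multimorphisms $f\colon a\to b$ for each finite word $a$ of objects and object $b$, compositions $C(b_1\cdots b_n,c)\times C(a^1,b_1)\times\dots\times C(a^n,b_n)\to C(a^1\cdots a^n,c)$, $(g,f_1,\dots,f_n)\mapsto g\circ(f_1,\dots,f_n)$, identities $id_a\colon a\to a$, and for each $\theta\colon[m]\to[n]$ in $\Delta$ functions $\theta_{a_1\cdots a_n,b,*}\colon C(a_{\theta(1)}\cdots a_{\theta(m)},b)\to C(a_1\cdots a_n,b)$ (indices often dropped), such that composition is associative and unital (the usual multicategory axioms) and: (1) $(id_{[n]})_*=id$; (2) $(\tau\sigma)_{*}=\tau_{*}\circ\sigma_{*}$ for composable $\sigma,\tau$ in $\Delta$; (3) $g\circ(\sigma^1_*(f_1),\dots,\sigma^n_*(f_n))=(\sigma^1+\dots+\sigma^n)_*(g\circ(f_1,\dots,f_n))$ for $\sigma^i\colon[k_i]\to[l_i]$ in $\Delta$, $g\colon b_1\cdots b_n\to c$, $f_i\colon a^i_{\sigma^i(1)}\cdots a^i_{\sigma^i(k_i)}\to b_i$; (4) $\tau_*(g)\circ(f_1,\dots,f_n)=(\tau'_{k_1,\dots,k_n})_*(g\circ(f_{\tau(1)},\dots,f_{\tau(m)}))$ for $\tau\colon[m]\to[n]$ in $\Delta$,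 $f_i\colon a^i\to b_i$ with $a^i$ of length $k_i$, and $g\colon b_{\tau(1)}\cdots b_{\tau(m)}\to c$. A morphism of $\Delta$-multicategories is a map on objects and on multimorphisms preserving composition, identities and the $\Delta$-action. **Context structures.** For a set $V$, a context is a word in $V^*$ with no repeated letter; $\mathcal C$ is the set of contexts; $\mathrm{Var}(v)$ is the set of letters of $v$. A context structure on $V$ is a relation $R\subset \mathcal C\times V^*$ with: (1) $cRc$ for all contexts $c$; (2) $cRv$ implies $\mathrm{Var}(v)\subset\mathrm{Var}(c)$; (3) $cRv^1\cdots v^n$ and $v^iRw^i$ for $i\le n$ imply $cRw^1\cdots w^n$; (4) if $cRv$, $s\colon\mathrm{Var}(c)\to V^*$ and $dRs(c)$, then $dRs(v)$, where $s(v_1\cdots v_n)=s(v_1)\cdots s(v_n)$. $R$ is modelable if $cRv^1\cdots v^n$ implies there are contexts $c^1,\dots,c^n$ with $cRc^1\cdots c^n$ and $c^iRv^i$. A word $v$ is an $R$-word if $cRv$ for some context $c$; a context $c$ is a terminal $R$-context of $v$ if for all contexts $w$, $wRc$ iff $wRv$ (for modelable $R$ on infinite $V$ every $R$-word has one). $\Delta_R$ is the structure category of those $\theta\colon[m]\to[n]$ with $c_1\cdots c_nRc_{\theta(1)}\cdots c_{\theta(m)}$ for a context $c=c_1\cdots c_n$. **Syntax.** A signature $\sigma=(S,M,V)$ consists of a set $S$ of sorts, a set $M$ of function symbols $f\colon a\to b$ typed by $(a,b)\in S^*\times S$ (constants when $a=()$), and a set $V$ of typed variables $x\colon s$ with countably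 infinitely many of each sort. Terms are built as usual, respecting types. $\tau(x)=x$, $\tau(c)=()$, $\tau(f(t_1,\dots,t_n))=\tau(t_1)\cdots\tau(t_n)$. A context $c$ is an $R$-context for $t$ if $cR\tau(t)$. An $R$-equation $t_1\approx_vt_2$ is a pair of terms of the same sort with a common $R$-context $v$; an $R$-theory is a set of $R$-equations. For a context $v=v_1\cdots v_n$, an $R$-renaming of $v$ is a triple $(s,w,(w_i)_{i\le n})$ where $s$ is a type-preserving map from $\mathrm{Var}(v)$ to terms (extended by substitution), $w,w_i$ are contexts, $wRw_1\cdots w_n$ and $w_iR\tau(s(v_i))$ for all $i$. **Deduction.** $D^R_E$ is the smallest set $D$ of $R$-equations containing $E$, containing $t\approx_vt$ for every term $t$ with $R$-context $v$, closed under symmetry and transitivity (in a fixed context), and such that if $t_1\approx_vt_2\in D$, $v=v_1\cdots v_n$, and $(s_1,w,(w_i)),(s_2,w,(w_i))$ are $R$-renamings of $v$ with $s_1(v_i)\approx_{w_i}s_2(v_i)\in D$ for all $i$, then $s_1(t_1)\approx_ws_2(t_2)\in D$. $E\vdash_R\phi$ means $\phi\in D^R_E$. **Models.** A $\sigma$-model $m$ in a multicategory $C$ assigns an object $m(s)$ to each sort and a multimorphism $m(f)\colon m(a_1)\cdots m(a_n)\to m(b)$ to each $f\colon a_1\cdots a_n\to b$. For $v=v_1\cdots v_n$ with $v_i\colon a_i$, $m_v=m(a_1)\cdots m(a_n)$. In a $\Delta_R$-multicategory, if $v=v_1\cdots v_n$ is a context, $vRw$, $w=v_{\theta(1)}\cdots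 v_{\theta(k)}$ and $g\colon m_w\to b$, write $g*m_{v,w}=\theta_{m_v,b,*}(g)\colon m_v\to b$. For a term $t\colon b$ with $R$-context $v$ define $m_v(t)\colon m_v\to m(b)$ by $m_v(v_i)=id_{m(b)}*m_{v,v_i}$; $m_v(c)=m(c)*m_{v,()}$; $m_v(f(t_1,\dots,t_k))=(m(f)\circ(m_{w_1}(t_1),\dots,m_{w_k}(t_k)))*m_{v,w_1\cdots w_k}$ for any contexts $w_i$ with $w_iR\tau(t_i)$ and $vRw_1\cdots w_k$. $m\vDash t_1\approx_vt_2$ means $m_v(t_1)=m_v(t_2)$. An $E$-model is a model satisfying all equations of $E$. The category of $\Delta_R$-multicategories with a choice of an $E$-model has as objects pairs $(D,n)$ with $n$ an $E$-model in the $\Delta_R$-multicategory $D$; morphisms $(D,n)\to(D',n')$ are morphisms $T\colon D\to D'$ of $\Delta_R$-multicategories with $T(n(s))=n'(s)$ and $T(n(f))=n'(f)$ for all sorts $s$ and function symbols $f$. **The signature $\Sigma$.** Its sorts are the elements of $S^*\times S$. Its function symbols are: composition symbols $\circ\colon(b_1\cdots b_n,c)(a^1,b_1)\cdots(a^n,b_n)\to(a^1\cdots a^n,c)$; identity constants $id_c\colon(c,c)$; action symbols $\theta_{*,b_1\cdots b_n,c}\colon(b_{\theta(1)}\cdots b_{\theta(m)},c)\to(b_1\cdots b_n,c)$ for $\theta\colon[m]\to[n]$ in $\Delta_R$; and a constant $f\colon(a,b)$ for each $f\colon a\to b$ in $M$ (here $b,b_i,c\in S$, $a,a^i\in S^*$).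 **The theory $\overline\sigma$** consists of the $\Sigma$-equations, with distinct variables of the appropriate sorts and in the context of the displayed variables, expressing exactly the axioms of a $\Delta_R$-multicategory with object set $S$: $\circ(\circ(h,g_1,\dots,g_n),f^1_1,\dots,f^n_{m_n})\approx\circ(h,\circ(g_1,f^1_1,\dots,f^1_{m_1}),\dots,\circ(g_n,f^n_1,\dots,f^n_{m_n}))$; $\circ(id,h)\approx h$; $\circ(h,id,\dots,id)\approx h$; $(id_{[n]})_*(h)\approx h$; $(\phi\theta)_*(h)\approx\phi_*(\theta_*(h))$; $\circ(\theta_*(h),g_1,\dots,g_n)\approx(\theta'_{m_1,\dots,m_n})_*(\circ(h,g_{\theta(1)},\dots,g_{\theta(m)}))$, where $g_i$ has a source word of length $m_i$; $\circ(h,\theta^1_*(g_1),\dots,\theta^n_*(g_n))\approx(\theta^1+\dots+\theta^n)_*(\circ(h,g_1,\dots,g_n))$; for all $\theta,\phi,\theta^i$ in $\Delta_R$ for which these are well-typed. **The theory $\widetilde E$.** Choose a terminal $R$-context $\overline w$ for each $R$-word $w$. For a context $v=v_1\cdots v_n$, $v_i\colon a_i$, with $vRw$, $w=v_{\theta(1)}\cdots v_{\theta(k)}$, let $N_{v,w,b}$ be the symbol $\theta_{*,a_1\cdots a_n,b}$. For a term $t\colon b$ with $R$-context $v$ define the closed (variable-free) $\Sigma$-term $N_v(t)\colon(a_1\cdots a_n,b)$: $N_v(c)=N_{v,(),b}(c)$ for constants; $N_v(v_i)=N_{v,v_i,a_i}(id_{a_i})$; $N_v(f(t_1,\dots,t_k))=N_{v,\overline{\tau(t_1)}\cdots\overline{\tau(t_k)},b}(\circ(f,N_{\overline{\tau(t_1)}}(t_1),\dots,N_{\overline{\tau(t_k)}}(t_k)))$.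 Then $\widetilde E=\{N_v(t_1)\approx_{()}N_v(t_2)\mid t_1\approx_vt_2\in E\}$. An $\overline E$-model in $\mathbf{Set}$ (a $\Sigma$-algebra satisfying all equations of $\overline E$) is the same as a $\Delta_R$-multicategory with object set $S$ (the set of multimorphisms $a\to b$ being the carrier of sort $(a,b)$) equipped with an $E$-model sending each sort $s$ to $s$ and each $f\in M$ to the interpretation of the constant $f$. This gives the $\Delta_R$-multicategory structure on $C$ and the $E$-model $m$ in $C$. *)

theory Defs
  imports Main "HOL-Library.Countable_Set"
begin

section \<open>Finite ordinals and structure categories\<close>

text \<open>
  Indices are 0-based: the finite ordinal with \<open>n\<close> elements is \<open>{..<n}\<close>, so that a map
  between finite ordinals can be applied directly to positions of lists.  A map
  \<open>\<theta> : [m] \<rightarrow> [n]\<close> is its list of values \<open>\<theta>(0), \<dots>, \<theta>(m - 1)\<close> together with \<open>n\<close>;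
  equality of such data is equality of morphisms.
\<close>

datatype finmap = FinMap (vals: "nat list") (tgt: nat)

definition src :: "finmap \<Rightarrow> nat" where
  "src \<theta> = length (vals \<theta>)"

definition is_finmap :: "finmap \<Rightarrow> bool" where
  "is_finmap \<theta> \<longleftrightarrow> (\<forall>i\<in>set (vals \<theta>). i < tgt \<theta>)"

definition fid :: "nat \<Rightarrow> finmap" where
  "fid n = FinMap [0..<n] n"

text \<open>\<open>pull \<theta> (x\<^sub>1 \<dots> x\<^sub>n)\<close> is the word \<open>x\<^bsub>\<theta>(1)\<^esub> \<dots> x\<^bsub>\<theta>(m)\<^esub>\<close>.\<close>

definition pull :: "finmap \<Rightarrow> 'a list \<Rightarrow> 'a list" where
  "pull \<theta> xs = map (\<lambda>i. xs ! i) (vals \<theta>)"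

text \<open>\<open>fcomp \<tau> \<sigma>\<close> is \<open>\<tau> \<circ> \<sigma>\<close>, used when \<open>tgt \<sigma> = src \<tau>\<close>.\<close>

definition fcomp :: "finmap \<Rightarrow> finmap \<Rightarrow> finmap" where
  "fcomp \<tau> \<sigma> = FinMap (pull \<sigma> (vals \<tau>)) (tgt \<tau>)"

text \<open>The coproduct \<open>f\<^sub>1 + \<dots> + f\<^sub>k\<close>: the \<open>i\<close>-th block of values is shifted by
  \<open>N\<^bsub>i-1\<^esub> = n\<^sub>1 + \<dots> + n\<^bsub>i-1\<^esub>\<close>.\<close>

definition fsum :: "finmap list \<Rightarrow> finmap" where
  "fsum fs = FinMap
     (concat (map (\<lambda>i. map (\<lambda>y. sum_list (map tgt (take i fs)) + y) (vals (fs ! i)))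
               [0..<length fs]))
     (sum_list (map tgt fs))"

text \<open>The similarity component \<open>\<theta>'\<^bsub>k\<^sub>1,\<dots>,k\<^sub>n\<^esub>\<close>: the \<open>i\<close>-th block of values runs through the
  \<open>\<theta>(i)\<close>-th block \<open>{K\<^bsub>\<theta>(i)-1\<^esub> ..< K\<^bsub>\<theta>(i)\<^esub>}\<close> of the target.\<close>

definition fsim :: "finmap \<Rightarrow> nat list \<Rightarrow> finmap" where
  "fsim \<theta> ks = FinMap
     (concat (map (\<lambda>j. [sum_list (take j ks) ..< sum_list (take (Suc j) ks)]) (vals \<theta>)))
     (sum_list ks)"

definition structure_category :: "finmap set \<Rightarrow> bool" where
  "structure_category \<Delta> \<longleftrightarrow>
     (\<forall>\<theta>\<in>\<Delta>. is_finmap \<theta>) \<and>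
     (\<forall>n. fid n \<in> \<Delta>) \<and>
     (\<forall>\<sigma>\<in>\<Delta>. \<forall>\<tau>\<in>\<Delta>. tgt \<sigma> = src \<tau> \<longrightarrow> fcomp \<tau> \<sigma> \<in> \<Delta>) \<and>
     (\<forall>fs. set fs \<subseteq> \<Delta> \<longrightarrow> fsum fs \<in> \<Delta>) \<and>
     (\<forall>\<theta>\<in>\<Delta>. \<forall>ks. length ks = tgt \<theta> \<longrightarrow> fsim \<theta> ks \<in> \<Delta>)"


section \<open>Multicategories with an action of a structure category\<close>

text \<open>
  The sets \<open>hom C a b\<close> are not required to be disjoint, so composition and action carry the
  words and objects that type their arguments:
  \<open>mcomp C b c a g fs\<close> is \<open>g \<circ> (f\<^sub>1, \<dots>, f\<^sub>n)\<close> for \<open>g : b\<^sub>1 \<dots> b\<^sub>n \<rightarrow> c\<close> and \<open>f\<^sub>i : a\<^sup>i \<rightarrow> b\<^sub>i\<close>, and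
  \<open>mact C \<theta> a b\<close> is \<open>\<theta>\<^bsub>a,b,*\<^esub> : C(a\<^bsub>\<theta>(1)\<^esub> \<dots> a\<^bsub>\<theta>(m)\<^esub>, b) \<rightarrow> C(a\<^sub>1 \<dots> a\<^sub>n, b)\<close>.
\<close>

record ('o, 'm) multicat =
  obj :: "'o set"
  hom :: "'o list \<Rightarrow> 'o \<Rightarrow> 'm set"
  mcomp :: "'o list \<Rightarrow> 'o \<Rightarrow> 'o list list \<Rightarrow> 'm \<Rightarrow> 'm list \<Rightarrow> 'm"
  mident :: "'o \<Rightarrow> 'm"
  mact :: "finmap \<Rightarrow> 'o list \<Rightarrow> 'o \<Rightarrow> 'm \<Rightarrow> 'm"

text \<open>\<open>homs C a b fs\<close>: \<open>fs\<close> is a family of multimorphisms \<open>f\<^sub>i : a\<^sup>i \<rightarrow> b\<^sub>i\<close>.\<close>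

definition homs :: "('o, 'm) multicat \<Rightarrow> 'o list list \<Rightarrow> 'o list \<Rightarrow> 'm list \<Rightarrow> bool" where
  "homs C as bs fs \<longleftrightarrow>
     bs \<in> lists (obj C) \<and> as \<in> lists (lists (obj C)) \<and>
     length as = length bs \<and> length fs = length bs \<and>
     (\<forall>i<length bs. fs ! i \<in> hom C (as ! i) (bs ! i))"

text \<open>
  The locale does not itself require \<open>\<Delta>\<close> to be a structure category; below it is used for
  \<open>\<Delta> = Delta R\<close>, see \<open>structure_category_Delta\<close>.
\<close>

locale multicategory =
  fixes \<Delta> :: "finmap set" and C :: "('o, 'm) multicat"
  assumes comp_closed:
      "\<lbrakk>c \<in> obj C; g \<in> hom C bs c; homs C as bs fs\<rbrakk>
       \<Longrightarrow> mcomp C bs c as g fs \<in> hom C (concat as) c"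
    and ident_closed: "c \<in> obj C \<Longrightarrow> mident C c \<in> hom C [c] c"
    and act_closed:
      "\<lbrakk>\<theta> \<in> \<Delta>; a \<in> lists (obj C); length a = tgt \<theta>; b \<in> obj C; f \<in> hom C (pull \<theta> a) b\<rbrakk>
       \<Longrightarrow> mact C \<theta> a b f \<in> hom C a b"
    and comp_assoc:
      "\<lbrakk>d \<in> obj C; h \<in> hom C cs d; homs C bss cs gs;
        length asss = length cs; length fss = length cs;
        \<forall>i<length cs. homs C (asss ! i) (bss ! i) (fss ! i)\<rbrakk>
       \<Longrightarrow> mcomp C (concat bss) d (concat asss) (mcomp C cs d bss h gs) (concat fss)
         = mcomp C cs d (map concat asss) h
             (map (\<lambda>i. mcomp C (bss ! i) (cs ! i) (asss ! i) (gs ! i) (fss ! i)) [0..<length cs])"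
    and comp_ident_left:
      "\<lbrakk>a \<in> lists (obj C); b \<in> obj C; f \<in> hom C a b\<rbrakk>
       \<Longrightarrow> mcomp C [b] b [a] (mident C b) [f] = f"
    and comp_ident_right:
      "\<lbrakk>a \<in> lists (obj C); b \<in> obj C; f \<in> hom C a b\<rbrakk>
       \<Longrightarrow> mcomp C a b (map (\<lambda>x. [x]) a) f (map (mident C) a) = f"
    and act_id:
      "\<lbrakk>a \<in> lists (obj C); b \<in> obj C; f \<in> hom C a b\<rbrakk>
       \<Longrightarrow> mact C (fid (length a)) a b f = f"
    and act_fcomp:
      "\<lbrakk>\<sigma> \<in> \<Delta>; \<tau> \<in> \<Delta>; tgt \<sigma> = src \<tau>; a \<in> lists (obj C); length a = tgt \<tau>; b \<in> obj C;
        f \<in> hom C (pull (fcomp \<tau> \<sigma>) a) b\<rbrakk>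
       \<Longrightarrow> mact C (fcomp \<tau> \<sigma>) a b f = mact C \<tau> a b (mact C \<sigma> (pull \<tau> a) b f)"
    and comp_act_inner:
      "\<lbrakk>set \<sigma>s \<subseteq> \<Delta>; length \<sigma>s = length bs;
        as \<in> lists (lists (obj C)); map length as = map tgt \<sigma>s;
        c \<in> obj C; g \<in> hom C bs c; homs C (map2 pull \<sigma>s as) bs fs\<rbrakk>
       \<Longrightarrow> mcomp C bs c as g
             (map (\<lambda>i. mact C (\<sigma>s ! i) (as ! i) (bs ! i) (fs ! i)) [0..<length bs])
         = mact C (fsum \<sigma>s) (concat as) c (mcomp C bs c (map2 pull \<sigma>s as) g fs)"
    and comp_act_outer:
      "\<lbrakk>\<tau> \<in> \<Delta>; length bs = tgt \<tau>; c \<in> obj C; g \<in> hom C (pull \<tau> bs) c; homs C as bs fs\<rbrakk>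
       \<Longrightarrow> mcomp C bs c as (mact C \<tau> bs c g) fs
         = mact C (fsim \<tau> (map length as)) (concat as) c
             (mcomp C (pull \<tau> bs) c (pull \<tau> as) g (pull \<tau> fs))"

text \<open>A morphism is a pair of a map \<open>F\<close> on objects and a family of maps
  \<open>G a b : C(a, b) \<rightarrow> D(F a, F b)\<close>.\<close>

definition multicat_morphism ::
  "finmap set \<Rightarrow> ('o, 'm) multicat \<Rightarrow> ('p, 'n) multicat
   \<Rightarrow> ('o \<Rightarrow> 'p) \<Rightarrow> ('o list \<Rightarrow> 'o \<Rightarrow> 'm \<Rightarrow> 'n) \<Rightarrow> bool" where
  "multicat_morphism \<Delta> C D F G \<longleftrightarrow>
     (\<forall>a\<in>obj C. F a \<in> obj D) \<and>
     (\<forall>a\<in>lists (obj C). \<forall>b\<in>obj C. \<forall>f\<in>hom C a b. G a b f \<in> hom D (map F a) (F b)) \<and>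
     (\<forall>bs. \<forall>c\<in>obj C. \<forall>as. \<forall>g\<in>hom C bs c. \<forall>fs. homs C as bs fs \<longrightarrow>
        G (concat as) c (mcomp C bs c as g fs)
        = mcomp D (map F bs) (F c) (map (map F) as) (G bs c g)
            (map (\<lambda>i. G (as ! i) (bs ! i) (fs ! i)) [0..<length bs])) \<and>
     (\<forall>a\<in>obj C. G [a] a (mident C a) = mident D (F a)) \<and>
     (\<forall>\<theta>\<in>\<Delta>. \<forall>a\<in>lists (obj C). \<forall>b\<in>obj C. length a = tgt \<theta> \<longrightarrow>
        (\<forall>f\<in>hom C (pull \<theta> a) b.
           G a b (mact C \<theta> a b f) = mact D \<theta> (map F a) (F b) (G (pull \<theta> a) b f)))"

text \<open>Equality of morphisms out of \<open>C\<close>; values outside the carriers of \<open>C\<close> are irrelevant.\<close>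

definition multicat_morphism_eq ::
  "('o, 'm) multicat \<Rightarrow> ('o \<Rightarrow> 'p) \<Rightarrow> ('o list \<Rightarrow> 'o \<Rightarrow> 'm \<Rightarrow> 'n)
   \<Rightarrow> ('o \<Rightarrow> 'p) \<Rightarrow> ('o list \<Rightarrow> 'o \<Rightarrow> 'm \<Rightarrow> 'n) \<Rightarrow> bool" where
  "multicat_morphism_eq C F G F' G' \<longleftrightarrow>
     (\<forall>a\<in>obj C. F a = F' a) \<and>
     (\<forall>a\<in>lists (obj C). \<forall>b\<in>obj C. \<forall>f\<in>hom C a b. G a b f = G' a b f)"


section \<open>Context structures\<close>

definition is_context :: "'v set \<Rightarrow> 'v list \<Rightarrow> bool" where
  "is_context V c \<longleftrightarrow> distinct c \<and> set c \<subseteq> V"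

locale context_structure =
  fixes V :: "'v set" and R :: "'v list \<Rightarrow> 'v list \<Rightarrow> bool"
  assumes R_domain: "R c v \<Longrightarrow> is_context V c \<and> set v \<subseteq> V"
    and R_refl: "is_context V c \<Longrightarrow> R c c"
    and R_vars: "R c v \<Longrightarrow> set v \<subseteq> set c"
    and R_comp: "\<lbrakk>R c (concat vs); list_all2 R vs ws\<rbrakk> \<Longrightarrow> R c (concat ws)"
    and R_subst:
      "\<lbrakk>R c v; \<forall>x\<in>set c. set (s x) \<subseteq> V; R d (concat (map s c))\<rbrakk> \<Longrightarrow> R d (concat (map s v))"

definition modelable :: "('v list \<Rightarrow> 'v list \<Rightarrow> bool) \<Rightarrow> bool" where
  "modelable R \<longleftrightarrow>
     (\<forall>c vs. R c (concat vs) \<longrightarrow> (\<exists>cs. R c (concat cs) \<and> list_all2 R cs vs))"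

definition R_word :: "('v list \<Rightarrow> 'v list \<Rightarrow> bool) \<Rightarrow> 'v list \<Rightarrow> bool" where
  "R_word R v \<longleftrightarrow> (\<exists>c. R c v)"

definition terminal_context ::
  "'v set \<Rightarrow> ('v list \<Rightarrow> 'v list \<Rightarrow> bool) \<Rightarrow> 'v list \<Rightarrow> 'v list \<Rightarrow> bool" where
  "terminal_context V R v c \<longleftrightarrow>
     is_context V c \<and> (\<forall>w. is_context V w \<longrightarrow> (R w c \<longleftrightarrow> R w v))"

text \<open>A choice of a terminal context \<open>tc w\<close> for every \<open>R\<close>-word \<open>w\<close>.\<close>

definition terminal_choice ::
  "'v set \<Rightarrow> ('v list \<Rightarrow> 'v list \<Rightarrow> bool) \<Rightarrow> ('v list \<Rightarrow> 'v list) \<Rightarrow> bool" where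
  "terminal_choice V R tc \<longleftrightarrow> (\<forall>w. R_word R w \<longrightarrow> terminal_context V R w (tc w))"

definition Delta :: "('v list \<Rightarrow> 'v list \<Rightarrow> bool) \<Rightarrow> finmap set" where
  "Delta R = {\<theta>. is_finmap \<theta> \<and> (\<exists>c. length c = tgt \<theta> \<and> R c (pull \<theta> c))}"

text \<open>\<open>Delta R\<close> is a structure category as soon as there are contexts of every length.\<close>

lemma nth_concat_block:
  assumes "j < length as" "y < length (as ! j)"
  shows "concat as ! (sum_list (take j (map length as)) + y) = as ! j ! y"
  using assms
proof (induction as arbitrary: j)
  case (Cons a as)
  show ?case
  proof (cases j)
    case 0 then show ?thesis using Cons by (simp add: nth_append)
  next
    case (Suc k) then show ?thesis using Cons by (simp add: nth_append add.assoc)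
  qed
qed simp

lemma pull_fsum:
  assumes "map length as = map tgt fs" "\<forall>f\<in>set fs. is_finmap f"
  shows "pull (fsum fs) (concat as) = concat (map2 pull fs as)"
proof -
  have len: "length as = length fs" using assms(1) by (metis length_map)
  have "pull (fsum fs) (concat as)
     = concat (map (\<lambda>i. map (\<lambda>y. concat as ! (sum_list (take i (map length as)) + y)) (vals (fs ! i))) [0..<length fs])"
    unfolding pull_def fsum_def by (simp add: map_concat comp_def take_map assms(1))
  also have "\<dots> = concat (map (\<lambda>i. pull (fs ! i) (as ! i)) [0..<length fs])"
  proof (intro arg_cong[where f=concat] map_cong refl)
    fix i assume "i \<in> set [0..<length fs]"
    then have i: "i < length fs" by simp
    have l: "length (as ! i) = tgt (fs ! i)" using assms(1) i len by (metis nth_map)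
    show "map (\<lambda>y. concat as ! (sum_list (take i (map length as)) + y)) (vals (fs ! i)) = pull (fs ! i) (as ! i)"
      unfolding pull_def using nth_concat_block[of i as] i len l assms(2) unfolding is_finmap_def by auto
  qed
  also have "map (\<lambda>i. pull (fs ! i) (as ! i)) [0..<length fs] = map2 pull fs as"
    by (rule nth_equalityI) (auto simp: len)
  finally show ?thesis .
qed

lemma pull_fsim:
  assumes "is_finmap \<theta>" "length as = tgt \<theta>"
  shows "pull (fsim \<theta> (map length as)) (concat as) = concat (pull \<theta> as)"
proof -
  have "pull (fsim \<theta> (map length as)) (concat as) =
    concat (map (\<lambda>j. map ((!) (concat as)) [sum_list (take j (map length as)) ..< sum_list (take (Suc j) (map length as))]) (vals \<theta>))"
    unfolding pull_def fsim_def by (simp add: map_concat comp_def)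
  also have "\<dots> = concat (pull \<theta> as)"
    unfolding pull_def
  proof (intro arg_cong[where f=concat] map_cong refl)
    fix j assume "j \<in> set (vals \<theta>)"
    then have j: "j < length as" using assms unfolding is_finmap_def by auto
    have e: "sum_list (take (Suc j) (map length as)) = sum_list (take j (map length as)) + length (as ! j)"
      using j by (simp add: take_Suc_conv_app_nth)
    show "map ((!) (concat as)) [sum_list (take j (map length as)) ..< sum_list (take (Suc j) (map length as))] = as ! j"
      unfolding e by (rule nth_equalityI) (auto simp: nth_concat_block j)
  qed
  finally show ?thesis .
qed

lemma split_blocks: "sum_list ks = length d \<Longrightarrow> \<exists>ds. concat ds = d \<and> map length ds = (ks :: nat list)"
proof (induction ks arbitrary: d)
  case (Cons k ks)
  then obtain ds where "concat ds = drop k d" "map length ds = ks"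
    by (metis length_drop sum_list.Cons add_diff_cancel_left')
  moreover have "length (take k d) = k" using Cons.prems by simp
  ultimately show ?case
    by (intro exI[of _ "take k d # ds"]) simp
qed simp

lemma ex_fun_map: "distinct c \<Longrightarrow> length c = length ws \<Longrightarrow> \<exists>s. map s c = ws"
proof (induction c arbitrary: ws)
  case (Cons x c)
  then obtain w ws' where ws: "ws = w # ws'" by (cases ws) auto
  with Cons obtain s where "map s c = ws'" by auto
  then have "map (s(x := w)) (x # c) = ws" using Cons.prems ws by (auto intro: map_cong)
  then show ?case by blast
qed simp

lemma map_pull: "is_finmap \<theta> \<Longrightarrow> length c = tgt \<theta> \<Longrightarrow> map s (pull \<theta> c) = pull \<theta> (map s c)"
  unfolding pull_def is_finmap_def by auto

lemma map2_all: "length xs = length ys \<Longrightarrow> (\<And>x y. (x,y) \<in> set (zip xs ys) \<Longrightarrow> P y (f x y)) \<Longrightarrow> list_all2 P ys (map2 f xs ys)"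
  by (auto simp: list_all2_conv_all_nth set_zip)

context context_structure begin

lemma Delta_subst:
  assumes "\<theta> \<in> Delta R" "length ws = tgt \<theta>" "R d (concat ws)" "\<forall>w\<in>set ws. set w \<subseteq> V"
  shows "R d (concat (pull \<theta> ws))"
proof -
  obtain c where c: "is_finmap \<theta>" "length c = tgt \<theta>" "R c (pull \<theta> c)"
    using assms(1) unfolding Delta_def by auto
  then have "distinct c" using R_domain is_context_def by blast
  then obtain s where s: "map s c = ws" using ex_fun_map c(2) assms(2) by metis
  have "R d (concat (map s (pull \<theta> c)))"
    by (rule R_subst[OF c(3)]) (use s assms in auto)
  then show ?thesis using map_pull c s by metis
qed

lemma Delta_context:
  assumes "\<theta> \<in> Delta R" "length c = tgt \<theta>" "is_context V c"
  shows "R c (pull \<theta> c)"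
proof -
  have "R c (concat (pull \<theta> (map (\<lambda>x. [x]) c)))"
    by (rule Delta_subst) (use assms R_refl in \<open>auto simp: is_context_def\<close>)
  moreover have "is_finmap \<theta>" using assms(1) Delta_def by auto
  moreover have "concat (map (\<lambda>x. [x]) xs) = xs" for xs :: "'v list" by (induction xs) auto
  ultimately show ?thesis using map_pull[of \<theta> c "\<lambda>x. [x]"] assms(2) by metis
qed

lemma ex_context: "infinite V \<Longrightarrow> \<exists>c. length c = n \<and> is_context V c"
proof -
  assume "infinite V"
  then obtain T where "T \<subseteq> V" "finite T" "card T = n" using infinite_arbitrarily_large by metis
  then show ?thesis using finite_distinct_list[of T] distinct_card unfolding is_context_def by metis
qed

lemma structure_category_Delta:
  assumes "infinite V"
  shows "structure_category (Delta R)"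
  unfolding structure_category_def
proof (intro conjI allI ballI impI)
  fix \<theta> assume "\<theta> \<in> Delta R" then show "is_finmap \<theta>" by (simp add: Delta_def)
next
  fix n
  obtain c where c: "length c = n" "is_context V c" using ex_context assms by blast
  then have "pull (fid n) c = c" using map_nth[of c] by (simp add: pull_def fid_def)
  then show "fid n \<in> Delta R" using c R_refl unfolding Delta_def is_finmap_def
    by (auto simp: fid_def intro!: exI[of _ c])
next
  fix \<sigma> \<tau> assume s: "\<sigma> \<in> Delta R" and t: "\<tau> \<in> Delta R" and e: "tgt \<sigma> = src \<tau>"
  obtain c where c: "length c = tgt \<tau>" "is_context V c" using ex_context assms by blast
  have R: "R c (pull \<tau> c)" using Delta_context t c by blast
  have fs: "is_finmap \<sigma>" "is_finmap \<tau>" using s t Delta_def by auto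
  have "R c (concat (pull \<sigma> (map (\<lambda>x. [x]) (pull \<tau> c))))"
  proof (rule Delta_subst[OF s])
    have "concat (map (\<lambda>x. [x]) xs) = xs" for xs :: "'v list" by (induction xs) auto
    then show "R c (concat (map (\<lambda>x. [x]) (pull \<tau> c)))" using R by metis
    show "\<forall>w\<in>set (map (\<lambda>x. [x]) (pull \<tau> c)). set w \<subseteq> V" using R_domain[OF R] by auto
  qed (use e in \<open>simp add: pull_def src_def\<close>)
  moreover have "concat (map (\<lambda>x. [x]) xs) = xs" for xs :: "'v list" by (induction xs) auto
  moreover have "length (pull \<tau> c) = tgt \<sigma>" using e by (simp add: pull_def src_def)
  ultimately have "R c (pull \<sigma> (pull \<tau> c))"
    using map_pull[OF fs(1), of "pull \<tau> c" "\<lambda>x. [x]"] by metis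
  moreover have "pull \<sigma> (pull \<tau> c) = pull (fcomp \<tau> \<sigma>) c"
    using fs e by (auto simp: pull_def fcomp_def is_finmap_def src_def)
  moreover have "is_finmap (fcomp \<tau> \<sigma>)"
    using fs e unfolding is_finmap_def fcomp_def pull_def src_def by auto
  ultimately show "fcomp \<tau> \<sigma> \<in> Delta R" using c unfolding Delta_def by (auto simp: fcomp_def)
next
  fix fs assume sub: "set fs \<subseteq> Delta R"
  obtain c where c: "length c = sum_list (map tgt fs)" "is_context V c" using ex_context assms by blast
  obtain ds where ds: "concat ds = c" "map length ds = map tgt fs" using split_blocks c(1) by metis
  have len: "length ds = length fs" using ds(2) by (metis length_map)
  have fin: "\<forall>f\<in>set fs. is_finmap f" using sub Delta_def by auto
  have "list_all2 R ds (map2 pull fs ds)"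
  proof (rule map2_all)
    fix f d assume "(f, d) \<in> set (zip fs ds)"
    then obtain i where i: "i < length fs" "f = fs ! i" "d = ds ! i" by (auto simp: set_zip)
    then have "length d = tgt f" "d \<in> set ds" using ds(2) len by (metis nth_map, simp)
    moreover have "set d \<subseteq> set c" using \<open>d \<in> set ds\<close> ds(1)[symmetric] by auto
    then have "set d \<subseteq> V" using c(2) unfolding is_context_def by auto
    moreover have "distinct d" using \<open>d \<in> set ds\<close> c(2) ds(1) unfolding is_context_def
      by (auto simp: distinct_concat_iff)
    ultimately have "length d = tgt f" "is_context V d" using \<open>set d \<subseteq> V\<close> by (auto simp: is_context_def)
    moreover have "f \<in> Delta R" using sub i nth_mem by auto
    ultimately show "R d (pull f d)" by (intro Delta_context)
  qed (use len in simp)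
  then have "R c (concat (map2 pull fs ds))" using R_comp[of c ds] R_refl c ds by simp
  then have "R c (pull (fsum fs) c)" using pull_fsum[OF ds(2) fin] ds(1) by simp
  moreover have "is_finmap (fsum fs)"
    unfolding is_finmap_def fsum_def
  proof (clarsimp)
    fix i y assume i: "i < length fs" "y \<in> set (vals (fs ! i))"
    then have "y < tgt (fs ! i)" using fin unfolding is_finmap_def by auto
    then have "sum_list (map tgt (take i fs)) + y < sum_list (map tgt (take (Suc i) fs))"
      using i by (simp add: take_Suc_conv_app_nth)
    also have "\<dots> \<le> sum_list (map tgt fs)"
      by (metis append_take_drop_id le_add1 map_append sum_list_append)
    finally show "sum_list (map tgt (take i fs)) + y < sum_list (map tgt fs)" .
  qed
  ultimately show "fsum fs \<in> Delta R" using c unfolding Delta_def by (auto simp: fsum_def)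
next
  fix \<theta> and ks :: "nat list" assume t: "\<theta> \<in> Delta R" and l: "length ks = tgt \<theta>"
  obtain c where c: "length c = sum_list ks" "is_context V c" using ex_context assms by blast
  obtain ds where ds: "concat ds = c" "map length ds = ks" using split_blocks c(1) by metis
  have fin: "is_finmap \<theta>" using t Delta_def by auto
  have lds: "length ds = tgt \<theta>" using l ds by auto
  have sub: "\<forall>w\<in>set ds. set w \<subseteq> V" using c(2) unfolding ds(1)[symmetric] is_context_def set_concat by blast
  have Rc: "R c (concat ds)" using R_refl c ds by simp
  have "R c (concat (pull \<theta> ds))"
    by (rule Delta_subst[OF t lds Rc sub])
  then have "R c (pull (fsim \<theta> ks) c)" using pull_fsim[OF fin lds] ds by simp
  moreover have "is_finmap (fsim \<theta> ks)"
    unfolding is_finmap_def fsim_def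
  proof (clarsimp)
    fix j y assume "j \<in> set (vals \<theta>)" and y: "y < sum_list (take (Suc j) ks)"
    have "sum_list (take (Suc j) ks) \<le> sum_list ks"
      by (metis append_take_drop_id le_add1 sum_list_append)
    with y show "y < sum_list ks" by simp
  qed
  ultimately show "fsim \<theta> ks \<in> Delta R" using c unfolding Delta_def by (auto simp: fsim_def)
qed

end

text \<open>For a context \<open>v\<close> and \<open>set w \<subseteq> set v\<close>, the unique \<open>\<theta>\<close> with \<open>w = v\<^bsub>\<theta>(1)\<^esub> \<dots> v\<^bsub>\<theta>(k)\<^esub>\<close>.\<close>

definition theta_of :: "'v list \<Rightarrow> 'v list \<Rightarrow> finmap" where
  "theta_of v w = FinMap (map (\<lambda>x. LEAST i. i < length v \<and> v ! i = x) w) (length v)"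


section \<open>Syntax\<close>

record ('s, 'f, 'v) signature =
  sorts :: "'s set"
  funs :: "'f set"
  fdom :: "'f \<Rightarrow> 's list"
  fcod :: "'f \<Rightarrow> 's"
  vars :: "'v set"
  vsort :: "'v \<Rightarrow> 's"

definition wf_signature :: "('s, 'f, 'v) signature \<Rightarrow> bool" where
  "wf_signature sg \<longleftrightarrow>
     (\<forall>f\<in>funs sg. fdom sg f \<in> lists (sorts sg) \<and> fcod sg f \<in> sorts sg) \<and>
     (\<forall>x\<in>vars sg. vsort sg x \<in> sorts sg) \<and>
     (\<forall>s\<in>sorts sg. countable {x \<in> vars sg. vsort sg x = s} \<and>
                   infinite {x \<in> vars sg. vsort sg x = s})"

datatype ('f, 'v) trm = Var 'v | Fun 'f "('f, 'v) trm list"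

inductive has_sort :: "('s, 'f, 'v) signature \<Rightarrow> ('f, 'v) trm \<Rightarrow> 's \<Rightarrow> bool"
  for sg where
  has_sort_Var: "x \<in> vars sg \<Longrightarrow> has_sort sg (Var x) (vsort sg x)"
| has_sort_Fun: "\<lbrakk>f \<in> funs sg; list_all2 (has_sort sg) ts (fdom sg f)\<rbrakk>
    \<Longrightarrow> has_sort sg (Fun f ts) (fcod sg f)"

fun tau :: "('f, 'v) trm \<Rightarrow> 'v list" where
  "tau (Var x) = [x]"
| "tau (Fun f ts) = concat (map tau ts)"

fun subst :: "('v \<Rightarrow> ('f, 'v) trm) \<Rightarrow> ('f, 'v) trm \<Rightarrow> ('f, 'v) trm" where
  "subst s (Var x) = s x"
| "subst s (Fun f ts) = Fun f (map (subst s) ts)"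

text \<open>The triple \<open>(v, t\<^sub>1, t\<^sub>2)\<close> stands for \<open>t\<^sub>1 \<approx>\<^sub>v t\<^sub>2\<close>.\<close>

type_synonym ('f, 'v) eqn = "'v list \<times> ('f, 'v) trm \<times> ('f, 'v) trm"

definition R_equation ::
  "('s, 'f, 'v) signature \<Rightarrow> ('v list \<Rightarrow> 'v list \<Rightarrow> bool) \<Rightarrow> ('f, 'v) eqn \<Rightarrow> bool" where
  "R_equation sg R = (\<lambda>(v, t1, t2).
     (\<exists>b. has_sort sg t1 b \<and> has_sort sg t2 b) \<and> R v (tau t1) \<and> R v (tau t2))"

definition R_theory ::
  "('s, 'f, 'v) signature \<Rightarrow> ('v list \<Rightarrow> 'v list \<Rightarrow> bool) \<Rightarrow> ('f, 'v) eqn set \<Rightarrow> bool" where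
  "R_theory sg R E \<longleftrightarrow> (\<forall>\<phi>\<in>E. R_equation sg R \<phi>)"

text \<open>That \<open>w\<close> and the \<open>w\<^sub>i\<close> are contexts is part of the two conditions on \<open>R\<close>.\<close>

definition R_renaming ::
  "('s, 'f, 'v) signature \<Rightarrow> ('v list \<Rightarrow> 'v list \<Rightarrow> bool) \<Rightarrow> 'v list
   \<Rightarrow> ('v \<Rightarrow> ('f, 'v) trm) \<Rightarrow> 'v list \<Rightarrow> 'v list list \<Rightarrow> bool" where
  "R_renaming sg R v s w ws \<longleftrightarrow>
     (\<forall>x\<in>set v. has_sort sg (s x) (vsort sg x)) \<and>
     R w (concat ws) \<and> list_all2 R ws (map (\<lambda>x. tau (s x)) v)"


section \<open>Deduction\<close>

inductive_set deduct ::
  "('s, 'f, 'v) signature \<Rightarrow> ('v list \<Rightarrow> 'v list \<Rightarrow> bool) \<Rightarrow> ('f, 'v) eqn set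
   \<Rightarrow> ('f, 'v) eqn set"
  for sg R E where
  deduct_ax: "\<phi> \<in> E \<Longrightarrow> \<phi> \<in> deduct sg R E"
| deduct_refl: "\<lbrakk>has_sort sg t b; R v (tau t)\<rbrakk> \<Longrightarrow> (v, t, t) \<in> deduct sg R E"
| deduct_sym: "(v, t1, t2) \<in> deduct sg R E \<Longrightarrow> (v, t2, t1) \<in> deduct sg R E"
| deduct_trans: "\<lbrakk>(v, t1, t2) \<in> deduct sg R E; (v, t2, t3) \<in> deduct sg R E\<rbrakk>
    \<Longrightarrow> (v, t1, t3) \<in> deduct sg R E"
| deduct_subst: "\<lbrakk>(v, t1, t2) \<in> deduct sg R E;
     R_renaming sg R v s1 w ws; R_renaming sg R v s2 w ws;
     \<forall>i<length v. (ws ! i, s1 (v ! i), s2 (v ! i)) \<in> deduct sg R E\<rbrakk>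
    \<Longrightarrow> (w, subst s1 t1, subst s2 t2) \<in> deduct sg R E"


section \<open>Models in multicategories\<close>

record ('s, 'f, 'o, 'm) model =
  msort :: "'s \<Rightarrow> 'o"
  mfun :: "'f \<Rightarrow> 'm"

definition is_model ::
  "('s, 'f, 'v) signature \<Rightarrow> ('o, 'm) multicat \<Rightarrow> ('s, 'f, 'o, 'm) model \<Rightarrow> bool" where
  "is_model sg C m \<longleftrightarrow>
     (\<forall>s\<in>sorts sg. msort m s \<in> obj C) \<and>
     (\<forall>f\<in>funs sg. mfun m f \<in> hom C (map (msort m) (fdom sg f)) (msort m (fcod sg f)))"

definition mctx ::
  "('s, 'f, 'v) signature \<Rightarrow> ('s, 'f, 'o, 'm) model \<Rightarrow> 'v list \<Rightarrow> 'o list" where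
  "mctx sg m v = map (\<lambda>x. msort m (vsort sg x)) v"

text \<open>\<open>mres sg C m v w b g\<close> is \<open>g * m\<^bsub>v,w\<^esub>\<close> for \<open>g : m\<^sub>w \<rightarrow> b\<close>.\<close>

definition mres ::
  "('s, 'f, 'v) signature \<Rightarrow> ('o, 'm) multicat \<Rightarrow> ('s, 'f, 'o, 'm) model
   \<Rightarrow> 'v list \<Rightarrow> 'v list \<Rightarrow> 'o \<Rightarrow> 'm \<Rightarrow> 'm" where
  "mres sg C m v w b g = mact C (theta_of v w) (mctx sg m v) b g"

text \<open>
  \<open>m\<^sub>v(t)\<close> is defined by recursion on \<open>t\<close> using arbitrary contexts \<open>w\<^sub>i\<close> for the subterms.
  The relation \<open>mval_rel\<close> admits every such choice; its value does not depend on the choice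
  when \<open>R\<close> is modelable, and \<open>mval\<close> is that value.
\<close>

inductive mval_rel ::
  "('s, 'f, 'v) signature \<Rightarrow> ('v list \<Rightarrow> 'v list \<Rightarrow> bool) \<Rightarrow> ('o, 'm) multicat
   \<Rightarrow> ('s, 'f, 'o, 'm) model \<Rightarrow> 'v list \<Rightarrow> ('f, 'v) trm \<Rightarrow> 'm \<Rightarrow> bool"
  for sg R C m where
  mval_Var: "R v [x] \<Longrightarrow>
     mval_rel sg R C m v (Var x)
       (mres sg C m v [x] (msort m (vsort sg x)) (mident C (msort m (vsort sg x))))"
| mval_Const: "R v [] \<Longrightarrow>
     mval_rel sg R C m v (Fun f []) (mres sg C m v [] (msort m (fcod sg f)) (mfun m f))"
| mval_Fun: "\<lbrakk>ts \<noteq> []; list_all2 R ws (map tau ts); R v (concat ws);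
     length gs = length ts; \<forall>i<length ts. mval_rel sg R C m (ws ! i) (ts ! i) (gs ! i)\<rbrakk>
    \<Longrightarrow> mval_rel sg R C m v (Fun f ts)
       (mres sg C m v (concat ws) (msort m (fcod sg f))
          (mcomp C (map (msort m) (fdom sg f)) (msort m (fcod sg f)) (map (mctx sg m) ws)
             (mfun m f) gs))"

definition mval ::
  "('s, 'f, 'v) signature \<Rightarrow> ('v list \<Rightarrow> 'v list \<Rightarrow> bool) \<Rightarrow> ('o, 'm) multicat
   \<Rightarrow> ('s, 'f, 'o, 'm) model \<Rightarrow> 'v list \<Rightarrow> ('f, 'v) trm \<Rightarrow> 'm" where
  "mval sg R C m v t = (THE g. mval_rel sg R C m v t g)"

definition models_eqn ::
  "('s, 'f, 'v) signature \<Rightarrow> ('v list \<Rightarrow> 'v list \<Rightarrow> bool) \<Rightarrow> ('o, 'm) multicat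
   \<Rightarrow> ('s, 'f, 'o, 'm) model \<Rightarrow> ('f, 'v) eqn \<Rightarrow> bool" where
  "models_eqn sg R C m = (\<lambda>(v, t1, t2). mval sg R C m v t1 = mval sg R C m v t2)"

text \<open>Objects and morphisms of the category of \<open>Delta R\<close>-multicategories with a choice of an
  \<open>E\<close>-model.\<close>

definition multicat_with_model ::
  "('s, 'f, 'v) signature \<Rightarrow> ('v list \<Rightarrow> 'v list \<Rightarrow> bool) \<Rightarrow> ('f, 'v) eqn set
   \<Rightarrow> ('o, 'm) multicat \<Rightarrow> ('s, 'f, 'o, 'm) model \<Rightarrow> bool" where
  "multicat_with_model sg R E C m \<longleftrightarrow>
     multicategory (Delta R) C \<and> is_model sg C m \<and> (\<forall>\<phi>\<in>E. models_eqn sg R C m \<phi>)"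

definition multicat_with_model_morphism ::
  "('s, 'f, 'v) signature \<Rightarrow> ('v list \<Rightarrow> 'v list \<Rightarrow> bool)
   \<Rightarrow> ('o, 'm) multicat \<Rightarrow> ('s, 'f, 'o, 'm) model
   \<Rightarrow> ('p, 'n) multicat \<Rightarrow> ('s, 'f, 'p, 'n) model
   \<Rightarrow> ('o \<Rightarrow> 'p) \<Rightarrow> ('o list \<Rightarrow> 'o \<Rightarrow> 'm \<Rightarrow> 'n) \<Rightarrow> bool" where
  "multicat_with_model_morphism sg R C m D n F G \<longleftrightarrow>
     multicat_morphism (Delta R) C D F G \<and>
     (\<forall>s\<in>sorts sg. F (msort m s) = msort n s) \<and>
     (\<forall>f\<in>funs sg.
        G (map (msort m) (fdom sg f)) (msort m (fcod sg f)) (mfun m f) = mfun n f)"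


section \<open>Models in sets\<close>

record ('s, 'f, 'c) algebra =
  carrier :: "'s \<Rightarrow> 'c set"
  interp :: "'f \<Rightarrow> 'c list \<Rightarrow> 'c"

definition is_algebra :: "('s, 'f, 'v) signature \<Rightarrow> ('s, 'f, 'c) algebra \<Rightarrow> bool" where
  "is_algebra sg A \<longleftrightarrow>
     (\<forall>f\<in>funs sg. \<forall>xs. list_all2 (\<lambda>x s. x \<in> carrier A s) xs (fdom sg f)
        \<longrightarrow> interp A f xs \<in> carrier A (fcod sg f))"

fun eval_alg :: "('s, 'f, 'c) algebra \<Rightarrow> ('v \<Rightarrow> 'c) \<Rightarrow> ('f, 'v) trm \<Rightarrow> 'c" where
  "eval_alg A e (Var x) = e x"
| "eval_alg A e (Fun f ts) = interp A f (map (eval_alg A e) ts)"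

definition alg_models_eqn ::
  "('s, 'f, 'v) signature \<Rightarrow> ('s, 'f, 'c) algebra \<Rightarrow> ('f, 'v) eqn \<Rightarrow> bool" where
  "alg_models_eqn sg A = (\<lambda>(v, t1, t2).
     \<forall>e. (\<forall>x\<in>set v. e x \<in> carrier A (vsort sg x)) \<longrightarrow> eval_alg A e t1 = eval_alg A e t2)"

definition alg_model ::
  "('s, 'f, 'v) signature \<Rightarrow> ('f, 'v) eqn set \<Rightarrow> ('s, 'f, 'c) algebra \<Rightarrow> bool" where
  "alg_model sg E A \<longleftrightarrow> is_algebra sg A \<and> (\<forall>\<phi>\<in>E. alg_models_eqn sg A \<phi>)"

definition alg_hom ::
  "('s, 'f, 'v) signature \<Rightarrow> ('s, 'f, 'c) algebra \<Rightarrow> ('s, 'f, 'd) algebra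
   \<Rightarrow> ('s \<Rightarrow> 'c \<Rightarrow> 'd) \<Rightarrow> bool" where
  "alg_hom sg A B h \<longleftrightarrow>
     (\<forall>s\<in>sorts sg. \<forall>x\<in>carrier A s. h s x \<in> carrier B s) \<and>
     (\<forall>f\<in>funs sg. \<forall>xs. list_all2 (\<lambda>x s. x \<in> carrier A s) xs (fdom sg f)
        \<longrightarrow> h (fcod sg f) (interp A f xs) = interp B f (map2 h (fdom sg f) xs))"

text \<open>
  HOL cannot quantify over types inside a formula, so initiality is relative to the test models
  with carriers in a given type \<open>'d\<close>; initiality in the category of all models is the
  conjunction of the instances for all types \<open>'d\<close>.  Two instances already determine \<open>A\<close> up to
  isomorphism: \<open>'d\<close> the carrier type of \<open>A\<close>, and \<open>'d\<close> the type of sets of terms, which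
  contains the carriers of the term model (closed terms modulo provable equality).
\<close>

definition initial_alg_model ::
  "'d itself \<Rightarrow> ('s, 'f, 'v) signature \<Rightarrow> ('f, 'v) eqn set \<Rightarrow> ('s, 'f, 'c) algebra \<Rightarrow> bool" where
  "initial_alg_model _ sg E A \<longleftrightarrow>
     alg_model sg E A \<and>
     (\<forall>B :: ('s, 'f, 'd) algebra. alg_model sg E B \<longrightarrow>
        (\<exists>h. alg_hom sg A B h \<and>
             (\<forall>h'. alg_hom sg A B h' \<longrightarrow> (\<forall>s\<in>sorts sg. \<forall>x\<in>carrier A s. h' s x = h s x))))"


section \<open>The multicategorically extended signature\<close>

text \<open>
  The symbols are \<open>Comp\<^sub>S (b\<^sub>1 \<dots> b\<^sub>n) c (a\<^sup>1, \<dots>, a\<^sup>n)\<close>, \<open>Id\<^sub>S c\<close>, \<open>Act\<^sub>S \<theta> (b\<^sub>1 \<dots> b\<^sub>n) c\<close> for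
  \<open>\<theta>\<^bsub>*,b\<^sub>1\<dots>b\<^sub>n,c\<^esub>\<close>, and a constant for every function symbol.  The variables of a sort are its
  pairs with the natural numbers.
\<close>

datatype ('s, 'f) msym =
    CompS "'s list" 's "'s list list"
  | IdS 's
  | ActS finmap "'s list" 's
  | ConstS 'f

type_synonym 's msrt = "'s list \<times> 's"
type_synonym 's mvar = "nat \<times> 's msrt"
type_synonym ('s, 'f) mtrm = "(('s, 'f) msym, 's mvar) trm"

fun msym_dom :: "('s, 'f, 'v) signature \<Rightarrow> ('s, 'f) msym \<Rightarrow> 's msrt list" where
  "msym_dom sg (CompS bs c as) = (bs, c) # zip as bs"
| "msym_dom sg (IdS c) = []"
| "msym_dom sg (ActS \<theta> bs c) = [(pull \<theta> bs, c)]"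
| "msym_dom sg (ConstS f) = []"

fun msym_cod :: "('s, 'f, 'v) signature \<Rightarrow> ('s, 'f) msym \<Rightarrow> 's msrt" where
  "msym_cod sg (CompS bs c as) = (concat as, c)"
| "msym_cod sg (IdS c) = ([c], c)"
| "msym_cod sg (ActS \<theta> bs c) = (bs, c)"
| "msym_cod sg (ConstS f) = (fdom sg f, fcod sg f)"

definition ext_signature ::
  "('s, 'f, 'v) signature \<Rightarrow> ('v list \<Rightarrow> 'v list \<Rightarrow> bool)
   \<Rightarrow> ('s msrt, ('s, 'f) msym, 's mvar) signature" where
  "ext_signature sg R = \<lparr>
     sorts = lists (sorts sg) \<times> sorts sg,
     funs =
       {CompS bs c as | bs c as. bs \<in> lists (sorts sg) \<and> c \<in> sorts sg \<and>
          as \<in> lists (lists (sorts sg)) \<and> length as = length bs}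
       \<union> {IdS c | c. c \<in> sorts sg}
       \<union> {ActS \<theta> bs c | \<theta> bs c. \<theta> \<in> Delta R \<and> bs \<in> lists (sorts sg) \<and>
          length bs = tgt \<theta> \<and> c \<in> sorts sg}
       \<union> {ConstS f | f. f \<in> funs sg},
     fdom = msym_dom sg,
     fcod = msym_cod sg,
     vars = UNIV \<times> (lists (sorts sg) \<times> sorts sg),
     vsort = snd \<rparr>"

abbreviation compT ::
  "'s list \<Rightarrow> 's \<Rightarrow> 's list list \<Rightarrow> ('s, 'f) mtrm \<Rightarrow> ('s, 'f) mtrm list \<Rightarrow> ('s, 'f) mtrm" where
  "compT bs c as h gs \<equiv> Fun (CompS bs c as) (h # gs)"

abbreviation idT :: "'s \<Rightarrow> ('s, 'f) mtrm" where
  "idT c \<equiv> Fun (IdS c) []"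

abbreviation actT :: "finmap \<Rightarrow> 's list \<Rightarrow> 's \<Rightarrow> ('s, 'f) mtrm \<Rightarrow> ('s, 'f) mtrm" where
  "actT \<theta> bs c h \<equiv> Fun (ActS \<theta> bs c) [h]"

abbreviation constT :: "'f \<Rightarrow> ('s, 'f) mtrm" where
  "constT f \<equiv> Fun (ConstS f) []"

text \<open>\<open>mvars S as bs xs\<close>: \<open>xs\<close> is a family of variables \<open>x\<^sub>i : (a\<^sup>i, b\<^sub>i)\<close>.\<close>

definition mvars :: "'s set \<Rightarrow> 's list list \<Rightarrow> 's list \<Rightarrow> 's mvar list \<Rightarrow> bool" where
  "mvars S as bs xs \<longleftrightarrow>
     bs \<in> lists S \<and> as \<in> lists (lists S) \<and> length as = length bs \<and> map snd xs = zip as bs"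

section \<open>The categorization theory\<close>

text \<open>Every equation is included for all choices of distinct variables of the right sorts.\<close>

inductive_set cat_theory ::
  "('s, 'f, 'v) signature \<Rightarrow> ('v list \<Rightarrow> 'v list \<Rightarrow> bool) \<Rightarrow> (('s, 'f) msym, 's mvar) eqn set"
  for sg R where
  cat_assoc:
    "\<lbrakk>mvars (sorts sg) [cs] [d] [h]; mvars (sorts sg) bss cs gs;
      length asss = length cs; length fss = length cs;
      \<forall>i<length cs. mvars (sorts sg) (asss ! i) (bss ! i) (fss ! i);
      distinct (h # gs @ concat fss)\<rbrakk>
     \<Longrightarrow> (h # gs @ concat fss,
       compT (concat bss) d (concat asss)
         (compT cs d bss (Var h) (map Var gs)) (map Var (concat fss)),
       compT cs d (map concat asss) (Var h)
         (map (\<lambda>i. compT (bss ! i) (cs ! i) (asss ! i) (Var (gs ! i)) (map Var (fss ! i)))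
            [0..<length cs])) \<in> cat_theory sg R"
| cat_ident_left:
    "mvars (sorts sg) [a] [b] [h]
     \<Longrightarrow> ([h], compT [b] b [a] (idT b) [Var h], Var h) \<in> cat_theory sg R"
| cat_ident_right:
    "mvars (sorts sg) [a] [b] [h]
     \<Longrightarrow> ([h], compT a b (map (\<lambda>x. [x]) a) (Var h) (map idT a), Var h) \<in> cat_theory sg R"
| cat_act_id:
    "mvars (sorts sg) [a] [b] [h]
     \<Longrightarrow> ([h], actT (fid (length a)) a b (Var h), Var h) \<in> cat_theory sg R"
| cat_act_fcomp:
    "\<lbrakk>\<theta> \<in> Delta R; \<phi> \<in> Delta R; tgt \<theta> = src \<phi>; a \<in> lists (sorts sg); length a = tgt \<phi>;
      mvars (sorts sg) [pull (fcomp \<phi> \<theta>) a] [b] [h]\<rbrakk>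
     \<Longrightarrow> ([h], actT (fcomp \<phi> \<theta>) a b (Var h), actT \<phi> a b (actT \<theta> (pull \<phi> a) b (Var h)))
         \<in> cat_theory sg R"
| cat_comp_act_outer:
    "\<lbrakk>\<theta> \<in> Delta R; length bs = tgt \<theta>; mvars (sorts sg) [pull \<theta> bs] [c] [h];
      mvars (sorts sg) as bs gs; distinct (h # gs)\<rbrakk>
     \<Longrightarrow> (h # gs,
       compT bs c as (actT \<theta> bs c (Var h)) (map Var gs),
       actT (fsim \<theta> (map length as)) (concat as) c
         (compT (pull \<theta> bs) c (pull \<theta> as) (Var h) (map Var (pull \<theta> gs)))) \<in> cat_theory sg R"
| cat_comp_act_inner:
    "\<lbrakk>set \<theta>s \<subseteq> Delta R; length \<theta>s = length bs;
      as \<in> lists (lists (sorts sg)); map length as = map tgt \<theta>s;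
      mvars (sorts sg) [bs] [c] [h]; mvars (sorts sg) (map2 pull \<theta>s as) bs gs;
      distinct (h # gs)\<rbrakk>
     \<Longrightarrow> (h # gs,
       compT bs c as (Var h)
         (map (\<lambda>i. actT (\<theta>s ! i) (as ! i) (bs ! i) (Var (gs ! i))) [0..<length bs]),
       actT (fsum \<theta>s) (concat as) c
         (compT bs c (map2 pull \<theta>s as) (Var h) (map Var gs))) \<in> cat_theory sg R"


section \<open>The multicategorical theory of a theory\<close>

text \<open>\<open>N_act sg v w b\<close> is the symbol \<open>N\<^bsub>v,w,b\<^esub>\<close>, applied to a term.\<close>

definition N_act ::
  "('s, 'f, 'v) signature \<Rightarrow> 'v list \<Rightarrow> 'v list \<Rightarrow> 's \<Rightarrow> ('s, 'f) mtrm \<Rightarrow> ('s, 'f) mtrm" where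
  "N_act sg v w b t = actT (theta_of v w) (map (vsort sg) v) b t"

fun N_term ::
  "('s, 'f, 'v) signature \<Rightarrow> ('v list \<Rightarrow> 'v list) \<Rightarrow> 'v list \<Rightarrow> ('f, 'v) trm \<Rightarrow> ('s, 'f) mtrm"
where
  "N_term sg tc v (Var x) = N_act sg v [x] (vsort sg x) (idT (vsort sg x))"
| "N_term sg tc v (Fun f []) = N_act sg v [] (fcod sg f) (constT f)"
| "N_term sg tc v (Fun f (t # ts)) =
     N_act sg v (concat (map (\<lambda>u. tc (tau u)) (t # ts))) (fcod sg f)
       (compT (fdom sg f) (fcod sg f) (map (\<lambda>u. map (vsort sg) (tc (tau u))) (t # ts))
          (constT f) (map (\<lambda>u. N_term sg tc (tc (tau u)) u) (t # ts)))"

definition tilde_theory ::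
  "('s, 'f, 'v) signature \<Rightarrow> ('v list \<Rightarrow> 'v list) \<Rightarrow> ('f, 'v) eqn set
   \<Rightarrow> (('s, 'f) msym, 's mvar) eqn set" where
  "tilde_theory sg tc E = {([], N_term sg tc v t1, N_term sg tc v t2) | v t1 t2. (v, t1, t2) \<in> E}"

definition mc_theory ::
  "('s, 'f, 'v) signature \<Rightarrow> ('v list \<Rightarrow> 'v list \<Rightarrow> bool) \<Rightarrow> ('v list \<Rightarrow> 'v list)
   \<Rightarrow> ('f, 'v) eqn set \<Rightarrow> (('s, 'f) msym, 's mvar) eqn set" where
  "mc_theory sg R tc E = cat_theory sg R \<union> tilde_theory sg tc E"


section \<open>Set-valued models as multicategories\<close>

definition alg_multicat ::
  "('s, 'f, 'v) signature \<Rightarrow> ('s msrt, ('s, 'f) msym, 'c) algebra \<Rightarrow> ('s, 'c) multicat" where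
  "alg_multicat sg A = \<lparr>
     obj = sorts sg,
     hom = (\<lambda>a b. carrier A (a, b)),
     mcomp = (\<lambda>bs c as g fs. interp A (CompS bs c as) (g # fs)),
     mident = (\<lambda>c. interp A (IdS c) []),
     mact = (\<lambda>\<theta> a b f. interp A (ActS \<theta> a b) [f]) \<rparr>"

definition alg_universal_model ::
  "('s msrt, ('s, 'f) msym, 'c) algebra \<Rightarrow> ('s, 'f, 's, 'c) model" where
  "alg_universal_model A = \<lparr> msort = (\<lambda>s. s), mfun = (\<lambda>f. interp A (ConstS f) []) \<rparr>"

end

theory Submission
  imports Defs
begin

text \<open>
  The initial model \<open>A\<close> is generated by ground terms, and it maps to models of any carrier type:
  the ground terms modulo the kernel of evaluation in a model \<open>B\<close> form a model whose carriers are
  sets of terms.  An \<open>E\<close>-model \<open>n\<close> in a multicategory \<open>D\<close> makes the sets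
  \<open>D(n(a\<^sub>1) \<dots> n(a\<^sub>k), n(b))\<close> into a model of the multicategorical theory, so initiality of \<open>A\<close> is
  initiality of \<open>(C, m)\<close>.  Soundness follows from a substitution lemma expressing \<open>m\<^sub>w(s(t))\<close> as the
  composite of \<open>m\<^sub>v(t)\<close> with the values of \<open>s\<close>.  For completeness, the terms in a fixed context
  \<open>cctx a\<close> of type \<open>a\<close>, modulo provable equality, are the multimorphisms with source \<open>a\<close> of a
  multicategory in which a model satisfies exactly the provable equations; the unique morphism from
  \<open>C\<close> carries the values of terms in \<open>C\<close> to the values in this multicategory.
\<close>

section \<open>Values of terms in a multicategory\<close>

text \<open>Three obstacles shape the proof. Initiality of \<open>A\<close> is given against test
  algebras of two carrier types only. The carrier type of \<open>A\<close> itself yields generation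
  by ground terms, hence uniqueness of homomorphisms into algebras of every type; sets of terms
  yield existence. Secondly, values of terms are defined by a relation that admits every choice of
  contexts for the subterms. Fixing the terminal contexts \<open>tc\<close> gives a recursive
  function \<open>cval\<close>: modelability guarantees contexts for the subterms at all, and
  terminality makes every choice factor through \<open>tc\<close>, so the relation is single-valued.
  Thirdly, the objects of a multicategory built from syntax are sorts, and sources are words of
  sorts instead of contexts. So one context is chosen for each word, its variables are cut into
  blocks to define composition, and terms in other contexts enter by renaming.\<close>

lemma length_pull [simp]: "length (pull \<theta> xs) = src \<theta>"
  by (simp add: pull_def src_def)

lemma pull_fcomp:
  "is_finmap \<sigma> \<Longrightarrow> tgt \<sigma> = src \<tau> \<Longrightarrow> pull (fcomp \<tau> \<sigma>) xs = pull \<sigma> (pull \<tau> xs)"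
  by (auto simp: pull_def fcomp_def is_finmap_def src_def)

lemma set_pull: "is_finmap \<theta> \<Longrightarrow> length xs = tgt \<theta> \<Longrightarrow> set (pull \<theta> xs) \<subseteq> set xs"
  by (auto simp: pull_def is_finmap_def)

text \<open>In a repetition-free word a letter determines its position, so the word that a map
  selects determines the values of the map.\<close>

lemma finmap_eqI:
  assumes "is_finmap \<sigma>" "is_finmap \<tau>" "tgt \<sigma> = length c" "tgt \<tau> = length c" "distinct c"
    and eq: "pull \<sigma> c = pull \<tau> c"
  shows "\<sigma> = \<tau>"
proof -
  have "inj_on ((!) c) (set (vals \<sigma>) \<union> set (vals \<tau>))"
    using assms by (auto simp: is_finmap_def inj_on_def nth_eq_iff_index_eq)
  then have "vals \<sigma> = vals \<tau>"
    using eq unfolding pull_def by (rule map_inj_on[rotated])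
  then show ?thesis
    using assms by (metis finmap.expand)
qed

lemma theta_of:
  assumes "set w \<subseteq> set v"
  shows is_finmap_theta_of: "is_finmap (theta_of v w)"
    and tgt_theta_of: "tgt (theta_of v w) = length v"
    and src_theta_of: "src (theta_of v w) = length w"
    and pull_theta_of: "pull (theta_of v w) v = w"
proof -
  have least: "(LEAST i. i < length v \<and> v ! i = x) < length v \<and> v ! (LEAST i. i < length v \<and> v ! i = x) = x"
    if "x \<in> set w" for x
  proof -
    from that assms obtain i where "i < length v \<and> v ! i = x" by (metis in_set_conv_nth subset_code(1))
    then show ?thesis by (rule LeastI)
  qed
  then show "is_finmap (theta_of v w)" "tgt (theta_of v w) = length v"
    "src (theta_of v w) = length w" "pull (theta_of v w) v = w"
    by (auto simp: is_finmap_def theta_of_def pull_def src_def comp_def intro!: map_idI)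
qed

text \<open>Uniqueness of the map behind \<open>theta_of\<close>. It lets a composite of maps be
  recognised as some \<open>theta_of\<close> from the word that it selects.\<close>

lemma theta_of_pull:
  assumes "is_finmap \<sigma>" "tgt \<sigma> = length v" "distinct v"
  shows "theta_of v (pull \<sigma> v) = \<sigma>"
  using assms set_pull[of \<sigma> v] by (intro finmap_eqI[where c = v]) (auto simp: theta_of)

lemma has_sort_unique: "has_sort sg t b \<Longrightarrow> has_sort sg t b' \<Longrightarrow> b = b'"
  by (cases t) (auto elim: has_sort.cases)

lemma mctx_concat: "mctx sg m (concat ws) = concat (map (mctx sg m) ws)"
  by (simp add: mctx_def[abs_def] map_concat)

lemma length_mctx [simp]: "length (mctx sg m v) = length v"
  by (simp add: mctx_def)

lemma pull_mctx: "is_finmap \<theta> \<Longrightarrow> length v = tgt \<theta> \<Longrightarrow> pull \<theta> (mctx sg m v) = mctx sg m (pull \<theta> v)"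
  by (simp add: mctx_def map_pull)

context context_structure begin

lemma R_context: "R v w \<Longrightarrow> distinct v" "R v w \<Longrightarrow> set v \<subseteq> V" "R v w \<Longrightarrow> set w \<subseteq> V"
  using R_domain by (auto simp: is_context_def)

lemma theta_of_Delta: "R v w \<Longrightarrow> theta_of v w \<in> Delta R"
  using theta_of[OF R_vars[of v w]] unfolding Delta_def by auto

lemma Delta_finmap: "\<theta> \<in> Delta R \<Longrightarrow> is_finmap \<theta>"
  by (simp add: Delta_def)

text \<open>\<open>Delta_subst\<close> with one-letter words. Unlike in
  \<open>Delta_context\<close>, the word \<open>v\<close> may repeat letters.\<close>

lemma R_pull:
  assumes "R u v" "\<theta> \<in> Delta R" "tgt \<theta> = length v"
  shows "R u (pull \<theta> v)"
proof -
  have "R u (concat (pull \<theta> (map (\<lambda>x. [x]) v)))"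
    by (rule Delta_subst) (use assms R_domain in auto)
  moreover have "concat (map (\<lambda>x. [x]) (pull \<theta> v)) = pull \<theta> v" by simp
  ultimately show ?thesis
    using map_pull[OF Delta_finmap[OF assms(2)], of v "\<lambda>x. [x]"] assms(3) by simp
qed

lemma R_singleton: "x \<in> V \<Longrightarrow> R [x] [x]"
  by (rule R_refl) (simp add: is_context_def)

end

text \<open>A constant needs no clause of its own: composing a constant with the empty family is
  the identity, by the right unit law for the empty word.\<close>

fun cval ::
  "('s, 'f, 'v) signature \<Rightarrow> ('v list \<Rightarrow> 'v list) \<Rightarrow> ('o, 'm) multicat
   \<Rightarrow> ('s, 'f, 'o, 'm) model \<Rightarrow> 'v list \<Rightarrow> ('f, 'v) trm \<Rightarrow> 'm" where
  "cval sg tc C m v (Var x) =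
     mres sg C m v [x] (msort m (vsort sg x)) (mident C (msort m (vsort sg x)))"
| "cval sg tc C m v (Fun f ts) =
     mres sg C m v (concat (map (\<lambda>u. tc (tau u)) ts)) (msort m (fcod sg f))
       (mcomp C (map (msort m) (fdom sg f)) (msort m (fcod sg f))
          (map (\<lambda>u. mctx sg m (tc (tau u))) ts) (mfun m f)
          (map (\<lambda>u. cval sg tc C m (tc (tau u)) u) ts))"

section \<open>Modelability and the choice of terminal contexts\<close>

locale modelable_signature = context_structure "vars sg" R
  for sg :: "('s, 'f, 'v) signature" and R :: "'v list \<Rightarrow> 'v list \<Rightarrow> bool" +
  fixes tc :: "'v list \<Rightarrow> 'v list"
  assumes wf: "wf_signature sg" and modelable: "modelable R"
    and tc: "terminal_choice (vars sg) R tc"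
begin

lemma R_tc: "R v w \<Longrightarrow> R v (tc w)"
  using tc R_domain unfolding terminal_choice_def terminal_context_def R_word_def by blast

lemma tc_R: "R v w \<Longrightarrow> R (tc w) w"
  using tc R_refl unfolding terminal_choice_def terminal_context_def R_word_def by blast

lemma R_split:
  assumes "R v (concat ws)"
  obtains cs where "R v (concat cs)" "list_all2 R cs ws"
  using assms modelable unfolding modelable_def by blast

text \<open>Modelability cuts the context into pieces \<open>cs\<close> for the subterms. Each piece
  reaches the terminal context of its subterm, and axiom \<open>R_comp\<close> replaces
  \<open>cs\<close> by these terminal contexts.\<close>

lemma R_concat_tc:
  assumes "R v (tau (Fun f ts))"
  shows "R v (concat (map (\<lambda>u. tc (tau u)) ts))" "\<And>t. t \<in> set ts \<Longrightarrow> R (tc (tau t)) (tau t)"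
proof -
  from assms obtain cs where cs: "R v (concat cs)" "list_all2 R cs (map tau ts)"
    using R_split[of v "map tau ts"] by auto
  then have "list_all2 R cs (map (\<lambda>u. tc (tau u)) ts)"
    by (auto simp: list_all2_conv_all_nth intro: R_tc)
  with cs show "R v (concat (map (\<lambda>u. tc (tau u)) ts))"
    using R_comp by blast
  fix t assume "t \<in> set ts"
  then show "R (tc (tau t)) (tau t)"
    using cs(2) tc_R by (fastforce simp: list_all2_conv_all_nth in_set_conv_nth)
qed

text \<open>A sort brings infinitely many variables, hence contexts of every length. Over an empty
  set of sorts the only context is the empty word and \<open>Delta R\<close> lacks
  \<open>fid 1\<close>; this is why a sort is assumed here and in the lemmas built on this
  one.\<close>

lemma structure_category: "s \<in> sorts sg \<Longrightarrow> structure_category (Delta R)"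
proof (rule structure_category_Delta)
  assume "s \<in> sorts sg"
  then have "infinite {x \<in> vars sg. vsort sg x = s}"
    using wf unfolding wf_signature_def by blast
  then show "infinite (vars sg)" by (rule contrapos_nn) simp
qed

lemma has_sort_sorts: "has_sort sg t b \<Longrightarrow> b \<in> sorts sg"
  using wf by (auto simp: wf_signature_def elim: has_sort.cases)

end

locale multicat_model =
  modelable_signature sg R tc + multicategory "Delta R" C
  for sg :: "('s, 'f, 'v) signature" and R :: "'v list \<Rightarrow> 'v list \<Rightarrow> bool"
    and tc :: "'v list \<Rightarrow> 'v list" and C :: "('o, 'm) multicat" +
  fixes m :: "('s, 'f, 'o, 'm) model"
  assumes model: "is_model sg C m"
begin

abbreviation "ctx \<equiv> mctx sg m"
abbreviation "res \<equiv> mres sg C m"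
abbreviation "val \<equiv> cval sg tc C m"

lemma msort_obj: "s \<in> sorts sg \<Longrightarrow> msort m s \<in> obj C"
  using model by (simp add: is_model_def)

lemma msort_has_sort: "has_sort sg t b \<Longrightarrow> msort m b \<in> obj C"
  using has_sort_sorts msort_obj by blast

lemma ctx_obj: "set v \<subseteq> vars sg \<Longrightarrow> ctx v \<in> lists (obj C)"
  using wf msort_obj unfolding mctx_def wf_signature_def by fastforce

lemma ctxs_obj:
  assumes "\<And>w. w \<in> set ws \<Longrightarrow> set w \<subseteq> vars sg"
  shows "map ctx ws \<in> lists (lists (obj C))"
proof (rule in_listsI, rule ballI)
  fix a assume "a \<in> set (map ctx ws)"
  then obtain w where "w \<in> set ws" "a = ctx w" by auto
  then show "a \<in> lists (obj C)" using assms ctx_obj by blast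
qed

lemma res_closed:
  assumes "R v w" "b \<in> obj C" "g \<in> hom C (ctx w) b"
  shows "res v w b g \<in> hom C (ctx v) b"
  unfolding mres_def using assms theta_of[OF R_vars[OF assms(1)]]
  by (intro act_closed) (auto simp: theta_of_Delta pull_mctx R_context ctx_obj)

text \<open>Functoriality of the action turns the left side into the action of
  \<open>fcomp (theta_of u v) \<theta>\<close>. That map selects \<open>pull \<theta> v\<close> from
  \<open>u\<close>, so it is the map that defines the right side.\<close>

lemma res_act:
  assumes "R u v" "\<theta> \<in> Delta R" "tgt \<theta> = length v" "b \<in> obj C" "g \<in> hom C (ctx (pull \<theta> v)) b"
  shows "res u v b (mact C \<theta> (ctx v) b g) = res u (pull \<theta> v) b g"
proof -
  note th = theta_of[OF R_vars[OF assms(1)]]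
  have f: "is_finmap \<theta>" using assms Delta_finmap by blast
  have p: "pull (fcomp (theta_of u v) \<theta>) u = pull \<theta> v"
    using f th assms by (simp add: pull_fcomp)
  have fm: "is_finmap (fcomp (theta_of u v) \<theta>)"
    using f th assms unfolding is_finmap_def fcomp_def pull_def src_def by auto
  then have e: "fcomp (theta_of u v) \<theta> = theta_of u (pull \<theta> v)"
    using theta_of_pull[of "fcomp (theta_of u v) \<theta>" u] R_context(1)[OF assms(1)] p th by (simp add: fcomp_def)
  have q: "pull (fcomp (theta_of u v) \<theta>) (ctx u) = ctx (pull \<theta> v)"
    using pull_mctx[OF fm, of u] th p by (simp add: fcomp_def)
  show ?thesis
    unfolding mres_def e[symmetric]
    by (subst act_fcomp) (use assms q th R_context in \<open>auto simp: theta_of_Delta ctx_obj pull_mctx\<close>)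
qed

lemma res_res:
  assumes "R u v" "R v w" "b \<in> obj C" "g \<in> hom C (ctx w) b"
  shows "res u v b (res v w b g) = res u w b g"
  using res_act[OF assms(1), of "theta_of v w" b g] assms theta_of[OF R_vars[OF assms(2)]]
  by (simp add: theta_of_Delta mres_def[of sg C m v w])

text \<open>The restrictions of the arguments are pulled out together by
  \<open>comp_act_inner\<close>. The sum of their maps selects \<open>concat ws\<close> from
  \<open>concat us\<close>, so the outer restriction absorbs it by \<open>res_act\<close>. The sort
  \<open>s\<close> provides closure of \<open>Delta R\<close> under sums.\<close>

lemma res_comp:
  assumes s: "s \<in> sorts sg"
    and R: "R v (concat us)" "list_all2 R us ws"
    and c: "c \<in> obj C" "g \<in> hom C bs c" "homs C (map ctx ws) bs fs"
  shows "res v (concat us) c (mcomp C bs c (map ctx us) g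
           (map (\<lambda>i. res (us ! i) (ws ! i) (bs ! i) (fs ! i)) [0..<length bs]))
       = res v (concat ws) c (mcomp C bs c (map ctx ws) g fs)"
proof -
  have sc: "structure_category (Delta R)" using s structure_category by blast
  define \<sigma>s where "\<sigma>s = map2 theta_of us ws"
  have l: "length us = length ws" "length ws = length bs" "length fs = length bs"
    using R(2) c(3) by (auto simp: homs_def list_all2_lengthD)
  have Ri: "R (us ! i) (ws ! i)" if "i < length bs" for i
    using that R(2) l by (simp add: list_all2_conv_all_nth)
  note th = theta_of[OF R_vars[OF Ri]]
  have sub: "set \<sigma>s \<subseteq> Delta R"
    using Ri l theta_of_Delta by (auto simp: \<sigma>s_def set_zip)
  have mt: "map length us = map tgt \<sigma>s"
    by (rule nth_equalityI) (auto simp: \<sigma>s_def l th)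
  have mp: "map2 pull \<sigma>s us = ws"
    by (rule nth_equalityI) (auto simp: \<sigma>s_def l th)
  have mp': "map2 pull \<sigma>s (map ctx us) = map ctx ws"
    by (rule nth_equalityI) (auto simp: \<sigma>s_def l th pull_mctx)
  have fs: "fsum \<sigma>s \<in> Delta R" using sc sub unfolding structure_category_def by blast
  have pf: "pull (fsum \<sigma>s) (concat us) = concat ws"
    using pull_fsum[OF mt] sub Delta_finmap mp by auto
  have tf: "tgt (fsum \<sigma>s) = length (concat us)"
    by (simp add: fsum_def mt[symmetric] length_concat)
  have "mcomp C bs c (map ctx us) g
           (map (\<lambda>i. res (us ! i) (ws ! i) (bs ! i) (fs ! i)) [0..<length bs])
      = mcomp C bs c (map ctx us) g
           (map (\<lambda>i. mact C (\<sigma>s ! i) (map ctx us ! i) (bs ! i) (fs ! i)) [0..<length bs])"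
    by (intro arg_cong[where f = "mcomp C bs c (map ctx us) g"] map_cong) (auto simp: mres_def \<sigma>s_def l)
  also have "\<dots> = mact C (fsum \<sigma>s) (concat (map ctx us)) c (mcomp C bs c (map ctx ws) g fs)"
    unfolding mp'[symmetric]
  proof (rule comp_act_inner[OF sub _ _ _ c(1,2)])
    show "map ctx us \<in> lists (lists (obj C))"
      using R_context(2)[OF Ri] l by (intro ctxs_obj) (auto simp: in_set_conv_nth)
    show "length \<sigma>s = length bs" using l by (simp add: \<sigma>s_def)
    show "map length (map ctx us) = map tgt \<sigma>s" using mt by (simp add: comp_def)
    show "homs C (map2 pull \<sigma>s (map ctx us)) bs fs" unfolding mp' by (rule c)
  qed
  finally have "mcomp C bs c (map ctx us) g
           (map (\<lambda>i. res (us ! i) (ws ! i) (bs ! i) (fs ! i)) [0..<length bs])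
      = mact C (fsum \<sigma>s) (ctx (concat us)) c (mcomp C bs c (map ctx ws) g fs)"
    by (simp add: mctx_concat)
  moreover have "mcomp C bs c (map ctx ws) g fs \<in> hom C (ctx (concat ws)) c"
    unfolding mctx_concat using comp_closed c by blast
  ultimately show ?thesis
    using res_act[OF R(1) fs tf c(1)] pf by simp
qed

lemma homs_map:
  assumes "list_all2 (\<lambda>t b. b \<in> sorts sg \<and> set (W t) \<subseteq> vars sg \<and> g t \<in> hom C (ctx (W t)) (msort m b)) ts bs"
  shows "homs C (map (\<lambda>t. ctx (W t)) ts) (map (msort m) bs) (map g ts)"
proof -
  have "map ctx (map W ts) \<in> lists (lists (obj C))"
  proof (rule ctxs_obj)
    fix w assume "w \<in> set (map W ts)"
    then obtain i where "i < length ts" "w = W (ts ! i)" by (auto simp: in_set_conv_nth)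
    then show "set w \<subseteq> vars sg" using assms by (simp add: list_all2_conv_all_nth)
  qed
  moreover have "map (msort m) bs \<in> lists (obj C)"
    using assms msort_obj by (auto simp: list_all2_conv_all_nth in_set_conv_nth)
  ultimately show ?thesis
    using assms by (simp add: homs_def comp_def list_all2_conv_all_nth)
qed

lemma mfun_closed: "f \<in> funs sg \<Longrightarrow> mfun m f \<in> hom C (map (msort m) (fdom sg f)) (msort m (fcod sg f))"
  using model by (simp add: is_model_def)

lemma fcod_obj: "f \<in> funs sg \<Longrightarrow> msort m (fcod sg f) \<in> obj C"
  using wf msort_obj by (simp add: wf_signature_def)

lemma val_closed: "has_sort sg t b \<Longrightarrow> R v (tau t) \<Longrightarrow> val v t \<in> hom C (ctx v) (msort m b)"
proof (induction arbitrary: v rule: has_sort.induct)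
  case (has_sort_Var x)
  then have b: "msort m (vsort sg x) \<in> obj C"
    using wf msort_obj by (simp add: wf_signature_def)
  then have "mident C (msort m (vsort sg x)) \<in> hom C (ctx [x]) (msort m (vsort sg x))"
    by (simp add: mctx_def ident_closed)
  then show ?case
    using has_sort_Var b res_closed by simp
next
  case (has_sort_Fun f ts)
  note tcs = R_concat_tc[OF has_sort_Fun(3)]
  have "homs C (map (\<lambda>u. ctx (tc (tau u))) ts) (map (msort m) (fdom sg f)) (map (\<lambda>u. val (tc (tau u)) u) ts)"
    using has_sort_Fun(2) tcs(2) R_context(2)
    by (intro homs_map, elim list.rel_mono_strong) (auto intro: has_sort_sorts)
  then have "mcomp C (map (msort m) (fdom sg f)) (msort m (fcod sg f))
     (map (\<lambda>u. ctx (tc (tau u))) ts) (mfun m f) (map (\<lambda>u. val (tc (tau u)) u) ts)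
     \<in> hom C (ctx (concat (map (\<lambda>u. tc (tau u)) ts))) (msort m (fcod sg f))"
    using comp_closed[OF fcod_obj mfun_closed] has_sort_Fun(1) by (simp add: mctx_concat comp_def)
  then show ?case
    using res_closed[OF tcs(1) fcod_obj] has_sort_Fun(1) by simp
qed

lemma homs_val:
  assumes "list_all2 (has_sort sg) ts bs" "\<And>t. t \<in> set ts \<Longrightarrow> R (W t) (tau t)"
  shows "homs C (map (\<lambda>t. ctx (W t)) ts) (map (msort m) bs) (map (\<lambda>t. val (W t) t) ts)"
  using assms(1) assms(2) R_context(2)
  by (intro homs_map, elim list.rel_mono_strong) (auto intro: has_sort_sorts val_closed)

lemma comp_val_closed:
  assumes "f \<in> funs sg" "list_all2 (has_sort sg) ts (fdom sg f)" "\<And>t. t \<in> set ts \<Longrightarrow> R (W t) (tau t)"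
  shows "mcomp C (map (msort m) (fdom sg f)) (msort m (fcod sg f)) (map (\<lambda>t. ctx (W t)) ts)
      (mfun m f) (map (\<lambda>t. val (W t) t) ts) \<in> hom C (ctx (concat (map W ts))) (msort m (fcod sg f))"
  using comp_closed[OF fcod_obj mfun_closed homs_val[OF assms(2)]] assms(1,3)
  by (simp add: mctx_concat comp_def)

text \<open>A value is itself a restriction along its context, so the outer restriction merges with
  it by \<open>res_res\<close>; a case distinction on the term suffices.\<close>

lemma res_val:
  assumes "R u v" "R v (tau t)" "has_sort sg t b"
  shows "res u v (msort m b) (val v t) = val u t"
  using assms(3)
proof cases
  case (has_sort_Var x)
  then have "mident C (msort m b) \<in> hom C (ctx [x]) (msort m b)"
    using msort_has_sort[OF assms(3)] by (simp add: mctx_def ident_closed)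
  then show ?thesis
    using assms res_res msort_has_sort has_sort_Var by simp
next
  case (has_sort_Fun f ts)
  note tcs = R_concat_tc[OF assms(2)[unfolded has_sort_Fun]]
  from has_sort_Fun show ?thesis
    using res_res[OF assms(1) tcs(1) fcod_obj comp_val_closed[OF _ _ tcs(2)]] by simp
qed

text \<open>Independence of the contexts chosen for the arguments: each value in
  \<open>ws ! i\<close> is a restriction of the value in the terminal context, and
  \<open>res_comp\<close> moves these restrictions into the outer one.\<close>

lemma val_Fun:
  assumes f: "f \<in> funs sg" and ts: "list_all2 (has_sort sg) ts (fdom sg f)"
    and ws: "list_all2 R ws (map tau ts)" and R: "R v (concat ws)"
  shows "res v (concat ws) (msort m (fcod sg f))
      (mcomp C (map (msort m) (fdom sg f)) (msort m (fcod sg f)) (map ctx ws) (mfun m f) (map2 val ws ts))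
    = val v (Fun f ts)"
proof -
  let ?b = "fcod sg f" and ?vs = "map (\<lambda>u. tc (tau u)) ts"
  note l = list_all2_lengthD[OF ts] list_all2_lengthD[OF ws, simplified]
  have Rw: "R (ws ! i) (tau (ts ! i))" if "i < length ts" for i
    using ws that by (auto simp: list_all2_conv_all_nth)
  have "R v (tau (Fun f ts))" using R_comp[OF R ws] by simp
  note tcs = R_concat_tc[OF this]
  have Rwt: "list_all2 R ws ?vs"
    using ws by (auto simp: list_all2_conv_all_nth R_tc)
  have "map2 val ws ts = map (\<lambda>i. res (ws ! i) (?vs ! i) (map (msort m) (fdom sg f) ! i)
           (map (\<lambda>u. val (tc (tau u)) u) ts ! i)) [0..<length (map (msort m) (fdom sg f))]"
    using l ts Rw
    by (intro nth_equalityI) (auto simp: list_all2_conv_all_nth intro!: res_val[symmetric] intro: R_tc tc_R)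
  moreover have "homs C (map ctx ?vs) (map (msort m) (fdom sg f)) (map (\<lambda>u. val (tc (tau u)) u) ts)"
    using homs_val[OF ts] tcs(2) by (simp add: comp_def)
  moreover have "?b \<in> sorts sg"
    using f wf by (simp add: wf_signature_def)
  ultimately show ?thesis
    using res_comp[OF _ R Rwt fcod_obj[OF f] mfun_closed[OF f]] by (simp add: comp_def)
qed

text \<open>By \<open>val_Fun\<close>, no choice of contexts along a derivation influences the
  result. Together with \<open>ex_mval_rel\<close> this makes the description in \<open>mval\<close>
  a proper one.\<close>

lemma mval_rel_val:
  "mval_rel sg R C m v t g \<Longrightarrow> has_sort sg t b \<Longrightarrow> g = val v t"
proof (induction arbitrary: b rule: mval_rel.induct)
  case (mval_Const v f)
  then have "fdom sg f = []" "f \<in> funs sg" by (auto elim: has_sort.cases)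
  then show ?case
    using comp_ident_right[of "[]" "msort m (fcod sg f)" "mfun m f"] fcod_obj mfun_closed[of f] by simp
next
  case (mval_Fun ts ws v gs f)
  from mval_Fun.prems have f: "f \<in> funs sg" and ts: "list_all2 (has_sort sg) ts (fdom sg f)"
    by (auto elim: has_sort.cases)
  have l: "length gs = length ts" "length ws = length ts"
    using mval_Fun.hyps(4) list_all2_lengthD[OF mval_Fun.hyps(2)] by auto
  have "gs = map2 val ws ts"
  proof (rule nth_equalityI)
    fix i assume "i < length gs"
    then have i: "i < length ts" using l by simp
    with ts have "has_sort sg (ts ! i) (fdom sg f ! i)" by (rule list_all2_nthD)
    with i mval_Fun.IH have "gs ! i = val (ws ! i) (ts ! i)" by blast
    with i l show "gs ! i = map2 val ws ts ! i" by simp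
  qed (use l in simp)
  then show ?case using val_Fun[OF f ts mval_Fun.hyps(2,3)] by simp
qed simp

lemma ex_mval_rel: "has_sort sg t b \<Longrightarrow> R v (tau t) \<Longrightarrow> \<exists>g. mval_rel sg R C m v t g"
proof (induction arbitrary: v rule: has_sort.induct)
  case (has_sort_Var x)
  then show ?case using mval_Var[of R v x] by auto
next
  case (has_sort_Fun f ts)
  note tcs = R_concat_tc[OF has_sort_Fun(3)]
  have "\<forall>i<length ts. \<exists>g. mval_rel sg R C m (map (\<lambda>u. tc (tau u)) ts ! i) (ts ! i) g"
    using has_sort_Fun(2) tcs(2) by (auto simp: list_all2_conv_all_nth)
  then obtain g where g: "\<And>i. i < length ts \<Longrightarrow> mval_rel sg R C m (map (\<lambda>u. tc (tau u)) ts ! i) (ts ! i) (g i)"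
    by metis
  show ?case
  proof (cases "ts = []")
    case True
    then show ?thesis using has_sort_Fun(3) mval_Const[of R v sg C m f] by auto
  next
    case False
    have "list_all2 R (map (\<lambda>u. tc (tau u)) ts) (map tau ts)"
      using tcs(2) by (auto simp: list_all2_conv_all_nth)
    with False show ?thesis
      using mval_Fun[of ts R "map (\<lambda>u. tc (tau u)) ts" v "map g [0..<length ts]" sg C m f] tcs(1) g
      by (simp add: exI)
  qed
qed

lemma mval_val:
  assumes "has_sort sg t b" "R v (tau t)"
  shows "mval sg R C m v t = val v t"
  unfolding mval_def using ex_mval_rel[OF assms] mval_rel_val[OF _ assms(1)]
  by (intro the_equality) auto

lemma models_eqn_val:
  assumes "R_equation sg R (v, t1, t2)"
  shows "models_eqn sg R C m (v, t1, t2) \<longleftrightarrow> val v t1 = val v t2"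
  using assms mval_val by (auto simp: R_equation_def models_eqn_def)

end

section \<open>Substitution and soundness\<close>

lemma concat_concat_map: "concat (concat (map f xs)) = concat (map (\<lambda>x. concat (f x)) xs)"
  by (induction xs) auto

lemma tau_subst: "tau (subst s t) = concat (map (\<lambda>x. tau (s x)) (tau t))"
proof (induction t)
  case (Fun f ts)
  then show ?case by (simp add: map_concat comp_def concat_concat_map cong: map_cong)
qed simp

lemma has_sort_subst:
  "has_sort sg t b \<Longrightarrow> \<forall>x\<in>set (tau t). has_sort sg (s x) (vsort sg x) \<Longrightarrow> has_sort sg (subst s t) b"
proof (induction rule: has_sort.induct)
  case (has_sort_Fun f ts)
  then have "list_all2 (has_sort sg) (map (subst s) ts) (fdom sg f)"
    by (fastforce simp: list_all2_conv_all_nth)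
  with has_sort_Fun(1) show ?case by (auto intro: has_sort.has_sort_Fun)
qed simp

text \<open>The contexts of a renaming come as a list along \<open>v\<close>. As \<open>v\<close>
  has no repetitions they can be indexed by variables, and can then be reused for any word over the
  letters of \<open>v\<close>.\<close>

lemma R_renaming_map:
  assumes "R_renaming sg R v s w ws" "distinct v"
  obtains W where "ws = map W v" "\<forall>x\<in>set v. has_sort sg (s x) (vsort sg x)"
    "\<forall>x\<in>set v. R (W x) (tau (s x))" "R w (concat (map W v))"
proof -
  have l: "length v = length ws"
    using assms(1) by (auto simp: R_renaming_def dest: list_all2_lengthD)
  then obtain W where W: "map W v = ws" using ex_fun_map assms(2) by metis
  then show ?thesis
    using assms(1) by (intro that[of W]) (auto simp: R_renaming_def list_all2_map1 list_all2_map2 list_all2_same)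
qed

context modelable_signature begin

text \<open>Two axioms combine: \<open>R_comp\<close> passes from the contexts \<open>W x\<close> to
  the words \<open>tau (s x)\<close>, and \<open>R_subst\<close> then passes from \<open>v\<close>
  to \<open>tau t\<close>.\<close>

lemma R_tau_subst:
  assumes "R v (tau t)" "R w (concat (map W v))" "\<forall>x\<in>set v. R (W x) (tau (s x))"
  shows "R w (tau (subst s t))"
proof -
  have "R w (concat (map (\<lambda>x. tau (s x)) v))"
    by (rule R_comp[OF assms(2)]) (use assms(3) in \<open>auto simp: list_all2_map1 list_all2_map2 list_all2_same\<close>)
  then show ?thesis
    unfolding tau_subst using assms(3) R_context(3) by (intro R_subst[OF assms(1)]) blast+
qed

text \<open>That the sides of a derived equation share a sort and have its context as an
  \<open>R\<close>-context is no part of the rules of \<open>deduct\<close>. For the substitution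
  rule it rests on \<open>has_sort_subst\<close> and \<open>R_tau_subst\<close>.\<close>

lemma deduct_R_equation:
  assumes "R_theory sg R E" "(v, t1, t2) \<in> deduct sg R E"
  shows "R_equation sg R (v, t1, t2)"
  using assms(2)
proof (induction "(v, t1, t2)" arbitrary: v t1 t2 rule: deduct.induct)
  case deduct_ax
  then show ?case using assms(1) by (auto simp: R_theory_def)
next
  case (deduct_subst v t1 t2 s1 w ws s2)
  then obtain b where b: "has_sort sg t1 b" "has_sort sg t2 b" and R: "R v (tau t1)" "R v (tau t2)"
    by (auto simp: R_equation_def)
  have sort: "has_sort sg (subst s t) b" and Rt: "R w (tau (subst s t))"
    if ren: "R_renaming sg R v s w ws" and t: "has_sort sg t b" "R v (tau t)" for s t
  proof -
    obtain W where "\<forall>x\<in>set v. has_sort sg (s x) (vsort sg x)"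
      "\<forall>x\<in>set v. R (W x) (tau (s x))" "R w (concat (map W v))"
      using R_renaming_map[OF ren] R_context(1)[OF t(2)] by metis
    then show "has_sort sg (subst s t) b" "R w (tau (subst s t))"
      using R_vars[OF t(2)] R_tau_subst[OF t(2)] has_sort_subst[OF t(1)] by blast+
  qed
  show ?case
    using sort[OF _ b(1)] sort[OF _ b(2)] Rt[OF _ b(1)] Rt[OF _ b(2)] R deduct_subst(3,4)
    by (auto simp: R_equation_def)
qed (auto simp: R_equation_def dest: has_sort_unique)

end

context multicat_model begin

lemma homs_letters:
  assumes "set u \<subseteq> vars sg"
    and "\<And>x. x \<in> set u \<Longrightarrow> set (W x) \<subseteq> vars sg \<and> g x \<in> hom C (ctx (W x)) (msort m (vsort sg x))"
  shows "homs C (map (\<lambda>x. ctx (W x)) u) (ctx u) (map g u)"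
proof -
  have "list_all2 (\<lambda>x b. b \<in> sorts sg \<and> set (W x) \<subseteq> vars sg \<and> g x \<in> hom C (ctx (W x)) (msort m b))
      u (map (vsort sg) u)"
    using assms wf by (auto simp: list_all2_map2 list_all2_same wf_signature_def)
  from homs_map[OF this] show ?thesis by (simp add: mctx_def[of sg m u] comp_def)
qed

text \<open>By \<open>comp_act_outer\<close> the restriction of \<open>X\<close> becomes the action
  of a similarity component, which copies, drops and permutes whole blocks \<open>W x\<close>. It
  selects \<open>concat (map W u)\<close> from \<open>concat (map W v)\<close>, so the outer
  restriction absorbs it.\<close>

lemma res_comp_outer:
  assumes "R v u" "R w (concat (map W v))" "\<And>x. x \<in> set v \<Longrightarrow> set (W x) \<subseteq> vars sg"
    and "b \<in> obj C" "X \<in> hom C (ctx u) b" "s \<in> sorts sg"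
    and "\<And>x. x \<in> set v \<Longrightarrow> g x \<in> hom C (ctx (W x)) (msort m (vsort sg x))"
  shows "res w (concat (map W v)) b (mcomp C (ctx v) b (map (\<lambda>x. ctx (W x)) v) (res v u b X) (map g v))
       = res w (concat (map W u)) b (mcomp C (ctx u) b (map (\<lambda>x. ctx (W x)) u) X (map g u))"
proof -
  define \<theta> where "\<theta> = theta_of v u"
  note th = theta_of[OF R_vars[OF assms(1)], folded \<theta>_def]
  have D: "\<theta> \<in> Delta R" unfolding \<theta>_def using assms(1) by (rule theta_of_Delta)
  let ?\<theta>' = "fsim \<theta> (map length (map W v))"
  have D': "?\<theta>' \<in> Delta R"
    using structure_category[OF assms(6)] D th unfolding structure_category_def by simp
  have p: "pull ?\<theta>' (concat (map W v)) = concat (map W u)"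
    using th by (subst pull_fsim) (auto simp: map_pull[symmetric])
  have pm: "pull \<theta> (map h v) = map h u" for h :: "'v \<Rightarrow> 'z"
    using th by (simp add: map_pull[symmetric])
  have pc: "pull \<theta> (ctx v) = ctx u"
    using th by (simp add: pull_mctx)
  have t': "tgt ?\<theta>' = length (concat (map W v))"
    by (simp add: fsim_def length_concat comp_def)
  have u: "set u \<subseteq> set v" using R_vars[OF assms(1)] .
  have homs_u: "homs C (map (\<lambda>x. ctx (W x)) u) (ctx u) (map g u)"
    using u assms(3,7) R_context(3)[OF assms(1)] by (intro homs_letters) auto
  have homs_v: "homs C (map (\<lambda>x. ctx (W x)) v) (ctx v) (map g v)"
    using assms(3,7) R_context(2)[OF assms(1)] by (intro homs_letters) auto
  have "mcomp C (ctx u) b (map (\<lambda>x. ctx (W x)) u) X (map g u) \<in> hom C (ctx (concat (map W u))) b"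
    using comp_closed[OF assms(4,5) homs_u] by (simp add: mctx_concat comp_def)
  moreover have "mcomp C (ctx v) b (map (\<lambda>x. ctx (W x)) v) (res v u b X) (map g v)
    = mact C ?\<theta>' (ctx (concat (map W v))) b (mcomp C (ctx u) b (map (\<lambda>x. ctx (W x)) u) X (map g u))"
    using comp_act_outer[OF D _ assms(4) _ homs_v, of X] th assms(5)
    by (simp add: pc pm mres_def \<theta>_def[symmetric] mctx_concat comp_def)
  ultimately show ?thesis
    using res_act[OF assms(2) D' t' assms(4)] p by simp
qed

text \<open>The induction is over all \<open>v\<close> and \<open>w\<close>, because the arguments
  of a function symbol are treated in their terminal contexts instead of \<open>v\<close>, with the
  same \<open>s\<close> and \<open>W\<close>. The restrictions are matched by
  \<open>res_comp\<close> inside and \<open>res_comp_outer\<close> outside, with associativity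
  between them.\<close>

lemma val_subst:
  assumes "has_sort sg t b" "R v (tau t)" "R w (concat (map W v))"
    and "\<forall>x\<in>set v. has_sort sg (s x) (vsort sg x)" "\<forall>x\<in>set v. R (W x) (tau (s x))"
  shows "val w (subst s t) = res w (concat (map W v)) (msort m b)
    (mcomp C (ctx v) (msort m b) (map (\<lambda>x. ctx (W x)) v) (val v t) (map (\<lambda>x. val (W x) (s x)) v))"
  using assms
proof (induction arbitrary: v w rule: has_sort.induct)
  case (has_sort_Var x)
  let ?b = "msort m (vsort sg x)" and ?g = "\<lambda>x. val (W x) (s x)"
  have R: "R v [x]" using has_sort_Var(2) by simp
  have x: "x \<in> set v" using R_vars[OF R] by simp
  have b: "vsort sg x \<in> sorts sg" using has_sort_Var(1) wf by (simp add: wf_signature_def)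
  have W: "set (W y) \<subseteq> vars sg" and g: "?g y \<in> hom C (ctx (W y)) (msort m (vsort sg y))" if "y \<in> set v" for y
    using that has_sort_Var(4,5) R_context(2) val_closed by blast+
  have i: "mident C ?b \<in> hom C (ctx [x]) ?b"
    using ident_closed[OF msort_obj[OF b]] by (simp add: mctx_def)
  have "res w (concat (map W v)) ?b (mcomp C (ctx v) ?b (map (\<lambda>x. ctx (W x)) v) (val v (Var x)) (map ?g v))
    = res w (W x) ?b (mcomp C [?b] ?b [ctx (W x)] (mident C ?b) [?g x])"
    using res_comp_outer[where g = ?g, OF R has_sort_Var(3) W msort_obj[OF b] i b g] by (simp add: mctx_def)
  also have "mcomp C [?b] ?b [ctx (W x)] (mident C ?b) [?g x] = ?g x"
    using comp_ident_left[OF ctx_obj[OF W[OF x]] msort_obj[OF b] g[OF x]] .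
  also have "res w (W x) ?b (?g x) = val w (s x)"
  proof (rule res_val)
    \<comment> \<open>Axiom \<open>R_subst\<close> for the substitution \<open>W\<close>, applied to
      the one-letter word \<open>[x]\<close> below \<open>v\<close>.\<close>
    show "R w (W x)"
      using R_subst[OF R, of W w] W has_sort_Var(3) by auto
  qed (use x has_sort_Var(4,5) in auto)
  finally show ?case by simp
next
  case (has_sort_Fun f ts)
  note tcs = R_concat_tc[OF has_sort_Fun(3)]
  let ?g = "\<lambda>x. val (W x) (s x)" and ?b = "msort m (fcod sg f)" and ?a = "map (msort m) (fdom sg f)"
  let ?u = "\<lambda>t. tc (tau t)" and ?W = "\<lambda>x. ctx (W x)"
  let ?us = "concat (map ?u ts)" and ?ps = "map (\<lambda>t. concat (map W (?u t))) ts"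
  have lts: "list_all2 (has_sort sg) ts (fdom sg f)"
    using has_sort_Fun(2) by (rule list.rel_mono_strong) simp
  have W: "set (W y) \<subseteq> vars sg" and g: "?g y \<in> hom C (?W y) (msort m (vsort sg y))" if "y \<in> set v" for y
    using that has_sort_Fun(5,6) R_context(2) val_closed by blast+
  have b: "fcod sg f \<in> sorts sg" using has_sort_Fun(1) wf by (simp add: wf_signature_def)
  have u: "set (?u t) \<subseteq> set v" if "t \<in> set ts" for t
    using R_vars[OF tcs(1)] that by auto
  have "R w (concat (map W ?us))"
    by (rule R_subst[OF tcs(1)]) (use W has_sort_Fun(4) in auto)
  then have "R w (concat ?ps)"
    by (simp add: map_concat comp_def concat_concat_map)
  \<comment> \<open>The entries of \<open>?ps\<close> need not be contexts, since different
    \<open>W x\<close> may share variables. Modelability supplies contexts \<open>cs\<close> above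
    them, to which the induction hypothesis applies.\<close>
  then obtain cs where cs: "R w (concat cs)" "list_all2 R cs ?ps"
    by (rule R_split)
  have len: "length cs = length ts" "length (fdom sg f) = length ts"
    using list_all2_lengthD[OF cs(2)] list_all2_lengthD[OF lts] by auto
  have csi: "R (cs ! i) (concat (map W (?u (ts ! i))))" if "i < length ts" for i
    using list_all2_nthD[OF cs(2), of i] that len by simp
  let ?h = "\<lambda>i. mcomp C (ctx (?u (ts ! i))) (?a ! i) (map ?W (?u (ts ! i))) (val (?u (ts ! i)) (ts ! i)) (map ?g (?u (ts ! i)))"
  have IH: "val (cs ! i) (subst s (ts ! i)) = res (cs ! i) (concat (map W (?u (ts ! i)))) (?a ! i) (?h i)"
    if "i < length ts" for i
  proof -
    have t: "ts ! i \<in> set ts" using that by simp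
    then have "\<forall>x\<in>set (?u (ts ! i)). has_sort sg (s x) (vsort sg x)" "\<forall>x\<in>set (?u (ts ! i)). R (W x) (tau (s x))"
      using u has_sort_Fun(5,6) by blast+
    then show ?thesis
      using list_all2_nthD[OF has_sort_Fun(2) that] tcs(2)[OF t] csi[OF that] len(2) that by simp
  qed
  have sub: "list_all2 (has_sort sg) (map (subst s) ts) (fdom sg f)"
  proof (rule list_all2_all_nthI)
    fix i assume "i < length (map (subst s) ts)"
    then have i: "i < length ts" by simp
    then have "set (tau (ts ! i)) \<subseteq> set v"
      using R_vars[OF tcs(2)] u nth_mem by blast
    then have "has_sort sg (subst s (ts ! i)) (fdom sg f ! i)"
      using has_sort_subst[OF list_all2_nthD[OF lts i]] has_sort_Fun(5) by blast
    with i show "has_sort sg (map (subst s) ts ! i) (fdom sg f ! i)" by simp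
  qed (simp add: len)
  have Rsub: "list_all2 R cs (map tau (map (subst s) ts))"
  proof (rule list_all2_all_nthI)
    fix i assume "i < length cs"
    then have i: "i < length ts" using len by simp
    then have "R (cs ! i) (tau (subst s (ts ! i)))"
      using R_tau_subst[OF tcs(2) csi[OF i]] u[of "ts ! i"] has_sort_Fun(6) nth_mem[OF i] by blast
    with i show "R (cs ! i) (map tau (map (subst s) ts) ! i)" by simp
  qed (simp add: len)
  have hg: "homs C (map ?W (?u t)) (ctx (?u t)) (map ?g (?u t))" if "t \<in> set ts" for t
    using u[OF that] W g R_context(2)[OF tcs(2)[OF that]] by (intro homs_letters) blast+
  have hv: "homs C (map (\<lambda>t. ctx (?u t)) ts) ?a (map (\<lambda>t. val (?u t) t) ts)"
    using homs_val[OF lts] tcs(2) by simp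
  have hi: "?h i \<in> hom C (ctx (?ps ! i)) (?a ! i)" if "i < length ts" for i
  proof -
    have t: "ts ! i \<in> set ts" using that by simp
    have "?a ! i \<in> obj C" "val (?u (ts ! i)) (ts ! i) \<in> hom C (ctx (?u (ts ! i))) (?a ! i)"
      using hv that len by (auto simp: homs_def)
    from comp_closed[OF this hg[OF t]] that show ?thesis by (simp add: mctx_concat comp_def)
  qed
  have hp: "homs C (map ctx ?ps) ?a (map ?h [0..<length ts])"
  proof -
    have "map ctx ?ps \<in> lists (lists (obj C))"
      using u W by (intro ctxs_obj) force
    then show ?thesis using hi hv len by (simp add: homs_def)
  qed
  let ?Ws = "map (\<lambda>t. map ?W (?u t)) ts" and ?gs = "map (\<lambda>t. map ?g (?u t)) ts"
  have eq: "map (\<lambda>i. mcomp C (map (\<lambda>t. ctx (?u t)) ts ! i) (?a ! i) (?Ws ! i)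
      (map (\<lambda>t. val (?u t) t) ts ! i) (?gs ! i)) [0..<length ts] = map ?h [0..<length ts]"
    by (rule map_cong) auto
  have "val w (subst s (Fun f ts))
    = res w (concat cs) ?b (mcomp C ?a ?b (map ctx cs) (mfun m f) (map2 val cs (map (subst s) ts)))"
    using val_Fun[OF has_sort_Fun(1) sub Rsub cs(1)] by simp
  also have "map2 val cs (map (subst s) ts)
    = map (\<lambda>i. res (cs ! i) (?ps ! i) (?a ! i) (map ?h [0..<length ts] ! i)) [0..<length ?a]"
    by (rule nth_equalityI) (auto simp: len IH)
  also have "res w (concat cs) ?b (mcomp C ?a ?b (map ctx cs) (mfun m f) \<dots>)
    = res w (concat ?ps) ?b (mcomp C ?a ?b (map ctx ?ps) (mfun m f) (map ?h [0..<length ts]))"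
    by (rule res_comp[OF b cs fcod_obj mfun_closed hp]) (use has_sort_Fun(1) in auto)
  \<comment> \<open>Associativity, read from right to left, gathers the values substituted into all
    arguments in one family over \<open>?us\<close>.\<close>
  also have "mcomp C ?a ?b (map ctx ?ps) (mfun m f) (map ?h [0..<length ts])
    = mcomp C (ctx ?us) ?b (map ?W ?us) (mcomp C ?a ?b (map (\<lambda>t. ctx (?u t)) ts) (mfun m f)
        (map (\<lambda>t. val (?u t) t) ts)) (map ?g ?us)"
    using comp_assoc[OF fcod_obj[OF has_sort_Fun(1)] mfun_closed[OF has_sort_Fun(1)] hv,
        of ?Ws ?gs] hg
    unfolding length_map len(2) eq by (simp add: len map_concat mctx_concat comp_def)
  also have "res w (concat ?ps) ?b \<dots> = res w (concat (map W ?us)) ?b \<dots>"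
    by (simp add: map_concat comp_def concat_concat_map)
  also have "\<dots> = res w (concat (map W v)) ?b (mcomp C (ctx v) ?b (map ?W v) (val v (Fun f ts)) (map ?g v))"
    using res_comp_outer[OF tcs(1) has_sort_Fun(4) W fcod_obj comp_val_closed b g] has_sort_Fun(1) lts tcs(2)
    by simp
  finally show ?case by simp
qed

text \<open>For the substitution rule, \<open>val_subst\<close> writes both sides as composites: the
  outer factors agree by the induction hypothesis on the equation, the inner ones by the induction
  hypotheses on the substituted terms.\<close>

theorem deduct_sound:
  assumes E: "R_theory sg R E" "\<forall>\<phi>\<in>E. models_eqn sg R C m \<phi>" and "(v, t1, t2) \<in> deduct sg R E"
  shows "val v t1 = val v t2"
  using assms(3)
proof (induction "(v, t1, t2)" arbitrary: v t1 t2 rule: deduct.induct)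
  case (deduct_ax v t1 t2)
  then show ?case
    using E models_eqn_val[of v t1 t2] by (auto simp: R_theory_def)
next
  case (deduct_subst v t1 t2 s1 w ws s2)
  from deduct_R_equation[OF E(1) deduct_subst(1)] obtain b
    where b: "has_sort sg t1 b" "has_sort sg t2 b" and R: "R v (tau t1)" "R v (tau t2)"
    by (auto simp: R_equation_def)
  obtain W where W: "ws = map W v" "\<forall>x\<in>set v. has_sort sg (s1 x) (vsort sg x)"
      "\<forall>x\<in>set v. R (W x) (tau (s1 x))" "R w (concat (map W v))"
    using R_renaming_map[OF deduct_subst(3) R_context(1)[OF R(1)]] by metis
  have W2: "\<forall>x\<in>set v. has_sort sg (s2 x) (vsort sg x)" "\<forall>x\<in>set v. R (W x) (tau (s2 x))"
    using deduct_subst(4) W(1) by (auto simp: R_renaming_def list_all2_map1 list_all2_map2 list_all2_same)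
  have "val (W x) (s1 x) = val (W x) (s2 x)" if "x \<in> set v" for x
    using that deduct_subst(5) W(1) by (auto simp: in_set_conv_nth)
  then have eq: "map (\<lambda>x. val (W x) (s1 x)) v = map (\<lambda>x. val (W x) (s2 x)) v"
    by simp
  show ?case
    using val_subst[OF b(1) R(1) W(4,2,3)] val_subst[OF b(2) R(2) W(4) W2] deduct_subst(2)
    unfolding eq by simp
qed simp_all

end

section \<open>Ground terms and initial algebras\<close>

text \<open>Deleting the variables from the signature leaves exactly the closed well-sorted terms,
  so \<open>has_sort\<close> and its induction can be reused.\<close>

abbreviation ground_sort :: "('s, 'f, 'v) signature \<Rightarrow> ('f, 'v) trm \<Rightarrow> 's \<Rightarrow> bool" where
  "ground_sort sg \<equiv> has_sort (sg\<lparr>vars := {}\<rparr>)"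

lemma ground_sort_Fun:
  "f \<in> funs sg \<Longrightarrow> list_all2 (ground_sort sg) ts (fdom sg f) \<Longrightarrow> ground_sort sg (Fun f ts) (fcod sg f)"
  using has_sort_Fun[of f "sg\<lparr>vars := {}\<rparr>" ts] by simp

lemma ground_sort_induct [consumes 1, case_names Fun]:
  assumes "ground_sort sg t s"
    and "\<And>f ts. f \<in> funs sg \<Longrightarrow> list_all2 (\<lambda>t s. ground_sort sg t s \<and> P t s) ts (fdom sg f)
      \<Longrightarrow> P (Fun f ts) (fcod sg f)"
  shows "P t s"
  using assms(1) by (induction rule: has_sort.induct) (auto intro: assms(2))

lemma eval_ground_carrier:
  assumes "is_algebra sg A"
  shows "ground_sort sg t s \<Longrightarrow> eval_alg A e t \<in> carrier A s"
proof (induction rule: ground_sort_induct)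
  case (Fun f ts)
  then have "list_all2 (\<lambda>x s. x \<in> carrier A s) (map (eval_alg A e) ts) (fdom sg f)"
    by (auto simp: list_all2_map1 elim: list.rel_mono_strong)
  then show ?case using assms Fun(1) by (auto simp: is_algebra_def)
qed

lemma alg_hom_eval:
  assumes "is_algebra sg A" "alg_hom sg A B h"
  shows "ground_sort sg t s \<Longrightarrow> h s (eval_alg A e t) = eval_alg B e' t"
proof (induction rule: ground_sort_induct)
  case (Fun f ts)
  have "list_all2 (\<lambda>x s. x \<in> carrier A s) (map (eval_alg A e) ts) (fdom sg f)"
    using Fun(2) eval_ground_carrier[OF assms(1)] by (auto simp: list_all2_map1 elim: list.rel_mono_strong)
  then have "h (fcod sg f) (eval_alg A e (Fun f ts))
      = interp B f (map2 h (fdom sg f) (map (eval_alg A e) ts))"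
    using assms(2) Fun(1) by (auto simp: alg_hom_def)
  also have "map2 h (fdom sg f) (map (eval_alg A e) ts) = map (eval_alg B e') ts"
    using Fun(2) by (intro nth_equalityI) (auto simp: list_all2_conv_all_nth)
  finally show ?case by simp
qed

text \<open>The values of ground terms form a subalgebra that is again a model, over the same
  carrier type. A homomorphism into it, followed by the inclusion, is an endomorphism of
  \<open>A\<close> and so agrees with the identity; hence every element lies in the
  subalgebra.\<close>

lemma initial_generated:
  fixes A :: "('s, 'f, 'c) algebra" and sg :: "('s, 'f, 'v) signature"
  assumes sorts: "\<forall>f\<in>funs sg. fdom sg f \<in> lists (sorts sg) \<and> fcod sg f \<in> sorts sg"
    and A: "initial_alg_model TYPE('c) sg E A" and x: "s \<in> sorts sg" "x \<in> carrier A s"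
  shows "\<exists>t. ground_sort sg t s \<and> x = eval_alg A e t"
proof -
  define A' where "A' = A\<lparr>carrier := \<lambda>s. {eval_alg A e t | t. ground_sort sg t s}\<rparr>"
  have alg: "is_algebra sg A" and mod: "\<forall>\<phi>\<in>E. alg_models_eqn sg A \<phi>"
    using A by (auto simp: initial_alg_model_def alg_model_def)
  have sub: "carrier A' s \<subseteq> carrier A s" for s
    using eval_ground_carrier[OF alg] by (auto simp: A'_def)
  have interp: "interp A' = interp A" by (simp add: A'_def)
  have eval: "eval_alg A' = eval_alg A"
  proof (intro ext)
    fix e :: "'z \<Rightarrow> 'c" and t show "eval_alg A' e t = eval_alg A e t"
      by (induction t) (simp_all add: A'_def cong: map_cong)
  qed
  have "is_algebra sg A'"
    unfolding is_algebra_def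
  proof (intro ballI allI impI)
    fix f xs assume f: "f \<in> funs sg" and xs: "list_all2 (\<lambda>x s. x \<in> carrier A' s) xs (fdom sg f)"
    from xs have "\<forall>i<length xs. \<exists>t. ground_sort sg t (fdom sg f ! i) \<and> xs ! i = eval_alg A e t"
      by (auto simp: list_all2_conv_all_nth A'_def)
    then obtain t where t: "\<And>i. i < length xs \<Longrightarrow> ground_sort sg (t i) (fdom sg f ! i) \<and> xs ! i = eval_alg A e (t i)"
      by metis
    have "ground_sort sg (Fun f (map t [0..<length xs])) (fcod sg f)"
      using f t list_all2_lengthD[OF xs] by (intro ground_sort_Fun) (auto simp: list_all2_conv_all_nth)
    moreover have "map (eval_alg A e) (map t [0..<length xs]) = xs"
      using t by (intro nth_equalityI) auto
    ultimately show "interp A' f xs \<in> carrier A' (fcod sg f)"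
      unfolding A'_def by (auto intro!: exI[of _ "Fun f (map t [0..<length xs])"])
  qed
  moreover have "\<forall>\<phi>\<in>E. alg_models_eqn sg A' \<phi>"
    using mod sub unfolding alg_models_eqn_def eval by blast
  ultimately have "alg_model sg E A'" by (simp add: alg_model_def)
  then obtain h where h: "alg_hom sg A A' h"
    using A unfolding initial_alg_model_def by blast
  then have "alg_hom sg A A h"
    using subsetD[OF sub] unfolding alg_hom_def by (simp add: interp)
  moreover have "alg_hom sg A A (\<lambda>s x. x)"
  proof -
    have "map2 (\<lambda>s x. x) ss xs = xs" if "list_all2 (\<lambda>x s. x \<in> carrier A s) xs ss" for xs ss
      using that by (intro nth_equalityI) (auto simp: list_all2_conv_all_nth)
    then show ?thesis by (simp add: alg_hom_def)
  qed
  ultimately have "h s x = x"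
    using A x unfolding initial_alg_model_def by metis
  moreover have "h s x \<in> carrier A' s" using h x by (auto simp: alg_hom_def)
  ultimately show ?thesis by (auto simp: A'_def)
qed

text \<open>In the quotient \<open>B'\<close> the terms of a class need not be well-sorted, so that every operation is
  defined on all families of classes and \<open>\<iota>\<close> commutes with the operations unconditionally.\<close>

lemma ex_alg_hom:
  fixes A :: "('s, 'f, 'c) algebra" and B :: "('s, 'f, 'b) algebra" and sg :: "('s, 'f, 'v) signature"
  assumes sorts: "\<forall>f\<in>funs sg. fdom sg f \<in> lists (sorts sg) \<and> fcod sg f \<in> sorts sg"
    and A: "initial_alg_model TYPE(('f, 'v) trm set) sg E A" and B: "alg_model sg E B"
    and vars: "\<And>v t1 t2 x. (v, t1, t2) \<in> E \<Longrightarrow> t1 = Var x \<or> t2 = Var x \<Longrightarrow> x \<in> set v"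
  shows "\<exists>h. alg_hom sg A B h"
proof -
  \<comment> \<open>One fixed valuation, of no particular choice, so that terms with variables have
    a value as well.\<close>
  obtain e0 :: "'v \<Rightarrow> 'b" where True by blast
  define cls where "cls x = {t. eval_alg B e0 t = x}" for x
  \<comment> \<open>\<open>\<iota>\<close> reads off the value shared by the members of a class. On
    any set at all it returns the value of some term, so every operation of \<open>B'\<close> below
    yields a nonempty class.\<close>
  define \<iota> where "\<iota> X = eval_alg B e0 (SOME t. t \<in> X)" for X
  define B' where "B' = \<lparr>carrier = \<lambda>s. {cls (eval_alg B e0 t) | t. ground_sort sg t s},
    interp = \<lambda>f Xs. cls (interp B f (map \<iota> Xs))\<rparr>"
  have alg: "is_algebra sg B" and mod: "\<forall>\<phi>\<in>E. alg_models_eqn sg B \<phi>"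
    using B by (auto simp: alg_model_def)
  have \<iota>_cls: "\<iota> (cls (eval_alg B e0 t)) = eval_alg B e0 t" for t
    unfolding \<iota>_def cls_def using someI[of "\<lambda>t'. eval_alg B e0 t' = eval_alg B e0 t" t] by simp
  have cls_interp: "interp B f (map \<iota> Xs) = eval_alg B e0 (Fun f (map (\<lambda>X. SOME t. t \<in> X) Xs))" for f Xs
    by (simp add: \<iota>_def[abs_def] comp_def)
  have \<iota>_interp: "\<iota> (interp B' f Xs) = interp B f (map \<iota> Xs)" for f Xs
    unfolding B'_def algebra.simps cls_interp \<iota>_cls ..
  have \<iota>_eval: "\<iota> (eval_alg B' e t) = eval_alg B (\<lambda>x. \<iota> (e x)) t" for e :: "'v \<Rightarrow> ('f, 'v) trm set" and t
    by (induction t) (simp_all add: \<iota>_interp comp_def cong: map_cong)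
  have \<iota>_carrier: "\<iota> X \<in> carrier B s" if "X \<in> carrier B' s" for X s
    using that \<iota>_cls eval_ground_carrier[OF alg] by (auto simp: B'_def)
  have "is_algebra sg B'"
    unfolding is_algebra_def
  proof (intro ballI allI impI)
    fix f Xs assume f: "f \<in> funs sg" and Xs: "list_all2 (\<lambda>x s. x \<in> carrier B' s) Xs (fdom sg f)"
    from Xs have "\<forall>i<length Xs. \<exists>t. ground_sort sg t (fdom sg f ! i) \<and> Xs ! i = cls (eval_alg B e0 t)"
      by (auto simp: list_all2_conv_all_nth B'_def)
    then obtain t where t: "\<And>i. i < length Xs \<Longrightarrow> ground_sort sg (t i) (fdom sg f ! i) \<and> Xs ! i = cls (eval_alg B e0 (t i))"
      by metis
    have "ground_sort sg (Fun f (map t [0..<length Xs])) (fcod sg f)"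
      using f t list_all2_lengthD[OF Xs] by (intro ground_sort_Fun) (auto simp: list_all2_conv_all_nth)
    moreover have "map \<iota> Xs = map (eval_alg B e0) (map t [0..<length Xs])"
      using t by (intro nth_equalityI) (auto simp: \<iota>_cls)
    ultimately show "interp B' f Xs \<in> carrier B' (fcod sg f)"
      unfolding B'_def by (auto intro!: exI[of _ "Fun f (map t [0..<length Xs])"])
  qed
  moreover have "alg_models_eqn sg B' \<phi>" if "\<phi> \<in> E" for \<phi>
  proof -
    obtain v t1 t2 where \<phi>: "\<phi> = (v, t1, t2)" by (cases \<phi>)
    show ?thesis
      unfolding \<phi> alg_models_eqn_def prod.case
    proof (intro allI impI)
      fix e assume e: "\<forall>x\<in>set v. e x \<in> carrier B' (vsort sg x)"
      \<comment> \<open>Equality in \<open>B\<close> transfers to \<open>B'\<close> only for sides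
        that are classes. Applications always are; a bare variable is one because its context
        declares it, which is the purpose of the hypothesis \<open>vars\<close>.\<close>
      have "cls (\<iota> (eval_alg B' e t)) = eval_alg B' e t" if "t = t1 \<or> t = t2" for t
      proof (cases t)
        case (Var x)
        with that have "e x \<in> carrier B' (vsort sg x)" using vars e \<open>\<phi> \<in> E\<close> \<phi> by blast
        then obtain t' where "e x = cls (eval_alg B e0 t')" by (auto simp: B'_def)
        then show ?thesis by (simp add: Var \<iota>_cls)
      next
        case (Fun f ts)
        then have "eval_alg B' e t = cls (interp B f (map \<iota> (map (eval_alg B' e) ts)))"
          by (simp add: B'_def)
        then show ?thesis unfolding cls_interp by (simp only: \<iota>_cls)
      qed
      then have "eval_alg B' e t1 = cls (\<iota> (eval_alg B' e t1))" "eval_alg B' e t2 = cls (\<iota> (eval_alg B' e t2))"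
        by simp_all
      moreover have "eval_alg B (\<lambda>x. \<iota> (e x)) t1 = eval_alg B (\<lambda>x. \<iota> (e x)) t2"
        using mod[rule_format, OF \<open>\<phi> \<in> E\<close>] e \<iota>_carrier unfolding \<phi> alg_models_eqn_def by simp
      ultimately show "eval_alg B' e t1 = eval_alg B' e t2"
        by (metis \<iota>_eval)
    qed
  qed
  ultimately have "alg_model sg E B'" by (simp add: alg_model_def)
  then obtain h where h: "alg_hom sg A B' h"
    using A unfolding initial_alg_model_def by blast
  have "alg_hom sg A B (\<lambda>s x. \<iota> (h s x))"
    using h \<iota>_carrier unfolding alg_hom_def by (auto simp: \<iota>_interp comp_def case_prod_unfold)
  then show ?thesis by blast
qed

text \<open>A homomorphism is forced on the values of ground terms, and these exhaust
  \<open>A\<close>. So uniqueness holds for targets of every carrier type, although initiality is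
  assumed here only against algebras over \<open>'c\<close>.\<close>

lemma alg_hom_unique:
  fixes A :: "('s, 'f, 'c) algebra" and sg :: "('s, 'f, 'v) signature"
  assumes "\<forall>f\<in>funs sg. fdom sg f \<in> lists (sorts sg) \<and> fcod sg f \<in> sorts sg"
    and "initial_alg_model TYPE('c) sg E A"
    and "alg_hom sg A B h" "alg_hom sg A B h'" "s \<in> sorts sg" "x \<in> carrier A s"
  shows "h s x = h' s x"
proof -
  have "is_algebra sg A" using assms(2) by (simp add: initial_alg_model_def alg_model_def)
  then show ?thesis
    using initial_generated[OF assms(1,2,5,6)] alg_hom_eval assms(3,4) by metis
qed

section \<open>Models of the categorization theory\<close>

lemma ext_signature_simps [simp]:
  "sorts (ext_signature sg R) = lists (sorts sg) \<times> sorts sg"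
  "fdom (ext_signature sg R) = msym_dom sg" "fcod (ext_signature sg R) = msym_cod sg"
  "vsort (ext_signature sg R) = snd"
  "CompS bs c as \<in> funs (ext_signature sg R) \<longleftrightarrow>
     bs \<in> lists (sorts sg) \<and> c \<in> sorts sg \<and> as \<in> lists (lists (sorts sg)) \<and> length as = length bs"
  "IdS c \<in> funs (ext_signature sg R) \<longleftrightarrow> c \<in> sorts sg"
  "ActS \<theta> bs c \<in> funs (ext_signature sg R) \<longleftrightarrow>
     \<theta> \<in> Delta R \<and> bs \<in> lists (sorts sg) \<and> length bs = tgt \<theta> \<and> c \<in> sorts sg"
  "ConstS f \<in> funs (ext_signature sg R) \<longleftrightarrow> f \<in> funs sg"
  by (auto simp: ext_signature_def)

lemma pull_lists: "is_finmap \<theta> \<Longrightarrow> length a = tgt \<theta> \<Longrightarrow> a \<in> lists S \<Longrightarrow> pull \<theta> a \<in> lists S"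
  using set_pull[of \<theta> a] by auto

lemma concat_lists: "xss \<in> lists (lists S) \<Longrightarrow> concat xss \<in> lists S"
  by (induction xss) auto

lemma zip_lists: "xs \<in> lists S \<Longrightarrow> ys \<in> lists T \<Longrightarrow> zip xs ys \<in> lists (S \<times> T)"
  by (auto dest: set_zip_leftD set_zip_rightD)

lemma ext_signature_sorts:
  assumes "wf_signature sg" "f \<in> funs (ext_signature sg R)"
  shows "fdom (ext_signature sg R) f \<in> lists (sorts (ext_signature sg R))"
    "fcod (ext_signature sg R) f \<in> sorts (ext_signature sg R)"
proof -
  have "msym_dom sg f \<in> lists (lists (sorts sg) \<times> sorts sg) \<and> msym_cod sg f \<in> lists (sorts sg) \<times> sorts sg"
  proof (cases f)
    case (CompS bs c as)
    then have "as \<in> lists (lists (sorts sg))" "bs \<in> lists (sorts sg)" "c \<in> sorts sg"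
      using assms by simp_all
    then show ?thesis using zip_lists[of as _ bs] concat_lists[of as] CompS by (simp del: in_lists_conv_set)
  next
    case (ActS \<theta> bs c)
    then have "pull \<theta> bs \<in> lists (sorts sg)"
      using assms by (intro pull_lists) (auto simp: Delta_def)
    then show ?thesis using assms ActS by simp
  qed (use assms in \<open>auto simp: wf_signature_def\<close>)
  then show "fdom (ext_signature sg R) f \<in> lists (sorts (ext_signature sg R))"
    "fcod (ext_signature sg R) f \<in> sorts (ext_signature sg R)" by auto
qed

text \<open>The equations of \<open>cat_theory\<close> are stated in distinct variables, whereas the
  axioms speak of arbitrary elements, possibly equal. Numbering variables by their position in the
  flattened list keeps them distinct, and the valuation reads the element at that position.\<close>

lemma ex_valuation:
  fixes A :: "('s msrt, ('s, 'f) msym, 'c) algebra"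
  assumes "list_all2 (list_all2 (\<lambda>x s. x \<in> carrier A s)) xss sss"
  obtains e :: "'s mvar \<Rightarrow> 'c" and vss where "distinct (concat vss)" "map (map snd) vss = sss" "map (map e) vss = xss"
    "\<forall>x\<in>set (concat vss). e x \<in> carrier A (snd x)"
proof -
  have lens: "map length xss = map length sss"
    using assms by (auto simp: list_all2_conv_all_nth intro!: nth_equalityI)
  let ?n = "length (concat sss)"
  define vs where "vs = zip [0..<?n] (concat sss)"
  define e :: "'s mvar \<Rightarrow> 'c" where "e = (\<lambda>x. concat xss ! fst x)"
  have len: "length (concat xss) = ?n" by (simp add: length_concat lens)
  have vs: "length vs = ?n" "distinct vs" "map snd vs = concat sss" "map e vs = concat xss"
    by (auto simp: vs_def e_def distinct_zipI1 len intro!: nth_equalityI)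
  have "list_all2 (\<lambda>x s. x \<in> carrier A s) (concat xss) (concat sss)"
    using assms by (induction rule: list_all2_induct) (auto intro: list_all2_appendI)
  then have c: "\<forall>x\<in>set vs. e x \<in> carrier A (snd x)"
    using len by (auto simp: vs_def e_def set_zip list_all2_conv_all_nth)
  obtain vss where vss: "concat vss = vs" "map length vss = map length sss"
    using split_blocks[of "map length sss" vs] vs(1) by (auto simp: length_concat)
  have l: "length vss = length sss" "\<And>i. i < length sss \<Longrightarrow> length (vss ! i) = length (sss ! i)"
    using vss(2) by (metis length_map, metis length_map nth_map)
  have l': "length xss = length sss" "\<And>i. i < length sss \<Longrightarrow> length (xss ! i) = length (sss ! i)"
    using lens by (metis length_map, metis length_map nth_map)
  have "map (map snd) vss = sss"
    by (rule concat_injective) (use vss vs l in \<open>auto simp: map_concat[symmetric] set_zip\<close>)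
  moreover have "map (map e) vss = xss"
    by (rule concat_injective) (use vss vs l l' in \<open>auto simp: map_concat[symmetric] set_zip\<close>)
  ultimately show ?thesis using that[of vss e] vss(1) vs(2) c by simp
qed

lemma alg_multicat_simps [simp]:
  "obj (alg_multicat sg A) = sorts sg" "hom (alg_multicat sg A) a b = carrier A (a, b)"
  "mcomp (alg_multicat sg A) bs c as g fs = interp A (CompS bs c as) (g # fs)"
  "mident (alg_multicat sg A) c = interp A (IdS c) []"
  "mact (alg_multicat sg A) \<theta> a b f = interp A (ActS \<theta> a b) [f]"
  by (simp_all add: alg_multicat_def)

lemma homs_alg_multicat:
  "homs (alg_multicat sg A) as bs fs \<longleftrightarrow>
     bs \<in> lists (sorts sg) \<and> as \<in> lists (lists (sorts sg)) \<and> length as = length bs \<and>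
     list_all2 (\<lambda>x s. x \<in> carrier A s) fs (zip as bs)"
  by (auto simp: homs_def list_all2_conv_all_nth)

lemma ex_valuation_Cons:
  fixes A :: "('s msrt, ('s, 'f) msym, 'c) algebra"
  assumes "y \<in> carrier A s" "list_all2 (\<lambda>x s. x \<in> carrier A s) ys ss"
  obtains e :: "'s mvar \<Rightarrow> 'c" and x xs where "distinct (x # xs)" "snd x = s" "map snd xs = ss" "e x = y" "map e xs = ys"
    "\<forall>z\<in>set (x # xs). e z \<in> carrier A (snd z)"
proof -
  have "list_all2 (list_all2 (\<lambda>x s. x \<in> carrier A s)) [[y], ys] [[s], ss]" using assms by simp
  then obtain e :: "'s mvar \<Rightarrow> 'c" and vss where "distinct (concat vss)" "map (map snd) vss = [[s], ss]"
    "map (map e) vss = [[y], ys]" "\<forall>x\<in>set (concat vss). e x \<in> carrier A (snd x)"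
    by (rule ex_valuation)
  moreover from this(2) obtain x xs where "vss = [[x], xs]"
    by (auto simp: map_eq_Cons_conv)
  ultimately show ?thesis using that[of x xs e] by simp
qed

text \<open>An axiom at given elements is the corresponding equation at a valuation that sends its
  variables to them. A lone variable gets the number 0; several distinct ones come from
  \<open>ex_valuation\<close>.\<close>

theorem multicategory_alg_multicat:
  fixes A :: "('s msrt, ('s, 'f) msym, 'c) algebra" and sg :: "('s, 'f, 'v) signature"
  assumes alg: "is_algebra (ext_signature sg R) A"
    and mod: "\<forall>\<phi>\<in>cat_theory sg R. alg_models_eqn (ext_signature sg R) A \<phi>"
  shows "multicategory (Delta R) (alg_multicat sg A)"
proof -
  let ?C = "alg_multicat sg A"
  have interp: "interp A f xs \<in> carrier A (msym_cod sg f)"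
    if "f \<in> funs (ext_signature sg R)" "list_all2 (\<lambda>x s. x \<in> carrier A s) xs (msym_dom sg f)" for f xs
    using alg that by (simp add: is_algebra_def)
  have eqn: "eval_alg A e t1 = eval_alg A e t2"
    if "(v, t1, t2) \<in> cat_theory sg R" "\<forall>x\<in>set v. e x \<in> carrier A (snd x)" for v t1 t2 e
    using mod that by (auto simp: alg_models_eqn_def)
  show ?thesis
  proof (unfold_locales, goal_cases)
    case (1 c g bs as fs)
    then show ?case using interp[of "CompS bs c as" "g # fs"] by (simp add: homs_alg_multicat)
  next
    case (2 c)
    then show ?case using interp[of "IdS c" "[]"] by simp
  next
    case (3 \<theta> a b f)
    then show ?case using interp[of "ActS \<theta> a b" "[f]"] by simp
  next
    case (4 d h cs bss gs asss fss)
    let ?P = "\<lambda>x s. x \<in> carrier A s"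
    \<comment> \<open>One block for \<open>h\<close>, one for \<open>gs\<close> and one for each
      list in \<open>fss\<close>, so that the variables come back in the grouping that
      \<open>cat_assoc\<close> requires.\<close>
    have "list_all2 (list_all2 ?P) ([h] # gs # fss) ([(cs, d)] # zip bss cs # map2 zip asss bss)"
      using 4 by (auto simp: homs_alg_multicat list_all2_conv_all_nth[of "list_all2 ?P"])
    then obtain e :: "'s mvar \<Rightarrow> 'c" and vss where vss: "distinct (concat vss)" "map (map snd) vss = [(cs, d)] # zip bss cs # map2 zip asss bss"
      "map (map e) vss = [h] # gs # fss" "\<forall>x\<in>set (concat vss). e x \<in> carrier A (snd x)"
      by (rule ex_valuation)
    obtain vh vg vf where v: "vss = [vh] # vg # vf"
      using vss(2) by (auto simp: map_eq_Cons_conv)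
    have l: "length bss = length cs" "length vf = length cs" "length asss = length cs" "length fss = length cs"
      using 4 vss(3) v by (auto simp: homs_alg_multicat dest: arg_cong[of _ _ length])
    have lg: "length vg = length cs"
      using 4 vss(3) v by (auto simp: homs_alg_multicat dest: list_all2_lengthD)
    have "(vh # vg @ concat vf,
       compT (concat bss) d (concat asss) (compT cs d bss (Var vh) (map Var vg)) (map Var (concat vf)),
       compT cs d (map concat asss) (Var vh)
         (map (\<lambda>i. compT (bss ! i) (cs ! i) (asss ! i) (Var (vg ! i)) (map Var (vf ! i)))
            [0..<length cs])) \<in> cat_theory sg R"
    proof (rule cat_assoc)
      show "\<forall>i<length cs. mvars (sorts sg) (asss ! i) (bss ! i) (vf ! i)"
      proof (intro allI impI)
        fix i assume i: "i < length cs"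
        then have "map snd (vf ! i) = zip (asss ! i) (bss ! i)"
          using arg_cong[OF vss(2), of "\<lambda>l. tl (tl l) ! i"] v l by simp
        with i 4 show "mvars (sorts sg) (asss ! i) (bss ! i) (vf ! i)"
          by (auto simp: mvars_def homs_alg_multicat)
      qed
    qed (use 4 vss v l in \<open>auto simp: mvars_def homs_alg_multicat\<close>)
    from eqn[OF this, of e] have
      "interp A (CompS (concat bss) d (concat asss)) (interp A (CompS cs d bss) (e vh # map e vg) # concat (map (map e) vf))
       = interp A (CompS cs d (map concat asss)) (e vh #
           map (\<lambda>i. interp A (CompS (bss ! i) (cs ! i) (asss ! i)) (e (vg ! i) # map e (vf ! i))) [0..<length cs])"
      using vss(4) v by (simp add: comp_def map_concat)
    moreover have "map (\<lambda>i. interp A (CompS (bss ! i) (cs ! i) (asss ! i)) (e (vg ! i) # map e (vf ! i))) [0..<length cs]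
      = map (\<lambda>i. interp A (CompS (bss ! i) (cs ! i) (asss ! i)) (gs ! i # fss ! i)) [0..<length cs]"
      using vss(3) v l lg by (intro map_cong) auto
    ultimately show ?case using vss(3) v by simp
  next
    case (5 a b f)
    have "([(0, (a, b))], compT [b] b [a] (idT b) [Var (0, (a, b))], Var (0, (a, b))) \<in> cat_theory sg R"
      by (rule cat_ident_left) (use 5 in \<open>simp add: mvars_def\<close>)
    from eqn[OF this, of "\<lambda>_. f"] show ?case using 5 by simp
  next
    case (6 a b f)
    have "([(0, (a, b))], compT a b (map (\<lambda>x. [x]) a) (Var (0, (a, b))) (map idT a), Var (0, (a, b))) \<in> cat_theory sg R"
      by (rule cat_ident_right) (use 6 in \<open>simp add: mvars_def\<close>)
    from eqn[OF this, of "\<lambda>_. f"] show ?case using 6(3) by (simp add: comp_def alg_multicat_def)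
  next
    case (7 a b f)
    have "([(0, (a, b))], actT (fid (length a)) a b (Var (0, (a, b))), Var (0, (a, b))) \<in> cat_theory sg R"
      by (rule cat_act_id) (use 7 in \<open>simp add: mvars_def\<close>)
    from eqn[OF this, of "\<lambda>_. f"] show ?case using 7 by simp
  next
    case (8 \<sigma> \<tau> a b f)
    let ?x = "(0, (pull (fcomp \<tau> \<sigma>) a, b))"
    have "pull \<tau> a \<in> lists (sorts sg)"
      using 8 by (intro pull_lists) (auto simp: Delta_def)
    then have "pull (fcomp \<tau> \<sigma>) a \<in> lists (sorts sg)"
      using 8 pull_lists[of \<sigma> "pull \<tau> a"] by (simp add: Delta_def pull_fcomp)
    then have "([?x], actT (fcomp \<tau> \<sigma>) a b (Var ?x), actT \<tau> a b (actT \<sigma> (pull \<tau> a) b (Var ?x))) \<in> cat_theory sg R"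
      by (intro cat_act_fcomp) (use 8 in \<open>auto simp: mvars_def\<close>)
    from eqn[OF this, of "\<lambda>_. f"] show ?case using 8 by simp
  next
    case (9 \<sigma>s bs as c g fs)
    have "g \<in> carrier A (bs, c)" "list_all2 (\<lambda>x s. x \<in> carrier A s) fs (zip (map2 pull \<sigma>s as) bs)"
      using 9 by (auto simp: homs_alg_multicat)
    then obtain e :: "'s mvar \<Rightarrow> 'c" and h gs where v: "distinct (h # gs)" "snd h = (bs, c)" "map snd gs = zip (map2 pull \<sigma>s as) bs"
      "e h = g" "map e gs = fs" "\<forall>z\<in>set (h # gs). e z \<in> carrier A (snd z)"
      by (rule ex_valuation_Cons)
    have "(h # gs,
       compT bs c as (Var h)
         (map (\<lambda>i. actT (\<sigma>s ! i) (as ! i) (bs ! i) (Var (gs ! i))) [0..<length bs]),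
       actT (fsum \<sigma>s) (concat as) c
         (compT bs c (map2 pull \<sigma>s as) (Var h) (map Var gs))) \<in> cat_theory sg R"
      by (rule cat_comp_act_inner) (use 9 v in \<open>auto simp: mvars_def homs_alg_multicat\<close>)
    from eqn[OF this v(6)] have "interp A (CompS bs c as) (e h #
         map (\<lambda>i. interp A (ActS (\<sigma>s ! i) (as ! i) (bs ! i)) [e (gs ! i)]) [0..<length bs])
      = interp A (ActS (fsum \<sigma>s) (concat as) c) [interp A (CompS bs c (map2 pull \<sigma>s as)) (e h # map e gs)]"
      by (simp add: comp_def)
    moreover have "length gs = length bs"
      using 9 v(5) by (auto simp: homs_def)
    then have "map (\<lambda>i. interp A (ActS (\<sigma>s ! i) (as ! i) (bs ! i)) [e (gs ! i)]) [0..<length bs]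
      = map (\<lambda>i. interp A (ActS (\<sigma>s ! i) (as ! i) (bs ! i)) [fs ! i]) [0..<length bs]"
      using v(5) by (intro map_cong) auto
    ultimately show ?case using v(4,5) by simp
  next
    case (10 \<tau> bs c g as fs)
    have \<tau>: "is_finmap \<tau>" using 10 by (simp add: Delta_def)
    have "g \<in> carrier A (pull \<tau> bs, c)" "list_all2 (\<lambda>x s. x \<in> carrier A s) fs (zip as bs)"
      using 10 by (auto simp: homs_alg_multicat)
    then obtain e :: "'s mvar \<Rightarrow> 'c" and h gs where v: "distinct (h # gs)" "snd h = (pull \<tau> bs, c)" "map snd gs = zip as bs"
      "e h = g" "map e gs = fs" "\<forall>z\<in>set (h # gs). e z \<in> carrier A (snd z)"
      by (rule ex_valuation_Cons)
    have "pull \<tau> bs \<in> lists (sorts sg)"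
      using 10 \<tau> by (intro pull_lists) (auto simp: homs_alg_multicat)
    then have "(h # gs,
       compT bs c as (actT \<tau> bs c (Var h)) (map Var gs),
       actT (fsim \<tau> (map length as)) (concat as) c
         (compT (pull \<tau> bs) c (pull \<tau> as) (Var h) (map Var (pull \<tau> gs)))) \<in> cat_theory sg R"
      by (intro cat_comp_act_outer) (use 10 v in \<open>auto simp: mvars_def homs_alg_multicat\<close>)
    from eqn[OF this v(6)] have "interp A (CompS bs c as) (interp A (ActS \<tau> bs c) [e h] # map e gs)
      = interp A (ActS (fsim \<tau> (map length as)) (concat as) c)
          [interp A (CompS (pull \<tau> bs) c (pull \<tau> as)) (e h # map e (pull \<tau> gs))]"
      by (simp add: comp_def)
    moreover have "length gs = tgt \<tau>"
      using 10 v(5) by (auto simp: homs_def)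
    then have "map e (pull \<tau> gs) = pull \<tau> fs"
      using \<tau> v(5) by (simp add: map_pull)
    ultimately show ?case using v(4,5) by simp
  qed
qed

text \<open>The multimorphisms between images of sorts. The carriers are indexed by the words and
  sorts themselves, so \<open>msort\<close> may identify sorts; \<open>hd\<close> and
  \<open>tl\<close> make \<open>interp\<close> total on argument lists.\<close>

definition model_algebra ::
  "('o, 'm) multicat \<Rightarrow> ('s, 'f, 'o, 'm) model \<Rightarrow> ('s msrt, ('s, 'f) msym, 'm) algebra" where
  "model_algebra C m = \<lparr>
     carrier = (\<lambda>(a, b). hom C (map (msort m) a) (msort m b)),
     interp = (\<lambda>f xs. case f of
         CompS bs c as \<Rightarrow>
           mcomp C (map (msort m) bs) (msort m c) (map (map (msort m)) as) (hd xs) (tl xs)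
       | IdS c \<Rightarrow> mident C (msort m c)
       | ActS \<theta> a b \<Rightarrow> mact C \<theta> (map (msort m) a) (msort m b) (hd xs)
       | ConstS f \<Rightarrow> mfun m f) \<rparr>"

lemma model_algebra_simps [simp]:
  "carrier (model_algebra C m) (a, b) = hom C (map (msort m) a) (msort m b)"
  "interp (model_algebra C m) (CompS bs c as) (g # fs) =
     mcomp C (map (msort m) bs) (msort m c) (map (map (msort m)) as) g fs"
  "interp (model_algebra C m) (IdS c) [] = mident C (msort m c)"
  "interp (model_algebra C m) (ActS \<theta> a b) [f] = mact C \<theta> (map (msort m) a) (msort m b) f"
  "interp (model_algebra C m) (ConstS k) [] = mfun m k"
  by (simp_all add: model_algebra_def)

context multicat_model begin

abbreviation "M \<equiv> msort m"
abbreviation "Alg \<equiv> model_algebra C m"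

lemma map_msort_obj: "a \<in> lists (sorts sg) \<Longrightarrow> map M a \<in> lists (obj C)"
  using msort_obj by auto

lemma map_map_msort_obj: "as \<in> lists (lists (sorts sg)) \<Longrightarrow> map (map M) as \<in> lists (lists (obj C))"
  by (induction as) (auto simp: msort_obj)

lemma homs_carrier:
  assumes "bs \<in> lists (sorts sg)" "as \<in> lists (lists (sorts sg))" "length as = length bs"
    and "list_all2 (\<lambda>x s. x \<in> carrier Alg s) fs (zip as bs)"
  shows "homs C (map (map M) as) (map M bs) fs"
  using assms map_msort_obj[OF assms(1)] map_map_msort_obj[OF assms(2)]
  by (auto simp: homs_def list_all2_conv_all_nth simp del: in_lists_conv_set)

lemma homs_valuation:
  assumes "mvars (sorts sg) as bs xs" "\<forall>x\<in>set xs. e x \<in> carrier Alg (snd x)"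
  shows "homs C (map (map M) as) (map M bs) (map e xs)"
proof (rule homs_carrier)
  have "list_all2 (\<lambda>x s. e x \<in> carrier Alg s) xs (map snd xs)"
    using assms(2) by (simp add: list_all2_map2 list_all2_same)
  then show "list_all2 (\<lambda>x s. x \<in> carrier Alg s) (map e xs) (zip as bs)"
    using assms(1) by (simp add: mvars_def list_all2_map1)
qed (use assms in \<open>auto simp: mvars_def\<close>)

lemma is_algebra_model_algebra: "is_algebra (ext_signature sg R) Alg"
  unfolding is_algebra_def ext_signature_simps
proof (intro ballI allI impI)
  fix f xs assume f: "f \<in> funs (ext_signature sg R)"
    and xs: "list_all2 (\<lambda>x s. x \<in> carrier Alg s) xs (msym_dom sg f)"
  show "interp Alg f xs \<in> carrier Alg (msym_cod sg f)"
  proof (cases f)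
    case (CompS bs c as)
    then obtain g fs where "xs = g # fs" "g \<in> hom C (map M bs) (M c)"
      "list_all2 (\<lambda>x s. x \<in> carrier Alg s) fs (zip as bs)"
      using xs by (auto simp: list_all2_Cons2)
    with f CompS show ?thesis
      using comp_closed[OF _ _ homs_carrier[of bs as fs], of "M c" g] msort_obj by (simp add: map_concat)
  next
    case (IdS c)
    with f xs show ?thesis using ident_closed msort_obj by simp
  next
    case (ActS \<theta> bs c)
    then have "is_finmap \<theta>" "length bs = tgt \<theta>" using f Delta_finmap by auto
    with f xs ActS show ?thesis
      using act_closed[OF _ map_msort_obj, of \<theta> bs "M c"] msort_obj by (auto simp: list_all2_Cons2 map_pull)
  next
    case (ConstS f')
    with f xs show ?thesis using mfun_closed by simp
  qed
qed

text \<open>The axioms of \<open>C\<close> carry over along \<open>msort\<close> because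
  \<open>pull\<close> and \<open>concat\<close> commute with mapping objects on well-typed data, and
  because \<open>fsum\<close> and \<open>fsim\<close> depend only on lengths and positions.\<close>

lemma model_algebra_cat_theory:
  assumes "(v, t1, t2) \<in> cat_theory sg R"
  shows "alg_models_eqn (ext_signature sg R) Alg (v, t1, t2)"
  using assms
proof (induction rule: cat_theory.induct)
  case (cat_assoc cs d h bss gs asss fss)
  show ?case
    unfolding alg_models_eqn_def prod.case ext_signature_simps
  proof (intro allI impI)
    fix e assume e: "\<forall>x\<in>set (h # gs @ concat fss). e x \<in> carrier Alg (snd x)"
    have l: "length bss = length cs" "length gs = length cs"
      using cat_assoc(2) by (auto simp: mvars_def dest: arg_cong[of _ _ length])
    have "homs C (map (map (map M)) asss ! i) (map (map M) bss ! i) (map (map e) fss ! i)" if "i < length cs" for i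
    proof -
      have "fss ! i \<in> set fss" using that cat_assoc(4) by simp
      then have "set (fss ! i) \<subseteq> set (concat fss)" by auto
      then have "homs C (map (map M) (asss ! i)) (map M (bss ! i)) (map e (fss ! i))"
        using that cat_assoc(5) e by (intro homs_valuation) auto
      then show ?thesis using that l cat_assoc(3,4) by simp
    qed
    moreover have "homs C (map (map M) bss) (map M cs) (map e gs)"
      using cat_assoc(2) e by (intro homs_valuation) auto
    moreover have "e h \<in> hom C (map M cs) (M d)" "M d \<in> obj C"
      using cat_assoc(1) e msort_obj by (auto simp: mvars_def)
    ultimately have ca: "mcomp C (concat (map (map M) bss)) (M d) (concat (map (map (map M)) asss))
        (mcomp C (map M cs) (M d) (map (map M) bss) (e h) (map e gs)) (concat (map (map e) fss))
      = mcomp C (map M cs) (M d) (map concat (map (map (map M)) asss)) (e h)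
         (map (\<lambda>i. mcomp C (map (map M) bss ! i) (map M cs ! i) (map (map (map M)) asss ! i) (map e gs ! i) (map (map e) fss ! i)) [0..<length cs])"
      using comp_assoc[of "M d" "e h" "map M cs" "map (map M) bss" "map e gs"
          "map (map (map M)) asss" "map (map e) fss"] cat_assoc(3,4)
      by (simp del: map_map)
    have eq: "map (\<lambda>i. mcomp C (map (map M) bss ! i) (map M cs ! i) (map (map (map M)) asss ! i) (map e gs ! i) (map (map e) fss ! i)) [0..<length cs]
      = map (\<lambda>i. mcomp C (map M (bss ! i)) (M (cs ! i)) (map (map M) (asss ! i)) (e (gs ! i)) (map e (fss ! i))) [0..<length cs]"
      using l cat_assoc(3,4) by (intro map_cong) auto
    show "eval_alg Alg e (compT (concat bss) d (concat asss)
         (compT cs d bss (Var h) (map Var gs)) (map Var (concat fss)))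
      = eval_alg Alg e (compT cs d (map concat asss) (Var h)
         (map (\<lambda>i. compT (bss ! i) (cs ! i) (asss ! i) (Var (gs ! i)) (map Var (fss ! i)))
            [0..<length cs]))"
      using ca unfolding eq by (simp add: map_concat comp_def)
  qed
next
  case (cat_ident_left a b h)
  then show ?case
    using comp_ident_left[OF map_msort_obj msort_obj] by (auto simp: alg_models_eqn_def mvars_def)
next
  case (cat_ident_right a b h)
  then show ?case
    using comp_ident_right[OF map_msort_obj msort_obj] by (auto simp: alg_models_eqn_def mvars_def comp_def)
next
  case (cat_act_id a b h)
  then show ?case
    using act_id[OF map_msort_obj msort_obj] by (auto simp: alg_models_eqn_def mvars_def)
next
  case (cat_act_fcomp \<theta> \<phi> a b h)
  have f: "is_finmap \<theta>" "is_finmap \<phi>" using cat_act_fcomp(1,2) Delta_finmap by auto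
  have "map M (pull (fcomp \<phi> \<theta>) a) = pull (fcomp \<phi> \<theta>) (map M a)"
    using f cat_act_fcomp by (simp add: pull_fcomp map_pull)
  moreover have "map M (pull \<phi> a) = pull \<phi> (map M a)"
    using f cat_act_fcomp by (simp add: map_pull)
  ultimately show ?case
    using cat_act_fcomp act_fcomp[OF cat_act_fcomp(1-3) map_msort_obj[OF cat_act_fcomp(4)], of "M b"] msort_obj
    by (auto simp: alg_models_eqn_def mvars_def)
next
  case (cat_comp_act_outer \<theta> bs c h as gs)
  have f: "is_finmap \<theta>" using cat_comp_act_outer(1) Delta_finmap by auto
  show ?case
    unfolding alg_models_eqn_def prod.case ext_signature_simps
  proof (intro allI impI)
    fix e assume e: "\<forall>x\<in>set (h # gs). e x \<in> carrier Alg (snd x)"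
    have l: "length as = length bs" "length gs = length bs"
      using cat_comp_act_outer(4) by (auto simp: mvars_def dest: arg_cong[of _ _ length])
    have "homs C (map (map M) as) (map M bs) (map e gs)"
      using cat_comp_act_outer(4) e by (intro homs_valuation) auto
    moreover have "e h \<in> hom C (pull \<theta> (map M bs)) (M c)" "c \<in> sorts sg"
      using cat_comp_act_outer(2,3) e f by (auto simp: mvars_def map_pull)
    ultimately show "eval_alg Alg e (compT bs c as (actT \<theta> bs c (Var h)) (map Var gs))
      = eval_alg Alg e (actT (fsim \<theta> (map length as)) (concat as) c
         (compT (pull \<theta> bs) c (pull \<theta> as) (Var h) (map Var (pull \<theta> gs))))"
      using comp_act_outer[OF cat_comp_act_outer(1), of "map M bs" "M c" "e h" "map (map M) as" "map e gs"]
        cat_comp_act_outer(2) msort_obj f l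
      by (simp add: map_concat comp_def map_pull)
  qed
next
  case (cat_comp_act_inner \<theta>s bs as c h gs)
  show ?case
    unfolding alg_models_eqn_def prod.case ext_signature_simps
  proof (intro allI impI)
    fix e assume e: "\<forall>x\<in>set (h # gs). e x \<in> carrier Alg (snd x)"
    have lt: "length as = length \<theta>s" "\<And>i. i < length \<theta>s \<Longrightarrow> length (as ! i) = tgt (\<theta>s ! i)"
      using cat_comp_act_inner(4) by (metis length_map, metis length_map nth_map)
    have l: "length as = length bs" "length gs = length bs"
      using cat_comp_act_inner(2,6) lt by (auto simp: mvars_def dest: arg_cong[of _ _ length])
    have p: "map (map M) (map2 pull \<theta>s as) = map2 pull \<theta>s (map (map M) as)"
    proof -
      have "map M (pull (\<theta>s ! i) (as ! i)) = pull (\<theta>s ! i) (map M (as ! i))" if "i < length \<theta>s" for i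
        using that lt cat_comp_act_inner(1) Delta_finmap nth_mem by (intro map_pull) blast+
      then show ?thesis using lt by (intro nth_equalityI) simp_all
    qed
    have "homs C (map2 pull \<theta>s (map (map M) as)) (map M bs) (map e gs)"
      unfolding p[symmetric] using cat_comp_act_inner(6) e by (intro homs_valuation) auto
    moreover have "e h \<in> hom C (map M bs) (M c)" "M c \<in> obj C"
      using cat_comp_act_inner(5) e msort_obj by (auto simp: mvars_def)
    moreover have "length \<theta>s = length (map M bs)" "map length (map (map M) as) = map tgt \<theta>s"
      using cat_comp_act_inner(2,4) by (simp_all add: comp_def)
    ultimately have ca: "mcomp C (map M bs) (M c) (map (map M) as) (e h)
        (map (\<lambda>i. mact C (\<theta>s ! i) (map (map M) as ! i) (map M bs ! i) (map e gs ! i)) [0..<length bs])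
      = mact C (fsum \<theta>s) (map M (concat as)) (M c)
         (mcomp C (map M bs) (M c) (map (map M) (map2 pull \<theta>s as)) (e h) (map e gs))"
      using comp_act_inner[OF cat_comp_act_inner(1) _ map_map_msort_obj[OF cat_comp_act_inner(3)], of "map M bs"]
      unfolding p map_concat by simp
    have eq: "map (\<lambda>i. mact C (\<theta>s ! i) (map (map M) as ! i) (map M bs ! i) (map e gs ! i)) [0..<length bs]
      = map (eval_alg Alg e) (map (\<lambda>i. actT (\<theta>s ! i) (as ! i) (bs ! i) (Var (gs ! i))) [0..<length bs])"
      using l by simp
    have "map (eval_alg Alg e) (map Var gs) = map e gs" by simp
    then show "eval_alg Alg e (compT bs c as (Var h)
         (map (\<lambda>i. actT (\<theta>s ! i) (as ! i) (bs ! i) (Var (gs ! i))) [0..<length bs]))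
      = eval_alg Alg e (actT (fsum \<theta>s) (concat as) c
         (compT bs c (map2 pull \<theta>s as) (Var h) (map Var gs)))"
      using ca unfolding eq by (simp del: map_map)
  qed
qed

text \<open>Values of \<open>N_term\<close> are needed in \<open>Alg\<close> and also in the given
  initial algebra. The latter may differ from the \<open>model_algebra\<close> of its own
  multicategory on argument lists of wrong length; these clauses hold for both.\<close>

definition interprets :: "('s msrt, ('s, 'f) msym, 'm) algebra \<Rightarrow> bool" where
  "interprets B \<longleftrightarrow>
     (\<forall>bs c as g fs. interp B (CompS bs c as) (g # fs) = mcomp C (map M bs) (M c) (map (map M) as) g fs) \<and>
     (\<forall>c. interp B (IdS c) [] = mident C (M c)) \<and>
     (\<forall>\<theta> a b f. interp B (ActS \<theta> a b) [f] = mact C \<theta> (map M a) (M b) f) \<and>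
     (\<forall>f. interp B (ConstS f) [] = mfun m f)"

text \<open>\<open>N_term\<close> and \<open>cval\<close> recurse through the same terminal contexts
  and agree clause by clause. For constants, where \<open>N_term\<close> has no composition, the
  right unit law for the empty word closes the gap.\<close>

lemma eval_N_term:
  assumes B: "interprets B"
  shows "has_sort sg t b \<Longrightarrow> eval_alg B e (N_term sg tc v t) = val v t"
proof (induction arbitrary: v rule: has_sort.induct)
  case (has_sort_Var x)
  show ?case using B by (simp add: interprets_def N_act_def mres_def mctx_def comp_def)
next
  case (has_sort_Fun f ts)
  show ?case
  proof (cases ts)
    case Nil
    then have "fdom sg f = []" using has_sort_Fun(2) by simp
    then have "mcomp C [] (msort m (fcod sg f)) [] (mfun m f) [] = mfun m f"
      using comp_ident_right[of "[]" "msort m (fcod sg f)" "mfun m f"] fcod_obj mfun_closed[of f] has_sort_Fun(1) by simp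
    then show ?thesis
      using B Nil \<open>fdom sg f = []\<close> by (simp add: interprets_def N_act_def mres_def mctx_def comp_def)
  next
    case (Cons t ts')
    have IH: "map (eval_alg B e) (map (\<lambda>u. N_term sg tc (tc (tau u)) u) ts) = map (\<lambda>u. val (tc (tau u)) u) ts"
      using has_sort_Fun(2) by (auto simp: list_all2_conv_all_nth in_set_conv_nth)
    have N: "N_term sg tc v (Fun f ts) = N_act sg v (concat (map (\<lambda>u. tc (tau u)) ts)) (fcod sg f)
       (compT (fdom sg f) (fcod sg f) (map (\<lambda>u. map (vsort sg) (tc (tau u))) ts)
          (constT f) (map (\<lambda>u. N_term sg tc (tc (tau u)) u) ts))"
      unfolding Cons by simp
    have mc: "map M (map (vsort sg) v) = ctx v"
        "map (map M) (map (\<lambda>u. map (vsort sg) (tc (tau u))) ts) = map (\<lambda>u. ctx (tc (tau u))) ts"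
      by (simp_all add: mctx_def[abs_def] comp_def)
    show ?thesis
      using B unfolding N by (simp add: interprets_def N_act_def mres_def mc IH del: map_map)
  qed
qed

lemma interprets_model_algebra: "interprets Alg"
  by (simp add: interprets_def)

lemma model_algebra_mc_theory:
  assumes "R_theory sg R E" "\<forall>\<phi>\<in>E. models_eqn sg R C m \<phi>"
  shows "alg_model (ext_signature sg R) (mc_theory sg R tc E) Alg"
  unfolding alg_model_def
proof (intro conjI ballI)
  fix \<phi> :: "(('s, 'f) msym, 's mvar) eqn" assume "\<phi> \<in> mc_theory sg R tc E"
  then consider "\<phi> \<in> cat_theory sg R"
    | v t1 t2 where "(v, t1, t2) \<in> E" "\<phi> = ([], N_term sg tc v t1, N_term sg tc v t2)"
    by (auto simp: mc_theory_def tilde_theory_def)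
  then show "alg_models_eqn (ext_signature sg R) Alg \<phi>"
  proof cases
    case 1
    then show ?thesis using model_algebra_cat_theory by (cases \<phi>) simp
  next
    case (2 v t1 t2)
    then have eq: "R_equation sg R (v, t1, t2)" "models_eqn sg R C m (v, t1, t2)"
      using assms by (auto simp: R_theory_def)
    then obtain b where "has_sort sg t1 b" "has_sort sg t2 b" by (auto simp: R_equation_def)
    then show ?thesis
      using eq models_eqn_val eval_N_term[OF interprets_model_algebra] by (simp add: alg_models_eqn_def 2)
  qed
qed (rule is_algebra_model_algebra)

end

text \<open>The side condition of \<open>ex_alg_hom\<close>. An \<open>N_term\<close> is never a
  variable, and the only axioms with a variable as a side are the unit laws and the identity action,
  where it forms the context.\<close>

lemma mc_theory_vars:
  assumes "(v, t1, t2) \<in> mc_theory sg R tc E" "t1 = Var x \<or> t2 = Var x"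
  shows "x \<in> set v"
proof -
  have "N_term sg tc v t \<noteq> Var x" for v t
    by (cases "(sg, tc, v, t)" rule: N_term.cases) (auto simp: N_act_def)
  then show ?thesis
    using assms by (auto simp: mc_theory_def tilde_theory_def elim: cat_theory.cases)
qed

context modelable_signature begin

lemma vsort_lists: "set v \<subseteq> vars sg \<Longrightarrow> map (vsort sg) v \<in> lists (sorts sg)"
  using wf unfolding wf_signature_def by (intro in_listsI) auto

lemma N_act_ground:
  assumes "R v w" "b \<in> sorts sg" "ground_sort (ext_signature sg R) t (map (vsort sg) w, b)"
  shows "ground_sort (ext_signature sg R) (N_act sg v w b t) (map (vsort sg) v, b)"
proof -
  note th = theta_of[OF R_vars[OF assms(1)]]
  have "pull (theta_of v w) (map (vsort sg) v) = map (vsort sg) w"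
    using th by (simp add: map_pull[symmetric])
  moreover have "map (vsort sg) v \<in> lists (sorts sg)"
    using vsort_lists R_context(2)[OF assms(1)] .
  ultimately show ?thesis
    using assms th ground_sort_Fun[of "ActS (theta_of v w) (map (vsort sg) v) b" "ext_signature sg R" "[t]"]
    by (simp add: N_act_def theta_of_Delta)
qed

text \<open>Homomorphisms preserve the values of closed terms. This is what relates the values of
  one term in two multicategories with models.\<close>

lemma N_term_ground:
  "has_sort sg t b \<Longrightarrow> R v (tau t) \<Longrightarrow>
   ground_sort (ext_signature sg R) (N_term sg tc v t) (map (vsort sg) v, b)"
proof (induction arbitrary: v rule: has_sort.induct)
  case (has_sort_Var x)
  have "vsort sg x \<in> sorts sg" using has_sort_Var(1) wf by (simp add: wf_signature_def)
  then show ?case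
    using has_sort_Var(2) ground_sort_Fun[of "IdS (vsort sg x)" "ext_signature sg R" "[]"]
    by (auto intro!: N_act_ground)
next
  case (has_sort_Fun f ts)
  note tcs = R_concat_tc[OF has_sort_Fun(3)]
  have f: "fdom sg f \<in> lists (sorts sg)" "fcod sg f \<in> sorts sg"
    using has_sort_Fun(1) wf by (auto simp: wf_signature_def)
  have const: "ground_sort (ext_signature sg R) (constT f) (fdom sg f, fcod sg f)"
    using has_sort_Fun(1) ground_sort_Fun[of "ConstS f" "ext_signature sg R" "[]"] by simp
  show ?case
  proof (cases ts)
    case Nil
    then show ?thesis
      using const has_sort_Fun f by (auto intro!: N_act_ground)
  next
    case (Cons t ts')
    let ?w = "\<lambda>u. map (vsort sg) (tc (tau u))"
    have N: "N_term sg tc v (Fun f ts) = N_act sg v (concat (map (\<lambda>u. tc (tau u)) ts)) (fcod sg f)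
       (compT (fdom sg f) (fcod sg f) (map ?w ts)
          (constT f) (map (\<lambda>u. N_term sg tc (tc (tau u)) u) ts))"
      unfolding Cons by simp
    have "?w u \<in> lists (sorts sg)" if "u \<in> set ts" for u
      using vsort_lists R_context(2)[OF tcs(2)[OF that]] .
    then have ws: "map ?w ts \<in> lists (lists (sorts sg))"
      by (intro in_listsI) auto
    have "list_all2 (ground_sort (ext_signature sg R))
        (constT f # map (\<lambda>u. N_term sg tc (tc (tau u)) u) ts) ((fdom sg f, fcod sg f) # zip (map ?w ts) (fdom sg f))"
      using const has_sort_Fun(2) tcs(2) by (auto simp: list_all2_conv_all_nth nth_Cons')
    then have "ground_sort (ext_signature sg R) (compT (fdom sg f) (fcod sg f) (map ?w ts)
          (constT f) (map (\<lambda>u. N_term sg tc (tc (tau u)) u) ts)) (concat (map ?w ts), fcod sg f)"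
      using ground_sort_Fun[of "CompS (fdom sg f) (fcod sg f) (map ?w ts)" "ext_signature sg R"
        "constT f # map (\<lambda>u. N_term sg tc (tc (tau u)) u) ts"] ws f list_all2_lengthD[OF has_sort_Fun(2)]
      by simp
    then show ?thesis
      unfolding N using tcs(1) f by (intro N_act_ground) (auto simp: map_concat comp_def)
  qed
qed

end

section \<open>Syntactic multimorphisms\<close>

fun map3 :: "('a \<Rightarrow> 'b \<Rightarrow> 'c \<Rightarrow> 'd) \<Rightarrow> 'a list \<Rightarrow> 'b list \<Rightarrow> 'c list \<Rightarrow> 'd list" where
  "map3 f (x # xs) (y # ys) (z # zs) = f x y z # map3 f xs ys zs"
| "map3 f _ _ _ = []"

lemma length_map3 [simp]:
  "length ys = length xs \<Longrightarrow> length zs = length xs \<Longrightarrow> length (map3 f xs ys zs) = length xs"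
  by (induction f xs ys zs rule: map3.induct) auto

lemma nth_map3 [simp]:
  "length ys = length xs \<Longrightarrow> length zs = length xs \<Longrightarrow> i < length xs
   \<Longrightarrow> map3 f xs ys zs ! i = f (xs ! i) (ys ! i) (zs ! i)"
  by (induction f xs ys zs arbitrary: i rule: map3.induct) (auto simp: nth_Cons')

lemma map3_append:
  "length ys = length xs \<Longrightarrow> length zs = length xs
   \<Longrightarrow> map3 f (xs @ xs') (ys @ ys') (zs @ zs') = map3 f xs ys zs @ map3 f xs' ys' zs'"
  by (induction f xs ys zs rule: map3.induct) auto

lemma map3_concat:
  "map length yss = map length xss \<Longrightarrow> map length zss = map length xss
   \<Longrightarrow> map3 f (concat xss) (concat yss) (concat zss) = concat (map3 (map3 f) xss yss zss)"
proof (induction xss arbitrary: yss zss)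
  case (Cons xs xss)
  then show ?case by (auto simp: map3_append Cons_eq_map_conv)
qed simp

lemma map3_map:
  "map3 f (map g xs) (map h xs) (map k xs) = map (\<lambda>x. f (g x) (h x) (k x)) xs"
  by (induction xs) auto

text \<open>An explicit form of the division that \<open>split_blocks\<close> only asserts to exist,
  as needed for defining composition.\<close>

fun blocks :: "nat list \<Rightarrow> 'a list \<Rightarrow> 'a list list" where
  "blocks [] xs = []"
| "blocks (n # ns) xs = take n xs # blocks ns (drop n xs)"

lemma blocks_concat: "blocks (map length xss) (concat xss) = xss"
  by (induction xss) auto

lemma concat_blocks: "sum_list ns = length xs \<Longrightarrow> concat (blocks ns xs) = xs"
  by (induction ns xs rule: blocks.induct) auto

lemma length_blocks: "sum_list ns = length xs \<Longrightarrow> map length (blocks ns xs) = ns"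
  by (induction ns xs rule: blocks.induct) auto

lemma map_blocks: "map (map f) (blocks ns xs) = blocks ns (map f xs)"
  by (induction ns xs rule: blocks.induct) (auto simp: take_map drop_map)

definition env :: "'v list \<Rightarrow> ('f, 'v) trm list \<Rightarrow> 'v \<Rightarrow> ('f, 'v) trm" where
  "env v ts x = (case map_of (zip v ts) x of None \<Rightarrow> Var x | Some t \<Rightarrow> t)"

definition inst :: "'v list \<Rightarrow> ('f, 'v) trm list \<Rightarrow> ('f, 'v) trm \<Rightarrow> ('f, 'v) trm" where
  "inst v ts t = subst (env v ts) t"

lemma env_nth: "distinct v \<Longrightarrow> length ts = length v \<Longrightarrow> i < length v \<Longrightarrow> env v ts (v ! i) = ts ! i"
  by (simp add: env_def map_of_zip_nth)

lemma map_env: "distinct v \<Longrightarrow> length ts = length v \<Longrightarrow> map (env v ts) v = ts"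
  by (rule nth_equalityI) (auto simp: env_nth)

lemma subst_cong: "(\<And>x. x \<in> set (tau t) \<Longrightarrow> s x = s' x) \<Longrightarrow> subst s t = subst s' t"
  by (induction t) auto

lemma subst_subst: "subst s (subst s' t) = subst (\<lambda>x. subst s (s' x)) t"
  by (induction t) auto

lemma subst_Var: "subst Var t = t"
  by (induction t) (auto simp: map_idI)

lemma env_map: "distinct v \<Longrightarrow> x \<in> set v \<Longrightarrow> env v (map s v) x = s x"
  by (metis env_nth in_set_conv_nth length_map nth_map)

lemma inst_map:
  assumes "distinct v" "set (tau t) \<subseteq> set v"
  shows "inst v (map s v) t = subst s t"
  unfolding inst_def using assms
  by (intro subst_cong env_map) auto

lemma inst_Var: "distinct v \<Longrightarrow> set (tau t) \<subseteq> set v \<Longrightarrow> inst v (map Var v) t = t"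
  by (simp add: inst_map subst_Var)

text \<open>A variable of \<open>t\<close> outside \<open>v\<close> would be left alone by
  \<open>env\<close> and moved by \<open>s\<close> on the left side only, hence the condition on
  \<open>tau t\<close>.\<close>

lemma subst_inst:
  assumes "distinct v" "set (tau t) \<subseteq> set v" "length ts = length v"
  shows "subst s (inst v ts t) = inst v (map (subst s) ts) t"
proof -
  have "inst v ts t = inst v (map (env v ts) v) t" using assms by (simp add: map_env)
  then have "subst s (inst v ts t) = inst v (map (\<lambda>x. subst s (env v ts x)) v) t"
    using assms by (simp add: inst_map subst_subst)
  also have "map (\<lambda>x. subst s (env v ts x)) v = map (subst s) (map (env v ts) v)"
    by simp
  also have "map (env v ts) v = ts"
    using assms by (simp add: map_env)
  finally show ?thesis .
qed

lemma pull_map_env: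
  assumes "set w \<subseteq> set v" "distinct v" "length ts = length v"
  shows "pull (theta_of v w) ts = map (env v ts) w"
proof -
  have "pull (theta_of v w) (map (env v ts) v) = map (env v ts) w"
    using theta_of[OF assms(1)] by (simp add: map_pull[symmetric])
  then show ?thesis using assms by (simp add: map_env)
qed

section \<open>A standard context for every word of sorts\<close>

context modelable_signature begin

definition cctx :: "'s list \<Rightarrow> 'v list" where
  "cctx a = (SOME v. is_context (vars sg) v \<and> map (vsort sg) v = a)"

text \<open>Every sort has infinitely many variables, so a fresh one can always be put in
  front.\<close>

lemma ex_cctx: "a \<in> lists (sorts sg) \<Longrightarrow> \<exists>v. is_context (vars sg) v \<and> map (vsort sg) v = a"
proof (induction a)
  case Nil
  then show ?case by (simp add: is_context_def)
next
  case (Cons s a)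
  then obtain v where v: "is_context (vars sg) v" "map (vsort sg) v = a" by auto
  have "infinite {x \<in> vars sg. vsort sg x = s}"
    using Cons.prems wf unfolding wf_signature_def by simp
  then have "\<not> {x \<in> vars sg. vsort sg x = s} \<subseteq> set v"
    using finite_subset by blast
  then obtain x where "x \<in> vars sg" "vsort sg x = s" "x \<notin> set v"
    by blast
  with v show ?case by (intro exI[of _ "x # v"]) (auto simp: is_context_def)
qed

lemma cctx:
  assumes "a \<in> lists (sorts sg)"
  shows "is_context (vars sg) (cctx a)" "map (vsort sg) (cctx a) = a" "distinct (cctx a)"
    "length (cctx a) = length a" "R (cctx a) (cctx a)" "set (cctx a) \<subseteq> vars sg"
proof -
  show c: "is_context (vars sg) (cctx a)" "map (vsort sg) (cctx a) = a"
    unfolding cctx_def using someI_ex[OF ex_cctx[OF assms]] by auto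
  then show "distinct (cctx a)" "R (cctx a) (cctx a)" "set (cctx a) \<subseteq> vars sg"
    using R_refl by (auto simp: is_context_def)
  show "length (cctx a) = length a" using c(2) by (metis length_map)
qed

lemma inst_has_sort:
  assumes "has_sort sg t b" "set (tau t) \<subseteq> set v" "distinct v"
    and "list_all2 (\<lambda>t x. has_sort sg t (vsort sg x)) ts v"
  shows "has_sort sg (inst v ts t) b"
  unfolding inst_def
proof (rule has_sort_subst[OF assms(1)], rule ballI)
  fix x assume "x \<in> set (tau t)"
  then obtain i where "i < length v" "x = v ! i"
    using assms(2) by (metis in_set_conv_nth subset_code(1))
  then show "has_sort sg (env v ts x) (vsort sg x)"
    using assms(3,4) by (simp add: env_nth list_all2_conv_all_nth)
qed

end

locale theory_over = modelable_signature sg R tc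
  for sg :: "('s, 'f, 'v) signature" and R :: "'v list \<Rightarrow> 'v list \<Rightarrow> bool" and tc +
  fixes E :: "('f, 'v) eqn set"
  assumes theory_E: "R_theory sg R E"
begin

abbreviation ded :: "'v list \<Rightarrow> ('f, 'v) trm \<Rightarrow> ('f, 'v) trm \<Rightarrow> bool" where
  "ded v t t' \<equiv> (v, t, t') \<in> deduct sg R E"

lemma ded_D:
  assumes "ded v t t'"
  shows "R v (tau t)" "R v (tau t')" "\<And>b. has_sort sg t b \<Longrightarrow> has_sort sg t' b"
  using deduct_R_equation[OF theory_E assms] by (auto simp: R_equation_def dest: has_sort_unique)

text \<open>The substitution rule, with substitutions given by their lists of values on
  \<open>v\<close>. As \<open>ts\<close> and \<open>ts'\<close> may differ up to provable equality,
  this is also the congruence rule.\<close>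

lemma ded_inst:
  assumes t: "ded v t t'" and R: "R w (concat ws)" and len: "length ws = length v" "length ts = length v" "length ts' = length v"
    and ts: "\<And>i. i < length v \<Longrightarrow> ded (ws ! i) (ts ! i) (ts' ! i) \<and> has_sort sg (ts ! i) (vsort sg (v ! i))"
  shows "ded w (inst v ts t) (inst v ts' t')"
  unfolding inst_def
proof (rule deduct_subst[OF t])
  have d: "distinct v" using R_context(1)[OF ded_D(1)[OF t]] .
  have pt: "has_sort sg (ts ! i) (vsort sg (v ! i))" "has_sort sg (ts' ! i) (vsort sg (v ! i))"
      "R (ws ! i) (tau (ts ! i))" "R (ws ! i) (tau (ts' ! i))" if "i < length v" for i
    using ts[OF that] ded_D[of "ws ! i" "ts ! i" "ts' ! i"] by blast+
  show "R_renaming sg R v (env v ts) w ws" "R_renaming sg R v (env v ts') w ws"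
    unfolding R_renaming_def using d R len pt
    by (auto simp: in_set_conv_nth list_all2_conv_all_nth env_nth)
  show "\<forall>i<length v. ded (ws ! i) (env v ts (v ! i)) (env v ts' (v ! i))"
    using d len ts by (simp add: env_nth)
qed

text \<open>The word \<open>u\<close> may repeat variables and omit some of \<open>w\<close>. So
  this covers both bijective renaming and reindexing along a map in \<open>Delta R\<close>; each
  letter is substituted in its own one-letter context.\<close>

lemma ded_rename:
  assumes "ded v t t'" "R w u" "map (vsort sg) u = map (vsort sg) v"
  shows "ded w (inst v (map Var u) t) (inst v (map Var u) t')"
proof -
  have l: "length u = length v" using assms(3) by (metis length_map)
  have u: "u ! i \<in> vars sg" if "i < length v" for i
    using R_context(3)[OF assms(2)] that l nth_mem by force
  have "ded [u ! i] (Var (u ! i)) (Var (u ! i)) \<and> has_sort sg (Var (u ! i)) (vsort sg (v ! i))"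
    if "i < length v" for i
  proof -
    have "vsort sg (v ! i) = vsort sg (u ! i)" using that l assms(3) by (metis nth_map)
    then show ?thesis
      using has_sort_Var[OF u[OF that]] R_singleton[OF u[OF that]]
        deduct_refl[of sg "Var (u ! i)" "vsort sg (u ! i)" R "[u ! i]" E] by simp
  qed
  then show ?thesis
    using ded_inst[OF assms(1), of w "map (\<lambda>x. [x]) u" "map Var u" "map Var u"] assms(2) l by simp
qed

lemma rename_has_sort:
  assumes "ded v t t'" "has_sort sg t b" "set u \<subseteq> vars sg" "map (vsort sg) u = map (vsort sg) v"
  shows "has_sort sg (inst v (map Var u) t) b"
proof (rule inst_has_sort[OF assms(2) R_vars[OF ded_D(1)[OF assms(1)]] R_context(1)[OF ded_D(1)[OF assms(1)]]])
  have "length u = length v" using assms(4) by (metis length_map)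
  moreover have "vsort sg (u ! i) = vsort sg (v ! i)" if "i < length v" for i
    using that calculation assms(4) by (metis nth_map)
  moreover have "u ! i \<in> vars sg" if "i < length u" for i
    using that assms(3) nth_mem by blast
  ultimately show "list_all2 (\<lambda>t x. has_sort sg t (vsort sg x)) (map Var u) v"
    by (auto simp: list_all2_conv_all_nth) (metis has_sort_Var)
qed

abbreviation ev :: "'s list \<Rightarrow> ('f, 'v) trm \<Rightarrow> ('f, 'v) trm list \<Rightarrow> ('f, 'v) trm" where
  "ev a f ts \<equiv> inst (cctx a) ts f"

text \<open>A term in the context \<open>cctx a\<close> is
  determined by its instances \<open>ev a f ts\<close>, and under \<open>ev\<close> these operations become composition of
  functions, reindexing of arguments and the identity; hence the axioms of a multicategory hold
  already for representatives.\<close>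

definition rcomp :: "'s list \<Rightarrow> 's list list \<Rightarrow> ('f, 'v) trm \<Rightarrow> ('f, 'v) trm list \<Rightarrow> ('f, 'v) trm" where
  "rcomp bs as g fs = ev bs g (map3 ev as fs (blocks (map length as) (map Var (cctx (concat as)))))"

definition ract :: "finmap \<Rightarrow> 's list \<Rightarrow> ('f, 'v) trm \<Rightarrow> ('f, 'v) trm" where
  "ract \<theta> a f = ev (pull \<theta> a) f (pull \<theta> (map Var (cctx a)))"

definition rid :: "'s \<Rightarrow> ('f, 'v) trm" where
  "rid b = Var (hd (cctx [b]))"

text \<open>Typing is built in, which makes this a partial equivalence: \<open>eqv a b t t\<close>
  says that \<open>t\<close> is a term of sort \<open>b\<close> in the context
  \<open>cctx a\<close>, that is, that it represents a multimorphism from \<open>a\<close> to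
  \<open>b\<close>.\<close>

definition eqv :: "'s list \<Rightarrow> 's \<Rightarrow> ('f, 'v) trm \<Rightarrow> ('f, 'v) trm \<Rightarrow> bool" where
  "eqv a b t t' \<longleftrightarrow> a \<in> lists (sorts sg) \<and> ded (cctx a) t t' \<and> has_sort sg t b"

definition eqvs :: "'s list list \<Rightarrow> 's list \<Rightarrow> ('f, 'v) trm list \<Rightarrow> ('f, 'v) trm list \<Rightarrow> bool" where
  "eqvs as bs fs fs' \<longleftrightarrow> as \<in> lists (lists (sorts sg)) \<and> length as = length bs \<and>
     length fs = length bs \<and> length fs' = length bs \<and> (\<forall>i<length bs. eqv (as ! i) (bs ! i) (fs ! i) (fs' ! i))"

lemma eqv_sym: "eqv a b t t' \<Longrightarrow> eqv a b t' t"
  by (auto simp: eqv_def intro: deduct_sym ded_D(3))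

lemma eqv_trans: "eqv a b t t' \<Longrightarrow> eqv a b t' t'' \<Longrightarrow> eqv a b t t''"
  by (auto simp: eqv_def intro: deduct_trans)

lemma eqv_refl: "eqv a b t t' \<Longrightarrow> eqv a b t t"
  using eqv_sym eqv_trans by blast

lemma eqv_tau: "eqv a b t t' \<Longrightarrow> set (tau t) \<subseteq> set (cctx a)"
  unfolding eqv_def using ded_D(1) R_vars by blast

lemma subst_ev:
  assumes "eqv a b f f'" "length ts = length a"
  shows "subst s (ev a f ts) = ev a f (map (subst s) ts)"
  using assms eqv_tau[OF assms(1)] by (intro subst_inst) (auto simp: eqv_def cctx)

lemma ev_inst_comp:
  assumes "eqv a b f f'" "length us = length a"
  shows "inst v ts (ev a f us) = ev a f (map (inst v ts) us)"
  unfolding inst_def[of v ts] inst_def[of v ts, abs_def] by (rule subst_ev[OF assms])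

text \<open>Instantiating at the variables of \<open>cctx a\<close> gives back the term. The
  conclusion is literal equality of terms, not provable equality.\<close>

lemma ev_ext:
  assumes "eqv a b p p" "eqv a b q q" "\<And>ts. length ts = length a \<Longrightarrow> ev a p ts = ev a q ts"
  shows "p = q"
proof -
  have a: "a \<in> lists (sorts sg)" using assms(1) by (simp add: eqv_def)
  have "ev a p (map Var (cctx a)) = ev a q (map Var (cctx a))"
    by (rule assms(3)) (simp add: cctx[OF a])
  then show ?thesis
    using eqv_tau[OF assms(1)] eqv_tau[OF assms(2)] cctx(3)[OF a] by (simp add: inst_Var)
qed

lemma length_nth: "map length xs = map length ys \<Longrightarrow> i < length ys \<Longrightarrow> length (xs ! i) = length (ys ! i)"
  by (metis length_map nth_map)

text \<open>The inner terms of \<open>rcomp\<close> are written in consecutive blocks of the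
  variables of \<open>cctx (concat as)\<close>. Substituting \<open>concat tss\<close> sends the
  \<open>i\<close>-th block to the \<open>i\<close>-th list of \<open>tss\<close>, and substitution
  commutes with instantiation by \<open>subst_ev\<close>.\<close>

lemma ev_rcomp:
  assumes g: "eqv bs c g g" and fs: "eqvs as bs fs fs" and tss: "map length tss = map length as"
  shows "ev (concat as) (rcomp bs as g fs) (concat tss) = ev bs g (map3 ev as fs tss)"
proof -
  let ?v = "cctx (concat as)"
  let ?bl = "blocks (map length as) (map Var ?v) :: ('f, 'v) trm list list"
  define s where "s = env ?v (concat tss)"
  have as: "as \<in> lists (lists (sorts sg))" using fs by (simp add: eqvs_def)
  have v: "distinct ?v" "length ?v = length (concat as)"
    using cctx[OF concat_lists[OF as]] by auto
  have l: "length as = length bs" "length fs = length bs" "length tss = length bs"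
    using fs tss by (auto simp: eqvs_def dest: map_eq_imp_length_eq)
  have bl: "map length ?bl = map length as"
    by (rule length_blocks) (simp add: v length_concat)
  then have lb: "length ?bl = length bs" using l by (metis length_map)
  have "map (map (subst s)) ?bl = blocks (map length as) (map s ?v)"
    by (simp add: map_blocks comp_def)
  also have "map s ?v = concat tss"
    unfolding s_def using v tss by (intro map_env) (simp_all add: length_concat)
  also have "blocks (map length as) (concat tss) = tss"
    unfolding tss[symmetric] by (rule blocks_concat)
  finally have mb: "map (map (subst s)) ?bl = tss" .
  have "map (subst s) (map3 ev as fs ?bl) = map3 ev as fs tss"
  proof (rule nth_equalityI)
    fix i assume "i < length (map (subst s) (map3 ev as fs ?bl))"
    then have i: "i < length bs" using l lb by simp
    then have "subst s (ev (as ! i) (fs ! i) (?bl ! i)) = ev (as ! i) (fs ! i) (map (subst s) (?bl ! i))"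
      using fs length_nth[OF bl, of i] l by (intro subst_ev[of _ "bs ! i" _ "fs ! i"]) (auto simp: eqvs_def)
    also have "map (subst s) (?bl ! i) = tss ! i"
      using i lb by (subst mb[symmetric]) simp
    finally show "map (subst s) (map3 ev as fs ?bl) ! i = map3 ev as fs tss ! i"
      using i l lb by simp
  qed (simp add: l lb)
  then show ?thesis
    unfolding rcomp_def inst_def[of ?v] s_def[symmetric]
    using l lb by (subst subst_ev[OF g]) simp_all
qed

text \<open>The blocks of \<open>cctx (concat as)\<close> are contexts whose concatenation is the
  whole context. They serve as the family of contexts in the substitution rule, after each
  \<open>fs ! i\<close> has been renamed from \<open>cctx (as ! i)\<close> to its block.\<close>

lemma eqv_rcomp:
  assumes g: "eqv bs c g g'" and fs: "eqvs as bs fs fs'"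
  shows "eqv (concat as) c (rcomp bs as g fs) (rcomp bs as g' fs')"
proof -
  let ?v = "cctx (concat as)"
  let ?bl = "blocks (map length as) ?v"
  have as: "as \<in> lists (lists (sorts sg))" and bs: "bs \<in> lists (sorts sg)"
    using fs g by (auto simp: eqvs_def eqv_def)
  note v = cctx[OF concat_lists[OF as]]
  have l: "length as = length bs" "length fs = length bs" "length fs' = length bs"
    using fs by (auto simp: eqvs_def)
  have ci: "concat ?bl = ?v"
    by (rule concat_blocks) (simp add: v length_concat)
  have "map length ?bl = map length as"
    by (rule length_blocks) (simp add: v length_concat)
  then have lb: "length ?bl = length bs" using l by (metis length_map)
  have "map (map (vsort sg)) ?bl = as"
    unfolding map_blocks v(2) by (rule blocks_concat)
  then have sb: "map (vsort sg) (?bl ! i) = as ! i" if "i < length bs" for i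
    using that lb by (metis nth_map)
  have Rb: "R (?bl ! i) (?bl ! i)" and vb: "set (?bl ! i) \<subseteq> vars sg" if "i < length bs" for i
  proof -
    have mem: "?bl ! i \<in> set ?bl" using that lb by simp
    have "distinct (concat ?bl)" using v(3) ci by simp
    then have "distinct (?bl ! i)" using mem by (auto simp: distinct_concat_iff)
    moreover have "set (?bl ! i) \<subseteq> set (concat ?bl)" using mem by auto
    then have "set (?bl ! i) \<subseteq> set ?v" unfolding ci .
    ultimately show "R (?bl ! i) (?bl ! i)" "set (?bl ! i) \<subseteq> vars sg"
      using v(6) R_refl by (auto simp: is_context_def)
  qed
  have mv: "blocks (map length as) (map Var ?v) = map (map Var) ?bl"
    by (simp add: map_blocks)
  have nth: "map3 ev as hs (blocks (map length as) (map Var ?v)) ! i = ev (as ! i) (hs ! i) (map Var (?bl ! i))"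
    if "i < length bs" "length hs = length bs" for i hs
    unfolding mv using that l lb by simp
  have len: "length (map3 ev as hs (blocks (map length as) (map Var ?v))) = length (cctx bs)"
    if "length hs = length bs" for hs
    unfolding mv using that l lb cctx(4)[OF bs] by simp
  have f: "ded (cctx (as ! i)) (fs ! i) (fs' ! i)" "has_sort sg (fs ! i) (bs ! i)" "as ! i \<in> lists (sorts sg)"
    if "i < length bs" for i
    using fs that by (auto simp: eqvs_def eqv_def)
  have vs: "vsort sg (cctx bs ! i) = bs ! i" if "i < length bs" for i
    using cctx(2,4)[OF bs] that by (metis nth_map)
  have sort: "has_sort sg (ev (as ! i) (fs ! i) (map Var (?bl ! i))) (vsort sg (cctx bs ! i))"
    if "i < length bs" for i
    using rename_has_sort[OF f(1,2) vb] sb cctx(2)[OF f(3)] vs that by simp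
  have "ded ?v (rcomp bs as g fs) (rcomp bs as g' fs')"
    unfolding rcomp_def
  proof (rule ded_inst)
    show "ded (cctx bs) g g'" using g by (simp add: eqv_def)
    show "R ?v (concat ?bl)" using v(5) ci by simp
    fix i assume "i < length (cctx bs)"
    then have i: "i < length bs" using cctx(4)[OF bs] by simp
    show "ded (?bl ! i) (map3 ev as fs (blocks (map length as) (map Var ?v)) ! i)
        (map3 ev as fs' (blocks (map length as) (map Var ?v)) ! i) \<and>
      has_sort sg (map3 ev as fs (blocks (map length as) (map Var ?v)) ! i) (vsort sg (cctx bs ! i))"
      unfolding nth[OF i l(2)] nth[OF i l(3)]
      using ded_rename[OF f(1)[OF i] Rb[OF i]] sb[OF i] cctx(2)[OF f(3)[OF i]] sort[OF i] by simp
  qed (simp_all add: len l lb cctx(4)[OF bs])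
  moreover have "has_sort sg (rcomp bs as g fs) c"
    unfolding rcomp_def
  proof (rule inst_has_sort)
    show "list_all2 (\<lambda>t x. has_sort sg t (vsort sg x))
       (map3 ev as fs (blocks (map length as) (map Var ?v))) (cctx bs)"
      using sort nth[OF _ l(2)] len[OF l(2)] cctx(4)[OF bs] by (simp add: list_all2_conv_all_nth)
  qed (use g eqv_tau[OF g] cctx(3)[OF bs] in \<open>auto simp: eqv_def\<close>)
  ultimately show ?thesis using concat_lists[OF as] by (simp add: eqv_def)
qed

lemma ev_ract:
  assumes "is_finmap \<theta>" "length a = tgt \<theta>" "a \<in> lists (sorts sg)" "eqv (pull \<theta> a) b f f'" "length ts = length a"
  shows "ev a (ract \<theta> a f) ts = ev (pull \<theta> a) f (pull \<theta> ts)"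
proof -
  note v = cctx[OF assms(3)]
  have "map (inst (cctx a) ts) (pull \<theta> (map Var (cctx a))) = pull \<theta> (map (inst (cctx a) ts) (map Var (cctx a)))"
    using assms v by (intro map_pull) simp_all
  also have "map (inst (cctx a) ts) (map Var (cctx a)) = ts"
    using assms v map_env[of "cctx a" ts] by (simp add: inst_def comp_def)
  finally show ?thesis
    unfolding ract_def using assms by (subst ev_inst_comp[OF assms(4)]) simp_all
qed

text \<open>The word \<open>pull \<theta> (cctx a)\<close> is related to \<open>cctx a\<close>
  because \<open>\<theta>\<close> lies in \<open>Delta R\<close>. It need not be a context, and
  \<open>ded_rename\<close> does not ask for one.\<close>

lemma eqv_ract:
  assumes "\<theta> \<in> Delta R" "length a = tgt \<theta>" "a \<in> lists (sorts sg)" "eqv (pull \<theta> a) b f f'"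
  shows "eqv a b (ract \<theta> a f) (ract \<theta> a f')"
proof -
  note v = cctx[OF assms(3)]
  have p: "pull \<theta> a \<in> lists (sorts sg)" using assms(4) by (simp add: eqv_def)
  have f: "is_finmap \<theta>" using assms(1) Delta_finmap by blast
  have u: "pull \<theta> (map Var (cctx a)) = map Var (pull \<theta> (cctx a))"
    using assms(2) v f by (simp add: map_pull)
  have s: "map (vsort sg) (pull \<theta> (cctx a)) = map (vsort sg) (cctx (pull \<theta> a))"
    using assms(2) v f cctx(2)[OF p] by (simp add: map_pull)
  have R: "R (cctx a) (pull \<theta> (cctx a))"
    using R_pull[OF v(5) assms(1)] assms(2) v by simp
  show ?thesis
    unfolding eqv_def ract_def u
    using ded_rename[OF _ R s] rename_has_sort[OF _ _ R_context(3)[OF R] s] assms(3,4)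
    by (auto simp: eqv_def)
qed

lemma eqv_rid: "b \<in> sorts sg \<Longrightarrow> eqv [b] b (rid b) (rid b)"
  and ev_rid: "b \<in> sorts sg \<Longrightarrow> ev [b] (rid b) [t] = t"
proof -
  assume b: "b \<in> sorts sg"
  then have l: "[b] \<in> lists (sorts sg)" by simp
  note v = cctx[OF l]
  then obtain x where x: "cctx [b] = [x]" by (auto simp: length_Suc_conv)
  show "ev [b] (rid b) [t] = t"
    by (simp add: rid_def x inst_def env_def)
  have "has_sort sg (Var x) b" using v has_sort_Var[of x sg] by (simp add: x)
  moreover have "R [x] [x]" using v by (simp add: x)
  ultimately show "eqv [b] b (rid b) (rid b)"
    using l by (auto simp: eqv_def rid_def x intro: deduct_refl)
qed

end

lemma concat_concat_concat: "concat (map concat xsss) = concat (concat xsss)"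
  by (induction xsss) auto

lemma pull_fid: "length xs = n \<Longrightarrow> pull (fid n) xs = xs"
  using map_nth[of xs] by (simp add: pull_def fid_def)

section \<open>The multicategory axioms for representatives\<close>

context theory_over begin

lemma eqvs_Cons:
  "eqvs (a # as) (b # bs) (f # fs) (f' # fs') \<longleftrightarrow> a \<in> lists (sorts sg) \<and> eqv a b f f' \<and> eqvs as bs fs fs'"
  unfolding eqvs_def by (auto simp: All_less_Suc2)

lemma eqvs_Nil: "eqvs [] bs fs fs' \<longleftrightarrow> bs = [] \<and> fs = [] \<and> fs' = []"
  unfolding eqvs_def by auto

lemma eqvs_append:
  assumes "eqvs as bs fs fs'" "eqvs as' bs' gs gs'"
  shows "eqvs (as @ as') (bs @ bs') (fs @ gs) (fs' @ gs')"
  using assms unfolding eqvs_def by (auto simp: nth_append)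

lemma eqvs_concat:
  "length bss = length asss \<Longrightarrow> length fss = length asss \<Longrightarrow>
   \<forall>i<length asss. eqvs (asss ! i) (bss ! i) (fss ! i) (fss ! i) \<Longrightarrow>
   eqvs (concat asss) (concat bss) (concat fss) (concat fss)"
proof (induction asss arbitrary: bss fss)
  case Nil
  then show ?case by (simp add: eqvs_Nil)
next
  case (Cons as asss)
  then show ?case by (auto simp: length_Suc_conv All_less_Suc2 intro!: eqvs_append)
qed

lemma eqv_lists: "eqv a b t t' \<Longrightarrow> a \<in> lists (sorts sg)"
  by (simp add: eqv_def)

lemma rcomp_ident_left:
  assumes "eqv a b f f" "b \<in> sorts sg"
  shows "rcomp [b] [a] (rid b) [f] = f"
proof (rule ev_ext[of a b])
  have fs: "eqvs [a] [b] [f] [f]"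
    using assms eqv_lists by (auto simp: eqvs_Cons eqvs_Nil)
  show "eqv a b (rcomp [b] [a] (rid b) [f]) (rcomp [b] [a] (rid b) [f])"
    using eqv_rcomp[OF eqv_rid[OF assms(2)] fs] by simp
  show "ev a (rcomp [b] [a] (rid b) [f]) ts = ev a f ts" if "length ts = length a" for ts
    using ev_rcomp[OF eqv_rid[OF assms(2)] fs, of "[ts]"] that ev_rid[OF assms(2)] by simp
qed (rule assms)

lemma rcomp_ident_right:
  assumes "eqv a b f f"
  shows "rcomp a (map (\<lambda>x. [x]) a) f (map rid a) = f"
proof (rule ev_ext[of a b])
  have a: "a \<in> lists (sorts sg)" using assms eqv_lists by blast
  then have as: "a ! i \<in> sorts sg" if "i < length a" for i using that by auto
  have fs: "eqvs (map (\<lambda>x. [x]) a) a (map rid a) (map rid a)"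
    using a eqv_rid[OF as] by (auto simp: eqvs_def)
  show "eqv a b (rcomp a (map (\<lambda>x. [x]) a) f (map rid a)) (rcomp a (map (\<lambda>x. [x]) a) f (map rid a))"
    using eqv_rcomp[OF assms fs] by simp
  show "ev a (rcomp a (map (\<lambda>x. [x]) a) f (map rid a)) ts = ev a f ts" if "length ts = length a" for ts
  proof -
    have "map3 ev (map (\<lambda>x. [x]) a) (map rid a) (map (\<lambda>x. [x]) ts) = ts"
      using that ev_rid[OF as] by (intro nth_equalityI) auto
    moreover have "map length (map (\<lambda>x. [x]) ts) = map length (map (\<lambda>x. [x]) a)"
      using that by (simp add: map_equality_iff)
    ultimately show ?thesis
      using ev_rcomp[OF assms fs, of "map (\<lambda>x. [x]) ts"] by simp
  qed
qed (rule assms)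

text \<open>Both sides are evaluated at a list of terms that is cut twice: into one block for each
  word in \<open>concat asss\<close>, and these blocks are grouped by the entries of
  \<open>cs\<close>. Each side then applies \<open>h\<close> to the same nested instances.\<close>

lemma rcomp_assoc:
  assumes h: "eqv cs d h h" and gs: "eqvs bss cs gs gs"
    and len: "length asss = length cs" "length fss = length cs"
    and fss: "\<forall>i<length cs. eqvs (asss ! i) (bss ! i) (fss ! i) (fss ! i)"
  shows "rcomp (concat bss) (concat asss) (rcomp cs bss h gs) (concat fss)
    = rcomp cs (map concat asss) h (map (\<lambda>i. rcomp (bss ! i) (asss ! i) (gs ! i) (fss ! i)) [0..<length cs])"
    (is "?l = rcomp cs _ h ?ks")
proof (rule ev_ext[of "concat (concat asss)" d])
  have l: "length bss = length cs" "length gs = length cs" using gs by (auto simp: eqvs_def)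
  have g: "eqv (bss ! i) (cs ! i) (gs ! i) (gs ! i)" if "i < length cs" for i
    using gs that by (simp add: eqvs_def)
  have f: "eqvs (concat asss) (concat bss) (concat fss) (concat fss)"
    using fss len l by (intro eqvs_concat) auto
  have hg: "eqv (concat bss) d (rcomp cs bss h gs) (rcomp cs bss h gs)"
    by (rule eqv_rcomp[OF h gs])
  have k: "eqvs (map concat asss) cs ?ks ?ks"
    unfolding eqvs_def
  proof (intro conjI allI impI)
    show "map concat asss \<in> lists (lists (sorts sg))"
    proof (rule in_listsI, rule ballI)
      fix a assume "a \<in> set (map concat asss)"
      then obtain i where i: "i < length cs" "a = concat (asss ! i)"
        using len by (auto simp: in_set_conv_nth)
      have "asss ! i \<in> lists (lists (sorts sg))"
        using fss[rule_format, OF i(1)] unfolding eqvs_def by (elim conjE)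
      then show "a \<in> lists (sorts sg)"
        unfolding i(2) by (rule concat_lists)
    qed
    fix i assume i: "i < length cs"
    show "eqv (map concat asss ! i) (cs ! i) (?ks ! i) (?ks ! i)"
      using eqv_rcomp[OF g[OF i] fss[rule_format, OF i]] i len by simp
  qed (simp_all add: len)
  show "eqv (concat (concat asss)) d ?l ?l"
    by (rule eqv_rcomp[OF hg f])
  show "eqv (concat (concat asss)) d (rcomp cs (map concat asss) h ?ks) (rcomp cs (map concat asss) h ?ks)"
    using eqv_rcomp[OF h k] by (simp add: concat_concat_concat)
  fix ts :: "('f, 'v) trm list" assume "length ts = length (concat (concat asss))"
  then obtain tss where tss: "concat tss = ts" "map length tss = map length (concat asss)"
    using split_blocks[of "map length (concat asss)" ts] by (auto simp: length_concat)
  then have "length tss = length (concat asss)" by (metis length_map)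
  then obtain tsss where tsss: "concat tsss = tss" "map length tsss = map length asss"
    using split_blocks[of "map length asss" tss] by (auto simp: length_concat)
  have lt: "length tsss = length cs" using tsss(2) len by (metis length_map)
  \<comment> \<open>Block lengths agree in the flattened lists; since the groups have equal sizes,
    \<open>concat\<close> can be cancelled.\<close>
  have "concat (map (map length) tsss) = concat (map (map length) asss)"
    using tss(2) tsss(1) by (metis map_concat)
  then have mm: "map (map length) tsss = map (map length) asss"
    by (rule concat_injective) (use tsss(2) lt len length_nth[OF tsss(2)] in \<open>auto simp: set_zip\<close>)
  have m: "map length (tsss ! i) = map length (asss ! i)" if "i < length cs" for i
    using mm that lt len by (metis nth_map)
  have la: "length (asss ! i) = length (bss ! i)" "length (fss ! i) = length (bss ! i)" if "i < length cs" for i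
    using fss that by (auto simp: eqvs_def)
  have "ev (concat (concat asss)) ?l ts = ev (concat bss) (rcomp cs bss h gs) (map3 ev (concat asss) (concat fss) tss)"
    using ev_rcomp[OF hg f tss(2)] tss(1) by simp
  also have "map3 ev (concat asss) (concat fss) tss = concat (map3 (map3 ev) asss fss tsss)"
    unfolding tsss(1)[symmetric] using la len tsss(2)
    by (intro map3_concat) (auto simp: list_eq_iff_nth_eq)
  also have "ev (concat bss) (rcomp cs bss h gs) \<dots> = ev cs h (map3 ev bss gs (map3 (map3 ev) asss fss tsss))"
    using la len lt l map_eq_imp_length_eq[OF m] by (intro ev_rcomp[OF h gs]) (auto simp: list_eq_iff_nth_eq)
  also have "map3 ev bss gs (map3 (map3 ev) asss fss tsss) = map3 ev (map concat asss) ?ks (map concat tsss)"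
  proof (rule nth_equalityI)
    fix i assume "i < length (map3 ev bss gs (map3 (map3 ev) asss fss tsss))"
    then have i: "i < length cs" using l len lt by simp
    then show "map3 ev bss gs (map3 (map3 ev) asss fss tsss) ! i = map3 ev (map concat asss) ?ks (map concat tsss) ! i"
      using ev_rcomp[OF g[OF i] fss[rule_format, OF i] m[OF i]] l len lt by simp
  qed (simp add: l len lt)
  also have "ev cs h \<dots> = ev (concat (map concat asss)) (rcomp cs (map concat asss) h ?ks) (concat (map concat tsss))"
  proof (rule ev_rcomp[OF h k, symmetric])
    show "map length (map concat tsss) = map length (map concat asss)"
      using m lt len by (intro nth_equalityI) (auto simp: length_concat)
  qed
  also have "\<dots> = ev (concat (concat asss)) (rcomp cs (map concat asss) h ?ks) ts"
    unfolding tss(1)[symmetric] tsss(1)[symmetric] by (simp add: concat_concat_concat)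
  finally show "ev (concat (concat asss)) ?l ts = ev (concat (concat asss)) (rcomp cs (map concat asss) h ?ks) ts" .
qed

lemma ract_fid:
  assumes "eqv a b f f"
  shows "ract (fid (length a)) a f = f"
proof -
  have a: "a \<in> lists (sorts sg)" using assms eqv_lists by blast
  show ?thesis
    using eqv_tau[OF assms] cctx[OF a] by (simp add: ract_def pull_fid inst_Var)
qed

lemma ract_fcomp:
  assumes \<sigma>: "\<sigma> \<in> Delta R" and \<tau>: "\<tau> \<in> Delta R" and st: "tgt \<sigma> = src \<tau>"
    and a: "a \<in> lists (sorts sg)" "length a = tgt \<tau>" and f: "eqv (pull (fcomp \<tau> \<sigma>) a) b f f"
  shows "ract (fcomp \<tau> \<sigma>) a f = ract \<tau> a (ract \<sigma> (pull \<tau> a) f)"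
proof -
  have fin: "is_finmap \<sigma>" "is_finmap \<tau>" using \<sigma> \<tau> Delta_finmap by auto
  have p: "pull \<tau> a \<in> lists (sorts sg)" using fin a pull_lists by blast
  note pf = pull_fcomp[OF fin(1) st]
  have f': "eqv (pull \<sigma> (pull \<tau> a)) b f f" using f by (simp add: pf)
  let ?ts = "map Var (cctx a) :: ('f, 'v) trm list"
  have g: "eqv (pull \<tau> a) b (ract \<sigma> (pull \<tau> a) f) (ract \<sigma> (pull \<tau> a) f)"
    by (rule eqv_ract[OF \<sigma> _ p f']) (simp add: st)
  have "ract \<tau> a (ract \<sigma> (pull \<tau> a) f) = ev (pull \<tau> a) (ract \<sigma> (pull \<tau> a) f) (pull \<tau> ?ts)"
    by (simp add: ract_def[of \<tau>])
  also have "\<dots> = ev (pull \<sigma> (pull \<tau> a)) f (pull \<sigma> (pull \<tau> ?ts))"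
    by (rule ev_ract[OF fin(1) _ p f']) (simp_all add: st)
  also have "\<dots> = ract (fcomp \<tau> \<sigma>) a f"
    by (simp add: ract_def pf)
  finally show ?thesis ..
qed

text \<open>The sum of the maps acts block by block on a list of terms. At \<open>concat tss\<close>
  both sides therefore apply \<open>g\<close> to the instances of \<open>fs ! i\<close> at
  \<open>pull (\<sigma>s ! i) (tss ! i)\<close>.\<close>

lemma rcomp_ract_inner:
  assumes \<sigma>s: "set \<sigma>s \<subseteq> Delta R" "length \<sigma>s = length bs"
    and as: "as \<in> lists (lists (sorts sg))" "map length as = map tgt \<sigma>s"
    and g: "eqv bs c g g" and fs: "eqvs (map2 pull \<sigma>s as) bs fs fs" and c: "c \<in> sorts sg"
  shows "rcomp bs as g (map (\<lambda>i. ract (\<sigma>s ! i) (as ! i) (fs ! i)) [0..<length bs])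
    = ract (fsum \<sigma>s) (concat as) (rcomp bs (map2 pull \<sigma>s as) g fs)"
    (is "rcomp bs as g ?ks = ract _ _ ?X")
proof (rule ev_ext[of "concat as" c])
  have la: "length as = length bs" using as(2) \<sigma>s(2) by (metis length_map)
  have lf: "length fs = length bs" using fs by (simp add: eqvs_def)
  have fin: "\<forall>\<sigma>\<in>set \<sigma>s. is_finmap \<sigma>" using \<sigma>s(1) Delta_finmap by blast
  have ai: "as ! i \<in> lists (sorts sg)" "length (as ! i) = tgt (\<sigma>s ! i)" "\<sigma>s ! i \<in> Delta R" "is_finmap (\<sigma>s ! i)"
    "eqv (pull (\<sigma>s ! i) (as ! i)) (bs ! i) (fs ! i) (fs ! i)" if "i < length bs" for i
  proof -
    show "as ! i \<in> lists (sorts sg)" using as(1) that la nth_mem[of i as] by (simp del: nth_mem in_lists_conv_set add: in_lists_conv_set[of as])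
    show "length (as ! i) = tgt (\<sigma>s ! i)" using as(2) that la \<sigma>s(2) by (metis nth_map)
    show "\<sigma>s ! i \<in> Delta R" "is_finmap (\<sigma>s ! i)" using \<sigma>s fin that by auto
    show "eqv (pull (\<sigma>s ! i) (as ! i)) (bs ! i) (fs ! i) (fs ! i)" using fs that la \<sigma>s(2) by (simp add: eqvs_def)
  qed
  have k: "eqvs as bs ?ks ?ks"
    using as(1) la eqv_ract[OF ai(3,2,1,5)] by (simp add: eqvs_def del: in_lists_conv_set)
  have X: "eqv (concat (map2 pull \<sigma>s as)) c ?X ?X"
    by (rule eqv_rcomp[OF g fs])
  have pa: "pull (fsum \<sigma>s) (concat as) = concat (map2 pull \<sigma>s as)"
    by (rule pull_fsum[OF as(2) fin])
  have D: "fsum \<sigma>s \<in> Delta R" using structure_category[OF c] \<sigma>s(1) unfolding structure_category_def by blast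
  have t: "length (concat as) = tgt (fsum \<sigma>s)" by (simp add: fsum_def length_concat as(2))
  have X': "eqv (pull (fsum \<sigma>s) (concat as)) c ?X ?X" using X pa by simp
  show "eqv (concat as) c (rcomp bs as g ?ks) (rcomp bs as g ?ks)"
    by (rule eqv_rcomp[OF g k])
  show "eqv (concat as) c (ract (fsum \<sigma>s) (concat as) ?X) (ract (fsum \<sigma>s) (concat as) ?X)"
    by (rule eqv_ract[OF D t concat_lists[OF as(1)] X'])
  fix ts :: "('f, 'v) trm list" assume lt: "length ts = length (concat as)"
  then obtain tss where tss: "concat tss = ts" "map length tss = map length as"
    using split_blocks[of "map length as" ts] by (auto simp: length_concat)
  have ltss: "length tss = length bs" using tss(2) la by (metis length_map)
  have lti: "length (tss ! i) = length (as ! i)" if "i < length bs" for i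
    using length_nth[OF tss(2)] that la by simp
  have pt: "pull (fsum \<sigma>s) ts = concat (map2 pull \<sigma>s tss)"
    using pull_fsum[of tss \<sigma>s] tss as(2) fin by simp
  have "ev (concat as) (rcomp bs as g ?ks) ts = ev bs g (map3 ev as ?ks tss)"
    using ev_rcomp[OF g k tss(2)] tss(1) by simp
  also have "map3 ev as ?ks tss = map3 ev (map2 pull \<sigma>s as) fs (map2 pull \<sigma>s tss)"
    by (rule nth_equalityI) (simp_all add: la lf ltss \<sigma>s(2) ev_ract[OF ai(4,2,1,5) lti])
  also have "ev bs g \<dots> = ev (concat (map2 pull \<sigma>s as)) ?X (concat (map2 pull \<sigma>s tss))"
    by (rule ev_rcomp[OF g fs, symmetric]) (auto simp: list_eq_iff_nth_eq la ltss \<sigma>s(2))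
  also have "\<dots> = ev (concat as) (ract (fsum \<sigma>s) (concat as) ?X) ts"
    using ev_ract[OF Delta_finmap[OF D] t concat_lists[OF as(1)] X' lt] pa pt by simp
  finally show "ev (concat as) (rcomp bs as g ?ks) ts = ev (concat as) (ract (fsum \<sigma>s) (concat as) ?X) ts" .
qed

lemma pull_eqvs:
  assumes "is_finmap \<tau>" "length bs = tgt \<tau>" "eqvs as bs fs fs'"
  shows "eqvs (pull \<tau> as) (pull \<tau> bs) (pull \<tau> fs) (pull \<tau> fs')"
proof -
  have "pull \<tau> as \<in> lists (lists (sorts sg))"
    using assms by (intro pull_lists) (simp_all add: eqvs_def del: in_lists_conv_set)
  moreover have "vals \<tau> ! i < length bs" if "i < src \<tau>" for i
    using assms(1,2) that nth_mem[of i "vals \<tau>"] by (simp add: is_finmap_def src_def)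
  ultimately show ?thesis
    using assms(3) by (auto simp: eqvs_def pull_def src_def simp del: in_lists_conv_set)
qed

text \<open>The similarity component moves whole blocks. So it makes no difference whether all
  instances of \<open>fs\<close> are formed and then selected by \<open>\<tau>\<close>, or terms and
  blocks are selected first.\<close>

lemma rcomp_ract_outer:
  assumes \<tau>: "\<tau> \<in> Delta R" "length bs = tgt \<tau>" "bs \<in> lists (sorts sg)"
    and g: "eqv (pull \<tau> bs) c g g" and fs: "eqvs as bs fs fs" and c: "c \<in> sorts sg"
  shows "rcomp bs as (ract \<tau> bs g) fs
    = ract (fsim \<tau> (map length as)) (concat as) (rcomp (pull \<tau> bs) (pull \<tau> as) g (pull \<tau> fs))"
    (is "?l = ract ?\<theta> _ ?X")
proof (rule ev_ext[of "concat as" c])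
  have fin: "is_finmap \<tau>" using \<tau>(1) Delta_finmap by blast
  have as: "as \<in> lists (lists (sorts sg))" and la: "length as = tgt \<tau>" and lf: "length fs = tgt \<tau>"
    using fs \<tau>(2) by (simp_all add: eqvs_def)
  have g': "eqv bs c (ract \<tau> bs g) (ract \<tau> bs g)"
    by (rule eqv_ract[OF \<tau> g])
  have pfs: "eqvs (pull \<tau> as) (pull \<tau> bs) (pull \<tau> fs) (pull \<tau> fs)"
    by (rule pull_eqvs[OF fin \<tau>(2) fs])
  have X: "eqv (concat (pull \<tau> as)) c ?X ?X" by (rule eqv_rcomp[OF g pfs])
  have pa: "pull ?\<theta> (concat as) = concat (pull \<tau> as)" by (rule pull_fsim[OF fin la])
  have D: "?\<theta> \<in> Delta R" using structure_category[OF c] \<tau>(1) la unfolding structure_category_def by simp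
  have t: "length (concat as) = tgt ?\<theta>" by (simp add: fsim_def length_concat)
  have X': "eqv (pull ?\<theta> (concat as)) c ?X ?X" using X pa by simp
  show "eqv (concat as) c ?l ?l" by (rule eqv_rcomp[OF g' fs])
  show "eqv (concat as) c (ract ?\<theta> (concat as) ?X) (ract ?\<theta> (concat as) ?X)"
    by (rule eqv_ract[OF D t concat_lists[OF as] X'])
  fix ts :: "('f, 'v) trm list" assume lt: "length ts = length (concat as)"
  then obtain tss where tss: "concat tss = ts" "map length tss = map length as"
    using split_blocks[of "map length as" ts] by (auto simp: length_concat)
  have ltss: "length tss = tgt \<tau>" using tss(2) la by (metis length_map)
  have pt: "pull ?\<theta> ts = concat (pull \<tau> tss)"
    using pull_fsim[OF fin ltss] tss by simp
  have vl: "vals \<tau> ! i < tgt \<tau>" if "i < src \<tau>" for i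
    using fin that nth_mem[of i "vals \<tau>"] by (simp add: is_finmap_def src_def)
  have "ev (concat as) ?l ts = ev bs (ract \<tau> bs g) (map3 ev as fs tss)"
    using ev_rcomp[OF g' fs tss(2)] tss(1) by simp
  also have "\<dots> = ev (pull \<tau> bs) g (pull \<tau> (map3 ev as fs tss))"
    by (rule ev_ract[OF fin \<tau>(2,3) g]) (simp add: la lf ltss \<tau>(2))
  also have "pull \<tau> (map3 ev as fs tss) = map3 ev (pull \<tau> as) (pull \<tau> fs) (pull \<tau> tss)"
    by (rule nth_equalityI) (use vl in \<open>simp_all add: la lf ltss, simp add: pull_def src_def la lf ltss\<close>)
  also have "ev (pull \<tau> bs) g \<dots> = ev (concat (pull \<tau> as)) ?X (concat (pull \<tau> tss))"
  proof (rule ev_rcomp[OF g pfs, symmetric])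
    show "map length (pull \<tau> tss) = map length (pull \<tau> as)"
      using tss(2) map_pull[OF fin ltss, of length] map_pull[OF fin la, of length] by simp
  qed
  also have "\<dots> = ev (concat as) (ract ?\<theta> (concat as) ?X) ts"
    using ev_ract[OF Delta_finmap[OF D] t concat_lists[OF as] X' lt] pa pt by simp
  finally show "ev (concat as) ?l ts = ev (concat as) (ract ?\<theta> (concat as) ?X) ts" .
qed

end

section \<open>The syntactic multicategory\<close>

context theory_over begin

definition cls :: "'s list \<Rightarrow> ('f, 'v) trm \<Rightarrow> ('f, 'v) trm set" where
  "cls a t = {t'. ded (cctx a) t t'}"

definition rep :: "('f, 'v) trm set \<Rightarrow> ('f, 'v) trm" where
  "rep X = (SOME t. t \<in> X)"

text \<open>The operations use the representatives chosen by \<open>rep\<close>; congruence of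
  \<open>rcomp\<close> and \<open>ract\<close> makes the resulting classes independent of that
  choice.\<close>

definition syn :: "('s, ('f, 'v) trm set) multicat" where
  "syn = \<lparr>
     obj = sorts sg,
     hom = (\<lambda>a b. {cls a t | t. eqv a b t t}),
     mcomp = (\<lambda>bs c as G Fs. cls (concat as) (rcomp bs as (rep G) (map rep Fs))),
     mident = (\<lambda>c. cls [c] (rid c)),
     mact = (\<lambda>\<theta> a b F. cls a (ract \<theta> a (rep F))) \<rparr>"

definition syn_model :: "('s, 'f, 's, ('f, 'v) trm set) model" where
  "syn_model = \<lparr> msort = (\<lambda>s. s), mfun = (\<lambda>f. cls (fdom sg f) (Fun f (map Var (cctx (fdom sg f))))) \<rparr>"

lemma obj_syn [simp]: "obj syn = sorts sg"
  by (simp add: syn_def)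

lemma mident_syn: "mident syn c = cls [c] (rid c)"
  by (simp add: syn_def)

lemma cls_eq: "eqv a b t t' \<Longrightarrow> cls a t = cls a t'"
  unfolding cls_def eqv_def by (auto intro: deduct_trans deduct_sym)

lemma cls_eqD: "eqv a b t' t' \<Longrightarrow> cls a t = cls a t' \<Longrightarrow> ded (cctx a) t t'"
  unfolding cls_def eqv_def by auto

lemma rep_cls: "eqv a b t t \<Longrightarrow> eqv a b (rep (cls a t)) t"
proof -
  assume t: "eqv a b t t"
  then have "t \<in> cls a t" by (simp add: cls_def eqv_def)
  then have "rep (cls a t) \<in> cls a t" unfolding rep_def by (rule someI)
  with t have "eqv a b t (rep (cls a t))" by (simp add: cls_def eqv_def)
  then show ?thesis by (rule eqv_sym)
qed

lemma hom_syn_iff: "F \<in> hom syn a b \<longleftrightarrow> eqv a b (rep F) (rep F) \<and> cls a (rep F) = F"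
proof
  assume "F \<in> hom syn a b"
  then obtain t where "F = cls a t" "eqv a b t t" by (auto simp: syn_def)
  then show "eqv a b (rep F) (rep F) \<and> cls a (rep F) = F"
    using rep_cls eqv_refl cls_eq by blast
qed (auto simp: syn_def)

lemma cls_hom: "eqv a b t t \<Longrightarrow> cls a t \<in> hom syn a b"
  by (auto simp: syn_def)

lemma homs_syn:
  assumes "homs syn as bs Fs"
  shows "eqvs as bs (map rep Fs) (map rep Fs)" "bs \<in> lists (sorts sg)"
  using assms by (auto simp: homs_def eqvs_def hom_syn_iff)

text \<open>Since \<open>rcomp\<close> respects \<open>eqv\<close>, the representatives picked by
  \<open>rep\<close> may be exchanged for any convenient ones.\<close>

lemma mcomp_syn:
  assumes "eqv bs c (rep G) g" "eqvs as bs (map rep Fs) fs"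
  shows "mcomp syn bs c as G Fs = cls (concat as) (rcomp bs as g fs)"
  using cls_eq[OF eqv_rcomp[OF assms]] by (simp add: syn_def)

lemma mact_syn:
  assumes "\<theta> \<in> Delta R" "length a = tgt \<theta>" "a \<in> lists (sorts sg)" "eqv (pull \<theta> a) b (rep F) f"
  shows "mact syn \<theta> a b F = cls a (ract \<theta> a f)"
  using cls_eq[OF eqv_ract[OF assms]] by (simp add: syn_def)

text \<open>A class arising inside a formula is represented, by \<open>rep_cls\<close>, by the term
  it was formed from. Each axiom then reduces to the equality of terms already proved for
  \<open>rcomp\<close> and \<open>ract\<close>.\<close>

lemma multicategory_syn: "multicategory (Delta R) syn"
proof (unfold_locales, goal_cases)
  case (1 c g bs as fs)
  then have "eqv bs c (rep g) (rep g)" "eqvs as bs (map rep fs) (map rep fs)"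
    using homs_syn by (auto simp: hom_syn_iff)
  then show ?case by (simp add: mcomp_syn cls_hom eqv_rcomp)
next
  case (2 c)
  then show ?case by (simp add: mident_syn cls_hom eqv_rid)
next
  case (3 \<theta> a b f)
  then have "eqv (pull \<theta> a) b (rep f) (rep f)" "a \<in> lists (sorts sg)" by (simp_all add: hom_syn_iff)
  then show ?case using 3 by (simp add: mact_syn cls_hom eqv_ract)
next
  case (4 d h cs bss gs asss fss)
  have h: "eqv cs d (rep h) (rep h)" using 4 by (simp add: hom_syn_iff)
  have g: "eqvs bss cs (map rep gs) (map rep gs)" using 4 homs_syn by blast
  have lg: "length gs = length cs" "length bss = length cs" using g by (auto simp: eqvs_def)
  have f: "eqvs (asss ! i) (bss ! i) (map rep (fss ! i)) (map rep (fss ! i))" if "i < length cs" for i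
    using 4(6) that homs_syn by blast
  have gi: "eqv (bss ! i) (cs ! i) (rep (gs ! i)) (rep (gs ! i))" if "i < length cs" for i
    using g that lg by (simp add: eqvs_def)
  have fc: "eqvs (concat asss) (concat bss) (concat (map (map rep) fss)) (concat (map (map rep) fss))"
    using f 4(4,5) lg by (intro eqvs_concat) auto
  let ?hg = "rcomp cs bss (rep h) (map rep gs)"
  let ?k = "\<lambda>i. rcomp (bss ! i) (asss ! i) (rep (gs ! i)) (map rep (fss ! i))"
  have "mcomp syn cs d bss h gs = cls (concat bss) ?hg"
    by (rule mcomp_syn[OF h g])
  moreover have "eqv (concat bss) d (rep (cls (concat bss) ?hg)) ?hg"
    by (rule rep_cls[OF eqv_rcomp[OF h g]])
  ultimately have l: "mcomp syn (concat bss) d (concat asss) (mcomp syn cs d bss h gs) (concat fss)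
    = cls (concat (concat asss)) (rcomp (concat bss) (concat asss) ?hg (concat (map (map rep) fss)))"
    using fc by (subst mcomp_syn) (simp_all add: map_concat)
  have k: "mcomp syn (bss ! i) (cs ! i) (asss ! i) (gs ! i) (fss ! i) = cls (concat (asss ! i)) (?k i)"
    "eqv (concat (asss ! i)) (cs ! i) (rep (cls (concat (asss ! i)) (?k i))) (?k i)"
    if "i < length cs" for i
    using mcomp_syn[OF gi f] rep_cls[OF eqv_rcomp[OF gi f]] that by auto
  have "eqvs (map concat asss) cs (map rep (map (\<lambda>i. mcomp syn (bss ! i) (cs ! i) (asss ! i) (gs ! i) (fss ! i)) [0..<length cs]))
      (map ?k [0..<length cs])"
    unfolding eqvs_def
  proof (intro conjI allI impI)
    show "map concat asss \<in> lists (lists (sorts sg))"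
    proof (rule in_listsI, rule ballI)
      fix a assume "a \<in> set (map concat asss)"
      then obtain i where "i < length cs" "a = concat (asss ! i)"
        using 4 by (auto simp: in_set_conv_nth)
      then show "a \<in> lists (sorts sg)" using k(2) eqv_lists by blast
    qed
  qed (use 4 k in simp_all)
  then have "mcomp syn cs d (map concat asss) h
      (map (\<lambda>i. mcomp syn (bss ! i) (cs ! i) (asss ! i) (gs ! i) (fss ! i)) [0..<length cs])
    = cls (concat (map concat asss)) (rcomp cs (map concat asss) (rep h) (map ?k [0..<length cs]))"
    by (rule mcomp_syn[OF h])
  also have "map ?k [0..<length cs] = map (\<lambda>i. rcomp (bss ! i) (asss ! i) (map rep gs ! i) (map (map rep) fss ! i)) [0..<length cs]"
    using 4 lg by (intro map_cong) auto
  also have "rcomp cs (map concat asss) (rep h) \<dots>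
      = rcomp (concat bss) (concat asss) ?hg (concat (map (map rep) fss))"
    by (rule rcomp_assoc[OF h g, symmetric]) (use 4 f in simp_all)
  finally show ?case
    using l by (simp add: concat_concat_concat)
next
  case (5 a b f)
  then have f: "eqv a b (rep f) (rep f)" "cls a (rep f) = f" by (simp_all add: hom_syn_iff)
  have b: "b \<in> sorts sg" using 5 by simp
  have "eqvs [a] [b] (map rep [f]) [rep f]"
    using f eqv_lists by (simp add: eqvs_Cons eqvs_Nil)
  then show ?case
    using mcomp_syn[OF rep_cls[OF eqv_rid[OF b]], of "[a]" "[f]" "[rep f]"] rcomp_ident_left[OF f(1) b] f(2)
    by (simp add: mident_syn)
next
  case (6 a b f)
  then have f: "eqv a b (rep f) (rep f)" "cls a (rep f) = f" by (simp_all add: hom_syn_iff)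
  have a: "a ! i \<in> sorts sg" if "i < length a" for i using 6 that by auto
  have "eqvs (map (\<lambda>x. [x]) a) a (map rep (map (mident syn) a)) (map rid a)"
    using 6 a by (auto simp: eqvs_def mident_syn intro!: rep_cls eqv_rid)
  then show ?case
    using mcomp_syn[OF f(1)] rcomp_ident_right[OF f(1)] f(2) by simp
next
  case (7 a b f)
  then have f: "eqv a b (rep f) (rep f)" "cls a (rep f) = f" by (simp_all add: hom_syn_iff)
  have p: "pull (fid (length a)) a = a" by (simp add: pull_fid)
  have "fid (length a) \<in> Delta R"
    using structure_category[of b] 7 by (simp add: structure_category_def)
  then show ?case
    using mact_syn[of "fid (length a)" a b f "rep f"] ract_fid[OF f(1)] f p eqv_lists
    by (simp add: fid_def)
next
  case (8 \<sigma> \<tau> a b f)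
  have a: "a \<in> lists (sorts sg)" using 8 by simp
  have f: "eqv (pull (fcomp \<tau> \<sigma>) a) b (rep f) (rep f)" using 8 by (simp add: hom_syn_iff)
  have fin: "is_finmap \<sigma>" "is_finmap \<tau>" using 8 Delta_finmap by auto
  have f': "eqv (pull \<sigma> (pull \<tau> a)) b (rep f) (rep f)" using f pull_fcomp[OF fin(1) 8(3), of a] by simp
  have p: "pull \<tau> a \<in> lists (sorts sg)" using fin a 8 pull_lists by blast
  have D: "fcomp \<tau> \<sigma> \<in> Delta R"
    using structure_category[of b] 8 unfolding structure_category_def by simp
  have lp: "length (pull \<tau> a) = tgt \<sigma>" using 8 by simp
  have "mact syn \<sigma> (pull \<tau> a) b f = cls (pull \<tau> a) (ract \<sigma> (pull \<tau> a) (rep f))"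
    by (rule mact_syn[OF 8(1) lp p f'])
  then have "mact syn \<tau> a b (mact syn \<sigma> (pull \<tau> a) b f) = cls a (ract \<tau> a (ract \<sigma> (pull \<tau> a) (rep f)))"
    using mact_syn[OF 8(2) 8(5) a rep_cls[OF eqv_ract[OF 8(1) lp p f']]] by simp
  moreover have "mact syn (fcomp \<tau> \<sigma>) a b f = cls a (ract (fcomp \<tau> \<sigma>) a (rep f))"
    by (rule mact_syn[OF D _ a f]) (use 8 in \<open>simp add: fcomp_def\<close>)
  ultimately show ?case
    using ract_fcomp[OF 8(1-3) a 8(5) f] by simp
next
  case (9 \<sigma>s bs as c g fs)
  have as: "as \<in> lists (lists (sorts sg))" and c: "c \<in> sorts sg" using 9 by simp_all
  have g: "eqv bs c (rep g) (rep g)" using 9 by (simp add: hom_syn_iff)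
  have f: "eqvs (map2 pull \<sigma>s as) bs (map rep fs) (map rep fs)" using 9 homs_syn by blast
  have la: "length as = length bs" using 9(2,4) by (metis length_map)
  have lf: "length fs = length bs" using f by (simp add: eqvs_def)
  let ?X = "rcomp bs (map2 pull \<sigma>s as) (rep g) (map rep fs)"
  let ?k = "\<lambda>i. ract (\<sigma>s ! i) (as ! i) (rep (fs ! i))"
  have pa: "pull (fsum \<sigma>s) (concat as) = concat (map2 pull \<sigma>s as)"
    using 9 Delta_finmap by (intro pull_fsum) auto
  have D: "fsum \<sigma>s \<in> Delta R" using structure_category[OF c] 9(1) unfolding structure_category_def by blast
  have t: "length (concat as) = tgt (fsum \<sigma>s)" by (simp add: fsum_def length_concat 9)
  have "eqv (concat (map2 pull \<sigma>s as)) c (rep (cls (concat (map2 pull \<sigma>s as)) ?X)) ?X"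
    by (rule rep_cls[OF eqv_rcomp[OF g f]])
  then have r: "mact syn (fsum \<sigma>s) (concat as) c (mcomp syn bs c (map2 pull \<sigma>s as) g fs)
      = cls (concat as) (ract (fsum \<sigma>s) (concat as) ?X)"
    unfolding mcomp_syn[OF g f] pa[symmetric] by (rule mact_syn[OF D t concat_lists[OF as]])
  have fi: "mact syn (\<sigma>s ! i) (as ! i) (bs ! i) (fs ! i) = cls (as ! i) (?k i)"
    "eqv (as ! i) (bs ! i) (rep (cls (as ! i) (?k i))) (?k i)" if "i < length bs" for i
  proof -
    have s: "\<sigma>s ! i \<in> Delta R" using 9(1,2) that by (metis nth_mem subset_code(1))
    have l: "length (as ! i) = tgt (\<sigma>s ! i)" using 9(2,4) that la by (metis nth_map)
    have a: "as ! i \<in> lists (sorts sg)" using in_listsD[OF as] la that nth_mem by metis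
    have e: "eqv (pull (\<sigma>s ! i) (as ! i)) (bs ! i) (rep (fs ! i)) (rep (fs ! i))"
      using f that la lf 9(2) by (simp add: eqvs_def)
    show "mact syn (\<sigma>s ! i) (as ! i) (bs ! i) (fs ! i) = cls (as ! i) (?k i)"
      by (rule mact_syn[OF s l a e])
    show "eqv (as ! i) (bs ! i) (rep (cls (as ! i) (?k i))) (?k i)"
      by (rule rep_cls[OF eqv_ract[OF s l a e]])
  qed
  have "eqvs as bs (map rep (map (\<lambda>i. mact syn (\<sigma>s ! i) (as ! i) (bs ! i) (fs ! i)) [0..<length bs])) (map ?k [0..<length bs])"
    unfolding eqvs_def using as la fi by simp
  then have "mcomp syn bs c as g (map (\<lambda>i. mact syn (\<sigma>s ! i) (as ! i) (bs ! i) (fs ! i)) [0..<length bs])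
      = cls (concat as) (rcomp bs as (rep g) (map ?k [0..<length bs]))"
    by (rule mcomp_syn[OF g])
  also have "map ?k [0..<length bs] = map (\<lambda>i. ract (\<sigma>s ! i) (as ! i) (map rep fs ! i)) [0..<length bs]"
    using lf by simp
  also have "rcomp bs as (rep g) \<dots> = ract (fsum \<sigma>s) (concat as) ?X"
    by (rule rcomp_ract_inner[OF 9(1,2) as 9(4) g f c])
  finally show ?case using r by simp
next
  case (10 \<tau> bs c g as fs)
  have c: "c \<in> sorts sg" using 10 by simp
  have f: "eqvs as bs (map rep fs) (map rep fs)" and bs: "bs \<in> lists (sorts sg)" using 10 homs_syn by blast+
  have fin: "is_finmap \<tau>" using 10 Delta_finmap by auto
  have as: "as \<in> lists (lists (sorts sg))" and la: "length as = tgt \<tau>" and lf: "length fs = tgt \<tau>"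
    using f 10(2) by (simp_all add: eqvs_def)
  have g: "eqv (pull \<tau> bs) c (rep g) (rep g)" using 10 by (simp add: hom_syn_iff)
  let ?\<theta> = "fsim \<tau> (map length as)"
  let ?X = "rcomp (pull \<tau> bs) (pull \<tau> as) (rep g) (map rep (pull \<tau> fs))"
  have pr: "map rep (pull \<tau> fs) = pull \<tau> (map rep fs)" by (rule map_pull[OF fin lf])
  have pf: "eqvs (pull \<tau> as) (pull \<tau> bs) (map rep (pull \<tau> fs)) (map rep (pull \<tau> fs))"
    unfolding pr by (rule pull_eqvs[OF fin 10(2) f])
  have pa: "pull ?\<theta> (concat as) = concat (pull \<tau> as)" by (rule pull_fsim[OF fin la])
  have D: "?\<theta> \<in> Delta R" using structure_category[OF c] 10(1) la unfolding structure_category_def by simp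
  have t: "length (concat as) = tgt ?\<theta>" by (simp add: fsim_def length_concat)
  have "eqv (concat (pull \<tau> as)) c (rep (cls (concat (pull \<tau> as)) ?X)) ?X"
    by (rule rep_cls[OF eqv_rcomp[OF g pf]])
  then have r: "mact syn ?\<theta> (concat as) c (mcomp syn (pull \<tau> bs) c (pull \<tau> as) g (pull \<tau> fs))
      = cls (concat as) (ract ?\<theta> (concat as) ?X)"
    unfolding mcomp_syn[OF g pf] pa[symmetric] by (rule mact_syn[OF D t concat_lists[OF as]])
  have "mact syn \<tau> bs c g = cls bs (ract \<tau> bs (rep g))"
    by (rule mact_syn[OF 10(1,2) bs g])
  moreover have "eqv bs c (rep (cls bs (ract \<tau> bs (rep g)))) (ract \<tau> bs (rep g))"
    by (rule rep_cls[OF eqv_ract[OF 10(1,2) bs g]])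
  ultimately have "mcomp syn bs c as (mact syn \<tau> bs c g) fs
      = cls (concat as) (rcomp bs as (ract \<tau> bs (rep g)) (map rep fs))"
    using f by (simp add: mcomp_syn)
  then show ?case
    using r rcomp_ract_outer[OF 10(1,2) bs g f c] pr by simp
qed


section \<open>The model in the syntactic multicategory and its values\<close>

lemma eqv_generator:
  assumes "f \<in> funs sg"
  shows "eqv (fdom sg f) (fcod sg f) (Fun f (map Var (cctx (fdom sg f)))) (Fun f (map Var (cctx (fdom sg f))))"
proof -
  have a: "fdom sg f \<in> lists (sorts sg)" using assms wf by (simp add: wf_signature_def)
  note v = cctx[OF a]
  have "has_sort sg (Var (cctx (fdom sg f) ! i)) (fdom sg f ! i)" if "i < length (fdom sg f)" for i
  proof -
    have "cctx (fdom sg f) ! i \<in> vars sg" using v(4,6) that nth_mem by (metis subset_code(1))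
    moreover have "vsort sg (cctx (fdom sg f) ! i) = fdom sg f ! i" using v(2,4) that by (metis nth_map)
    ultimately show ?thesis using has_sort_Var by metis
  qed
  then have "list_all2 (has_sort sg) (map Var (cctx (fdom sg f))) (fdom sg f)"
    using v(4) by (auto simp: list_all2_conv_all_nth)
  then have "has_sort sg (Fun f (map Var (cctx (fdom sg f)))) (fcod sg f)"
    by (rule has_sort_Fun[OF assms])
  then show ?thesis
    using a v(5) by (auto simp: eqv_def comp_def intro: deduct_refl)
qed

lemma multicat_model_syn: "multicat_model sg R tc syn syn_model"
proof (intro multicat_model.intro multicat_model_axioms.intro)
  show "modelable_signature sg R tc" by unfold_locales
  show "multicategory (Delta R) syn" by (rule multicategory_syn)
  show "is_model sg syn syn_model"
    using eqv_generator by (auto simp: is_model_def syn_model_def intro: cls_hom)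
qed

lemma syn_model_simps:
  "msort syn_model = (\<lambda>s. s)" "mfun syn_model f = cls (fdom sg f) (Fun f (map Var (cctx (fdom sg f))))"
  by (simp_all add: syn_model_def)

lemma mctx_syn_model: "mctx sg syn_model v = map (vsort sg) v"
  by (simp add: mctx_def syn_model_def)

lemma eqv_rename:
  assumes "has_sort sg t b" "R v (tau t)"
  shows "eqv (map (vsort sg) v) b (inst v (map Var (cctx (map (vsort sg) v))) t)
     (inst v (map Var (cctx (map (vsort sg) v))) t)"
proof -
  have a: "map (vsort sg) v \<in> lists (sorts sg)"
    using vsort_lists R_context(2)[OF assms(2)] .
  note w = cctx[OF a]
  have t: "ded v t t" using assms by (rule deduct_refl)
  show ?thesis
    unfolding eqv_def using a ded_rename[OF t w(5)] rename_has_sort[OF t assms(1) w(6)] w(2) by simp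
qed

text \<open>A term is interpreted by itself, renamed into the standard context of its source word.
  The subterms arrive renamed from their terminal contexts; \<open>ev_rcomp\<close> merges all these
  renamings into one substitution.\<close>

lemma cval_syn:
  "has_sort sg t b \<Longrightarrow> R v (tau t) \<Longrightarrow> cval sg tc syn syn_model v t
    = cls (map (vsort sg) v) (inst v (map Var (cctx (map (vsort sg) v))) t)"
proof (induction arbitrary: v rule: has_sort.induct)
  case (has_sort_Var x)
  let ?a = "map (vsort sg) v" and ?b = "vsort sg x" and ?\<theta> = "theta_of v [x]"
  have R: "R v [x]" using has_sort_Var(2) by simp
  note th = theta_of[OF R_vars[OF R]]
  have a: "?a \<in> lists (sorts sg)" using vsort_lists R_context(2)[OF R] .
  have b: "?b \<in> sorts sg" using has_sort_Var(1) wf by (simp add: wf_signature_def)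
  have p: "pull ?\<theta> ?a = [?b]" using th by (simp add: map_pull[symmetric])
  have "pull ?\<theta> (map Var (cctx ?a)) = [env v (map Var (cctx ?a)) x :: ('f, 'v) trm]"
    using pull_map_env[OF R_vars[OF R] R_context(1)[OF R], of "map Var (cctx ?a) :: ('f, 'v) trm list"] cctx(4)[OF a] by simp
  then have "ract ?\<theta> ?a (rid ?b) = env v (map Var (cctx ?a)) x"
    by (simp add: ract_def p ev_rid[OF b])
  moreover have "mact syn ?\<theta> ?a ?b (cls [?b] (rid ?b)) = cls ?a (ract ?\<theta> ?a (rid ?b))"
    by (rule mact_syn) (use theta_of_Delta[OF R] th a rep_cls[OF eqv_rid[OF b]] p in simp_all)
  ultimately show ?case
    by (simp add: mres_def mctx_syn_model mident_syn inst_def syn_model_simps)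
next
  case (has_sort_Fun f ts)
  note tcs = R_concat_tc[OF has_sort_Fun(3)]
  let ?u = "\<lambda>t. tc (tau t)" and ?a = "map (vsort sg) v"
  let ?w = "\<lambda>t. map (vsort sg) (?u t)"
  let ?us = "concat (map ?u ts)" and ?F = "Fun f (map Var (cctx (fdom sg f)))"
  let ?r = "\<lambda>t. inst (?u t) (map Var (cctx (?w t))) t"
  \<comment> \<open>The renaming from \<open>v\<close> to its standard context. The two renamings
    that a subterm undergoes will reduce to this one.\<close>
  define e :: "'v \<Rightarrow> ('f, 'v) trm" where "e = env v (map Var (cctx ?a))"
  let ?\<theta> = "theta_of v ?us"
  note th = theta_of[OF R_vars[OF tcs(1)]]
  have lts: "list_all2 (has_sort sg) ts (fdom sg f)"
    using has_sort_Fun(2) by (rule list.rel_mono_strong) simp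
  have l: "length (fdom sg f) = length ts" using list_all2_lengthD[OF lts] by simp
  have F: "eqv (fdom sg f) (fcod sg f) ?F ?F" by (rule eqv_generator[OF has_sort_Fun(1)])
  note fd = eqv_lists[OF F]
  have a: "?a \<in> lists (sorts sg)" using vsort_lists R_context(2)[OF has_sort_Fun(3)] .
  have w: "?w t \<in> lists (sorts sg)" if "t \<in> set ts" for t
    using vsort_lists R_context(2)[OF tcs(2)[OF that]] .
  have IH: "map (\<lambda>t. cval sg tc syn syn_model (?u t) t) ts = map (\<lambda>t. cls (?w t) (?r t)) ts"
  proof (rule map_cong[OF refl])
    fix t assume t: "t \<in> set ts"
    then obtain i where "i < length ts" "t = ts ! i" by (auto simp: in_set_conv_nth)
    with list_all2_nthD[OF has_sort_Fun(2), of i] tcs(2)[OF t]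
    show "cval sg tc syn syn_model (?u t) t = cls (?w t) (?r t)" by blast
  qed
  have r: "eqv (?w (ts ! i)) (fdom sg f ! i) (?r (ts ! i)) (?r (ts ! i))" if "i < length ts" for i
    using eqv_rename[OF list_all2_nthD[OF lts that] tcs(2)] that by simp
  have ws: "map ?w ts \<in> lists (lists (sorts sg))"
    using w by (intro in_listsI) auto
  have rs: "eqvs (map ?w ts) (fdom sg f) (map ?r ts) (map ?r ts)"
    unfolding eqvs_def using ws r l by simp
  have rs': "eqvs (map ?w ts) (fdom sg f) (map rep (map (\<lambda>t. cls (?w t) (?r t)) ts)) (map ?r ts)"
    unfolding eqvs_def using ws rep_cls[OF r] l by simp
  let ?X = "rcomp (fdom sg f) (map ?w ts) ?F (map ?r ts)"
  have X: "eqv (concat (map ?w ts)) (fcod sg f) ?X ?X" by (rule eqv_rcomp[OF F rs])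
  have p: "pull ?\<theta> ?a = concat (map ?w ts)"
    using th by (simp add: map_pull[symmetric] map_concat comp_def)
  have X': "eqv (pull ?\<theta> ?a) (fcod sg f) (rep (cls (concat (map ?w ts)) ?X)) ?X"
    unfolding p by (rule rep_cls[OF X])
  have "cval sg tc syn syn_model v (Fun f ts) = mact syn ?\<theta> ?a (fcod sg f)
      (mcomp syn (fdom sg f) (fcod sg f) (map ?w ts) (cls (fdom sg f) ?F) (map (\<lambda>t. cls (?w t) (?r t)) ts))"
    unfolding cval.simps IH by (simp add: mres_def mctx_syn_model syn_model_simps)
  also have "mcomp syn (fdom sg f) (fcod sg f) (map ?w ts) (cls (fdom sg f) ?F) (map (\<lambda>t. cls (?w t) (?r t)) ts)
      = cls (concat (map ?w ts)) ?X"
    by (rule mcomp_syn[OF rep_cls[OF F] rs'])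
  also have "mact syn ?\<theta> ?a (fcod sg f) \<dots> = cls ?a (ract ?\<theta> ?a ?X)"
    by (rule mact_syn[OF theta_of_Delta[OF tcs(1)] _ a X']) (simp add: th)
  also have "ract ?\<theta> ?a ?X = ev (concat (map ?w ts)) ?X (concat (map (\<lambda>t. map e (?u t)) ts))"
    using pull_map_env[OF R_vars[OF tcs(1)] R_context(1)[OF tcs(1)], of "map Var (cctx ?a) :: ('f, 'v) trm list"] cctx(4)[OF a]
    by (simp add: ract_def p e_def map_concat comp_def)
  also have "\<dots> = ev (fdom sg f) ?F (map3 ev (map ?w ts) (map ?r ts) (map (\<lambda>t. map e (?u t)) ts))"
    by (rule ev_rcomp[OF F rs]) simp
  also have "map3 ev (map ?w ts) (map ?r ts) (map (\<lambda>t. map e (?u t)) ts) = map (subst e) ts"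
    unfolding map3_map
  proof (rule map_cong[OF refl])
    fix t assume t: "t \<in> set ts"
    note c = cctx[OF w[OF t]] and d = R_context(1)[OF tcs(2)[OF t]] and s = R_vars[OF tcs(2)[OF t]]
    let ?s = "env (cctx (?w t)) (map e (?u t))"
    \<comment> \<open>The variables of \<open>cctx (?w t)\<close> are only intermediate names,
      introduced by \<open>?r\<close> and replaced by the outer instantiation.\<close>
    have "ev (?w t) (?r t) (map e (?u t)) = inst (?u t) (map ?s (cctx (?w t))) t"
      unfolding inst_def[of "cctx (?w t)"] using d s c(4) by (subst subst_inst) (simp_all add: comp_def)
    also have "map ?s (cctx (?w t)) = map e (?u t)"
      using c(3,4) by (simp add: map_env)
    also have "inst (?u t) (map e (?u t)) t = subst e t"
      by (rule inst_map[OF d s])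
    finally show "ev (?w t) (?r t) (map e (?u t)) = subst e t" .
  qed
  also have "ev (fdom sg f) ?F (map (subst e) ts) = Fun f (map (subst e) ts)"
    using map_env[of "cctx (fdom sg f)" "map (subst e) ts"] cctx(3,4)[OF fd] l
    by (simp add: inst_def comp_def)
  also have "\<dots> = inst v (map Var (cctx ?a)) (Fun f ts)"
    by (simp add: inst_def e_def)
  finally show ?case .
qed

text \<open>Renaming between \<open>v\<close> and its standard context is invertible and preserves
  provability both ways, so equality of classes amounts to provability in \<open>v\<close>
  itself.\<close>

lemma cval_syn_eq_iff:
  assumes "R_equation sg R (v, t1, t2)"
  shows "cval sg tc syn syn_model v t1 = cval sg tc syn syn_model v t2 \<longleftrightarrow> ded v t1 t2"
proof -
  from assms obtain b where s: "has_sort sg t1 b" "has_sort sg t2 b" and Rt: "R v (tau t1)" "R v (tau t2)"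
    by (auto simp: R_equation_def)
  let ?a = "map (vsort sg) v"
  let ?r = "inst v (map Var (cctx ?a)) :: ('f, 'v) trm \<Rightarrow> ('f, 'v) trm"
  have v: "is_context (vars sg) v" using R_domain Rt by blast
  have a: "?a \<in> lists (sorts sg)" using vsort_lists v by (simp add: is_context_def)
  note w = cctx[OF a]
  have unrename: "inst (cctx ?a) (map Var v) (?r t) = t" if "R v (tau t)" for t
  proof -
    let ?s = "env (cctx ?a) (map Var v)"
    have "inst (cctx ?a) (map Var v) (?r t) = inst v (map ?s (cctx ?a)) t"
      unfolding inst_def[of "cctx ?a"] using R_context(1)[OF that] R_vars[OF that] w(4)
      by (subst subst_inst) (simp_all add: comp_def)
    also have "map ?s (cctx ?a) = map Var v"
      using w(3,4) by (simp add: map_env)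
    finally show ?thesis
      using R_context(1)[OF that] R_vars[OF that] by (simp add: inst_Var)
  qed
  have "cval sg tc syn syn_model v t1 = cval sg tc syn syn_model v t2 \<longleftrightarrow> ded (cctx ?a) (?r t1) (?r t2)"
    using cls_eqD[OF eqv_rename[OF s(2) Rt(2)]] cls_eq[of ?a b "?r t1" "?r t2"]
      eqv_rename[OF s(1) Rt(1)] by (auto simp: cval_syn[OF s(1) Rt(1)] cval_syn[OF s(2) Rt(2)] eqv_def)
  also have "\<dots> \<longleftrightarrow> ded v t1 t2"
  proof
    assume "ded (cctx ?a) (?r t1) (?r t2)"
    from ded_rename[OF this R_refl[OF v]] show "ded v t1 t2"
      using w(2) unrename Rt by simp
  next
    assume "ded v t1 t2"
    from ded_rename[OF this w(5)] show "ded (cctx ?a) (?r t1) (?r t2)"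
      using w(2) by simp
  qed
  finally show ?thesis .
qed

end

theorem theorem4p4:
  fixes sg :: "('s, 'f, 'v) signature"
    and R :: "'v list \<Rightarrow> 'v list \<Rightarrow> bool"
    and E :: "('f, 'v) eqn set"
    and tc :: "'v list \<Rightarrow> 'v list"
    and A :: "('s msrt, ('s, 'f) msym, 'c) algebra"
    and C :: "('s, 'c) multicat"
    and m :: "('s, 'f, 's, 'c) model"
  assumes "wf_signature sg"
    and "context_structure (vars sg) R"
    and "modelable R"
    and "R_theory sg R E"
    and "terminal_choice (vars sg) R tc"
    and "initial_alg_model TYPE('c) (ext_signature sg R) (mc_theory sg R tc E) A"
    and "initial_alg_model TYPE(('s, 'f) mtrm set) (ext_signature sg R) (mc_theory sg R tc E) A"
    and "C = alg_multicat sg A"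
    and "m = alg_universal_model A"
  shows
    "multicat_with_model sg R E C m \<and>
     (\<forall>(D :: ('o, 'd) multicat) (n :: ('s, 'f, 'o, 'd) model).
        multicat_with_model sg R E D n \<longrightarrow>
        (\<exists>F G. multicat_with_model_morphism sg R C m D n F G \<and>
           (\<forall>F' G'. multicat_with_model_morphism sg R C m D n F' G' \<longrightarrow>
              multicat_morphism_eq C F' G' F G))) \<and>
     (\<forall>\<phi>. R_equation sg R \<phi> \<longrightarrow>
        (\<phi> \<in> deduct sg R E \<longleftrightarrow> models_eqn sg R C m \<phi>))"
proof -
  let ?S = "ext_signature sg R" and ?T = "mc_theory sg R tc E"
  interpret context_structure "vars sg" R by (rule assms(2))
  interpret theory_over sg R tc E
    by unfold_locales (use assms in auto)
  have algA: "is_algebra ?S A" and modA: "\<forall>\<phi>\<in>?T. alg_models_eqn ?S A \<phi>"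
    using assms(6) by (simp_all add: initial_alg_model_def alg_model_def)
  have sortsS: "\<forall>f\<in>funs ?S. fdom ?S f \<in> lists (sorts ?S) \<and> fcod ?S f \<in> sorts ?S"
    using ext_signature_sorts[OF wf] by blast
  have mcC: "multicategory (Delta R) C"
    unfolding assms(8) using algA modA by (intro multicategory_alg_multicat) (auto simp: mc_theory_def)
  have C [simp]: "obj C = sorts sg" "\<And>a b. hom C a b = carrier A (a, b)"
    "\<And>bs c as g fs. mcomp C bs c as g fs = interp A (CompS bs c as) (g # fs)"
    "\<And>c. mident C c = interp A (IdS c) []"
    "\<And>\<theta> a b f. mact C \<theta> a b f = interp A (ActS \<theta> a b) [f]"
    by (simp_all add: assms(8))
  have m [simp]: "msort m = (\<lambda>s. s)" "\<And>f. mfun m f = interp A (ConstS f) []"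
    by (simp_all add: assms(9) alg_universal_model_def)
  have modelC: "is_model sg C m"
    using algA[unfolded is_algebra_def, rule_format, of "ConstS _" "[]"] by (simp add: is_model_def)
  interpret C: multicat_model sg R tc C m
    by (intro multicat_model.intro multicat_model_axioms.intro mcC modelC) unfold_locales
  have "C.interprets A" by (simp add: C.interprets_def)
  then have evalA: "eval_alg A e (N_term sg tc v t) = cval sg tc C m v t" if "has_sort sg t b" for e v t b
    using C.eval_N_term that by blast
  have modelsE: "\<forall>\<phi>\<in>E. models_eqn sg R C m \<phi>"
  proof
    fix \<phi> assume \<phi>: "\<phi> \<in> E"
    obtain v t1 t2 where eq: "\<phi> = (v, t1, t2)" by (cases \<phi>)
    have Req: "R_equation sg R (v, t1, t2)" using \<phi> theory_E by (auto simp: R_theory_def eq)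
    have "([], N_term sg tc v t1, N_term sg tc v t2) \<in> ?T"
      using \<phi> by (auto simp: eq mc_theory_def tilde_theory_def)
    \<comment> \<open>The equations of \<open>tilde_theory\<close> have the empty context, so every
      valuation is admissible, and \<open>evalA\<close> identifies the two sides with values in
      \<open>C\<close>.\<close>
    then have "eval_alg A e (N_term sg tc v t1) = eval_alg A e (N_term sg tc v t2)" for e
      using modA by (fastforce simp: alg_models_eqn_def)
    then show "models_eqn sg R C m \<phi>"
      using Req evalA unfolding eq C.models_eqn_val[OF Req] by (auto simp: R_equation_def)
  qed
  \<comment> \<open>Existence draws on initiality against sets of terms, where the quotient of terms
    built from \<open>B\<close> lives.\<close>
  have ex_hom: "\<exists>h. alg_hom ?S A B h" if "alg_model ?S ?T B" for B :: "('s msrt, ('s, 'f) msym, 'z) algebra"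
    using ex_alg_hom[OF sortsS assms(7) that] mc_theory_vars by blast
  have initial: "\<exists>F G. multicat_with_model_morphism sg R C m D n F G \<and>
           (\<forall>F' G'. multicat_with_model_morphism sg R C m D n F' G' \<longrightarrow> multicat_morphism_eq C F' G' F G)"
    if D: "multicat_with_model sg R E D n" for D :: "('o, 'd) multicat" and n :: "('s, 'f, 'o, 'd) model"
  proof -
    have mcD: "multicategory (Delta R) D" and modelD: "is_model sg D n"
      using D by (simp_all add: multicat_with_model_def)
    interpret D: multicat_model sg R tc D n
      by (intro multicat_model.intro multicat_model_axioms.intro mcD modelD) unfold_locales
    have "alg_model ?S ?T D.Alg"
      using D.model_algebra_mc_theory[OF theory_E] D by (simp add: multicat_with_model_def)
    then obtain h where h: "alg_hom ?S A D.Alg h" using ex_hom by blast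
    then have h_carrier: "\<And>s x. s \<in> lists (sorts sg) \<times> sorts sg \<Longrightarrow> x \<in> carrier A s \<Longrightarrow> h s x \<in> carrier D.Alg s"
      and h_interp: "\<And>f xs. f \<in> funs ?S \<Longrightarrow> list_all2 (\<lambda>x s. x \<in> carrier A s) xs (msym_dom sg f) \<Longrightarrow>
        h (msym_cod sg f) (interp A f xs) = interp D.Alg f (map2 h (msym_dom sg f) xs)"
      unfolding alg_hom_def ext_signature_simps by blast+
    \<comment> \<open>A homomorphism of algebras at the sort \<open>(a, b)\<close> is a map on the
      multimorphisms from \<open>a\<close> to \<open>b\<close>; the accompanying map on objects is
      \<open>msort n\<close>.\<close>
    define G where "G = (\<lambda>a b. h (a, b))"
    have "multicat_morphism (Delta R) C D (msort n) G"
      unfolding multicat_morphism_def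
    proof (intro conjI ballI allI impI, goal_cases)
      case (1 a)
      then show ?case using D.msort_obj by simp
    next
      case (2 a b f)
      then show ?case using h_carrier[of "(a, b)" f] by (simp add: G_def)
    next
      case (3 bs c as g fs)
      then have "homs (alg_multicat sg A) as bs fs" by (simp add: assms(8))
      then have fs: "bs \<in> lists (sorts sg)" "as \<in> lists (lists (sorts sg))" "length as = length bs"
        "list_all2 (\<lambda>x s. x \<in> carrier A s) fs (zip as bs)"
        unfolding homs_alg_multicat by blast+
      have "map2 h (zip as bs) fs = map (\<lambda>i. G (as ! i) (bs ! i) (fs ! i)) [0..<length bs]"
        using fs(3) list_all2_lengthD[OF fs(4)] by (intro nth_equalityI) (simp_all add: G_def)
      then show ?case
        using h_interp[of "CompS bs c as" "g # fs"] 3 fs by (simp add: G_def)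
    next
      case (4 a)
      then show ?case using h_interp[of "IdS a" "[]"] by (simp add: G_def)
    next
      case (5 \<theta> a b f)
      then show ?case using h_interp[of "ActS \<theta> a b" "[f]"] by (simp add: G_def)
    qed
    moreover have "G (fdom sg f) (fcod sg f) (interp A (ConstS f) []) = mfun n f" if "f \<in> funs sg" for f
      using h_interp[of "ConstS f" "[]"] that by (simp add: G_def)
    ultimately have "multicat_with_model_morphism sg R C m D n (msort n) G"
      by (simp add: multicat_with_model_morphism_def)
    moreover have "multicat_morphism_eq C F' G' (msort n) G"
      if FG: "multicat_with_model_morphism sg R C m D n F' G'" for F' G'
    proof -
      \<comment> \<open>The objects of \<open>C\<close> are the sorts, so the map on objects is
        forced. The maps on multimorphisms assemble into a homomorphism \<open>h'\<close> of
        algebras, to which \<open>alg_hom_unique\<close> applies.\<close>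
      have F': "F' s = msort n s" if "s \<in> sorts sg" for s
        using FG that by (simp add: multicat_with_model_morphism_def)
      have Fl: "map F' a = map (msort n) a" if "a \<in> lists (sorts sg)" for a
        using that F' by auto
      have Fll: "map (map F') as = map (map (msort n)) as" if "as \<in> lists (lists (sorts sg))" for as
        using that Fl by (meson in_listsD map_cong)
      have mor: "multicat_morphism (Delta R) C D F' G'"
        and G'_const: "\<And>f. f \<in> funs sg \<Longrightarrow> G' (fdom sg f) (fcod sg f) (interp A (ConstS f) []) = mfun n f"
        using FG by (simp_all add: multicat_with_model_morphism_def)
      define h' where "h' = (\<lambda>(a, b). G' a b)"
      have h': "alg_hom ?S A D.Alg h'"
        unfolding alg_hom_def ext_signature_simps
      proof (intro conjI ballI allI impI)
        fix s x assume "s \<in> lists (sorts sg) \<times> sorts sg" "x \<in> carrier A s"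
        then obtain a b where ab: "s = (a, b)" "a \<in> lists (sorts sg)" "b \<in> sorts sg" "x \<in> carrier A (a, b)"
          by auto
        have "\<forall>a\<in>lists (obj C). \<forall>b\<in>obj C. \<forall>f\<in>hom C a b. G' a b f \<in> hom D (map F' a) (F' b)"
          using mor by (simp add: multicat_morphism_def del: in_lists_conv_set)
        then have "G' a b x \<in> hom D (map F' a) (F' b)"
          using ab unfolding C by blast
        then show "h' s x \<in> carrier D.Alg s"
          unfolding Fl[OF ab(2)] F'[OF ab(3)] by (simp add: h'_def ab(1))
      next
        fix f xs assume f: "f \<in> funs ?S" and xs: "list_all2 (\<lambda>x s. x \<in> carrier A s) xs (msym_dom sg f)"
        show "h' (msym_cod sg f) (interp A f xs) = interp D.Alg f (map2 h' (msym_dom sg f) xs)"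
        proof (cases f)
          case (CompS bs c as)
          then obtain g fs where gs: "xs = g # fs" "g \<in> carrier A (bs, c)"
            "list_all2 (\<lambda>x s. x \<in> carrier A s) fs (zip as bs)"
            using xs by (auto simp: list_all2_Cons2)
          have t: "bs \<in> lists (sorts sg)" "c \<in> sorts sg" "as \<in> lists (lists (sorts sg))" "length as = length bs"
            using f CompS by simp_all
          have "homs C as bs fs"
            unfolding assms(8) homs_alg_multicat using t gs(3) by blast
          then have "G' (concat as) c (interp A (CompS bs c as) (g # fs))
            = mcomp D (map F' bs) (F' c) (map (map F') as) (G' bs c g)
                (map (\<lambda>i. G' (as ! i) (bs ! i) (fs ! i)) [0..<length bs])"
            using mor t gs(2) by (simp add: multicat_morphism_def)
          moreover have "map2 h' (zip as bs) fs = map (\<lambda>i. G' (as ! i) (bs ! i) (fs ! i)) [0..<length bs]"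
            using t(4) list_all2_lengthD[OF gs(3)] by (intro nth_equalityI) (simp_all add: h'_def)
          ultimately show ?thesis
            using CompS gs(1) Fl[OF t(1)] F'[OF t(2)] Fll[OF t(3)] by (simp add: h'_def del: map_eq_conv)
        next
          case (IdS c)
          then show ?thesis using mor f xs F' by (simp add: multicat_morphism_def h'_def)
        next
          case (ActS \<theta> a b)
          then obtain y where y: "xs = [y]" "y \<in> carrier A (pull \<theta> a, b)"
            using xs by (auto simp: list_all2_Cons2)
          have t: "\<theta> \<in> Delta R" "a \<in> lists (sorts sg)" "length a = tgt \<theta>" "b \<in> sorts sg"
            using f ActS by simp_all
          have "G' a b (interp A (ActS \<theta> a b) [y]) = mact D \<theta> (map F' a) (F' b) (G' (pull \<theta> a) b y)"
            using mor t y(2) by (simp add: multicat_morphism_def)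
          then show ?thesis
            using ActS y(1) Fl[OF t(2)] F'[OF t(4)] by (simp add: h'_def del: map_eq_conv)
        next
          case (ConstS k)
          then show ?thesis using G'_const f xs by (simp add: h'_def)
        qed
      qed
      have "h' s x = h s x" if "s \<in> lists (sorts sg) \<times> sorts sg" "x \<in> carrier A s" for s x
        using alg_hom_unique[OF sortsS assms(6) h' h] that by simp
      then have "G' a b f = G a b f" if "a \<in> lists (sorts sg)" "b \<in> sorts sg" "f \<in> carrier A (a, b)" for a b f
        using that unfolding G_def h'_def by fastforce
      then show ?thesis
        using F' by (simp add: multicat_morphism_eq_def)
    qed
    ultimately show ?thesis by blast
  qed
  have complete: "\<phi> \<in> deduct sg R E \<longleftrightarrow> models_eqn sg R C m \<phi>" if "R_equation sg R \<phi>" for \<phi>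
  proof -
    obtain v t1 t2 where \<phi>: "\<phi> = (v, t1, t2)" by (cases \<phi>)
    have Req: "R_equation sg R (v, t1, t2)" using that \<phi> by simp
    then obtain b where s: "has_sort sg t1 b" "has_sort sg t2 b" and Rt: "R v (tau t1)" "R v (tau t2)"
      by (auto simp: R_equation_def)
    interpret syn: multicat_model sg R tc syn syn_model by (rule multicat_model_syn)
    have "models_eqn sg R syn syn_model \<psi>" if "\<psi> \<in> E" for \<psi>
    proof -
      obtain w u1 u2 where \<psi>: "\<psi> = (w, u1, u2)" by (cases \<psi>)
      have "R_equation sg R (w, u1, u2)" using that theory_E by (auto simp: R_theory_def \<psi>)
      then show ?thesis
        using that cval_syn_eq_iff syn.models_eqn_val deduct_ax unfolding \<psi> by blast
    qed
    then have "alg_model ?S ?T syn.Alg"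
      by (intro syn.model_algebra_mc_theory[OF theory_E]) blast
    then obtain h where h: "alg_hom ?S A syn.Alg h" using ex_hom by blast
    \<comment> \<open>Both values of \<open>t\<close> are values of the closed term
      \<open>N_term sg tc v t\<close>, in \<open>A\<close> and in \<open>syn.Alg\<close>, and
      \<open>h\<close> preserves these.\<close>
    have hval: "h (map (vsort sg) v, b) (cval sg tc C m v t) = cval sg tc syn syn_model v t"
      if "has_sort sg t b" "R v (tau t)" for t
      using alg_hom_eval[OF algA h N_term_ground[OF that]] evalA[OF that(1)]
        syn.eval_N_term[OF syn.interprets_model_algebra that(1)] by metis
    show ?thesis
    proof
      assume "\<phi> \<in> deduct sg R E"
      then show "models_eqn sg R C m \<phi>"
        using C.deduct_sound[OF theory_E modelsE] C.models_eqn_val[OF Req] by (simp add: \<phi>)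
    next
      assume "models_eqn sg R C m \<phi>"
      then have "cval sg tc C m v t1 = cval sg tc C m v t2"
        using C.models_eqn_val[OF Req] by (simp add: \<phi>)
      then have "cval sg tc syn syn_model v t1 = cval sg tc syn syn_model v t2"
        using hval[OF s(1) Rt(1)] hval[OF s(2) Rt(2)] by simp
      then show "\<phi> \<in> deduct sg R E"
        using cval_syn_eq_iff[OF Req] by (simp add: \<phi>)
    qed
  qed
  show ?thesis
    using mcC modelC modelsE initial complete by (auto simp: multicat_with_model_def)
qed

end
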